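(* Let $A=C^*(\Gamma)$ be the group C*-algebra of the infinite dihedral group $\Gamma=\mathbf{Z}\times_\sigma\mathbf{Z}_2$, with unitary generators $S,e$, and let $\mathbf{w}_0,\mathbf{w}_1,\mathbf{w}_2$ be the even Fredholm modules over $A$ described in the context. The pairings $\langle \mathrm{ch}_*(\mathbf{w}_i),[P]\rangle$ with the K-theory classes of the projections $P = 1,\ \tfrac12(1+e),\ \tfrac12(1+Se)$ are: $$\begin{array}{c|ccc} & 1 & \tfrac12(1+e) & \tfrac12(1+Se)\\ \hline \mathbf{w}_0 & 1&1&1\\ \mathbf{w}_1&0&1&0\\ \mathbf{w}_2&0&0&1\end{array}$$
   Context: The infinite dihedral group $\Gamma$ is the semidirect product of $\mathbf{Z}$ by $\mathbf{Z}_2$ acting by inversion. $A=C^*(\Gamma)$ is generated by unitaries $S$ and $e$ with $e=e^*$, $e^2=1$, $eSe=S^*=S^{-1}$. An even Fredholm module over a *-algebra $A$ is $(H,\pi,F,\gamma)$, where $\pi$ is a *-representation of $A$ by bounded operators on the Hilbert space $H$, $F\in \mathbf{B}(H)$ is selfadjoint with $F^2=1$ and $[F,\pi(a)]$ compact for all $a\in A$, and $\gamma=\gamma^*$, $\gamma^2=1$, $[\gamma,\pi(a)]=0$ for all $a$, $F\gamma=-\gamma F$. $\mathrm{ch}_*$ is Connes' even Chern character from even K-homology to even periodic cyclic cohomology, and $\langle\cdot,\cdot\rangle$ is Connes' pairing of periodic cyclic cohomology with K-theory. For the modules considered and a projection $P\in\{1,\ \tfrac12(1+e),\ \tfrac12(1+Se)\}$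 in $A$, $\langle \mathrm{ch}_*(H,\pi,F,\gamma),[P]\rangle=\lim_{n\to\infty}(n!)^{-1}\psi_{2n}(P,\dots,P)$, where $\psi_{2n}(a_0,\dots,a_{2n})=(-1)^{n(2n-1)}\Gamma(n+1)\,\mathrm{Tr}(\gamma\pi(a_0)[F,\pi(a_1)]\cdots[F,\pi(a_{2n})])$ (here $\Gamma(n+1)=n!$). The modules: (0) $\mathbf{w}_0 = \left(\mathbf{C}^2,\ \phi\oplus 0,\ \begin{pmatrix}0&1\\1&0\end{pmatrix},\ \begin{pmatrix}1&0\\0&-1\end{pmatrix}\right)$, where $\phi:A\to\mathbf{C}$ is the *-homomorphism with $\phi(S)=\phi(e)=1$. (1) Let $A$ act on $l^2(\mathbf{Z})$, with orthonormal basis $\{e_n\}_{n\in\mathbf{Z}}$, by $Se_n=e_{n+1}$, $e\,e_n=e_{-n}$. Let $Fe_n=\mathrm{sign}(n)e_n$, with $\mathrm{sign}(n)=1$ for $n\ge 0$ and $-1$ for $n<0$. Put $H=l^2(\mathbf{Z})\oplus l^2(\mathbf{Z})$, $\pi_1(S)=\begin{pmatrix}S&0\\0&S\end{pmatrix}$, $\pi_1(e)=\begin{pmatrix}e&0\\0&-e\end{pmatrix}$, $F_1=\begin{pmatrix}0&iF\\-iF&0\end{pmatrix}$, $\gamma=\begin{pmatrix}1&0\\0&-1\end{pmatrix}$. Then $\mathbf{w}_1=(H,\pi_1,F_1,\gamma)$. (2) $\mathbf{w}_2=(H,\pi_2,F_1,\gamma)$ with $H,F_1,\gamma$ as in (1)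 and $\pi_2=\pi_1\circ\alpha_{-1}$, where $\alpha_{-1}$ is the automorphism of $A$ with $\alpha_{-1}(S)=S$, $\alpha_{-1}(e)=S^{-1}e$. Equivalently, $\pi_2$ is given by the same matrix formulas as $\pi_1$, but using the action $Se_n=e_{n+1}$, $e\,e_n=e_{-(n+1)}$ on $l^2(\mathbf{Z})$. *)

theory Defs
  imports
    "HOL-Analysis.Analysis"
    "HOL-Algebra.Elementary_Groups"
begin

section \<open>Complex vector spaces, Hilbert spaces and C*-algebras\<close>

class complex_vector = real_vector +
  fixes scaleC :: "complex \<Rightarrow> 'a \<Rightarrow> 'a"  (infixr "*\<^sub>C" 75)
  assumes scaleC_add_right: "c *\<^sub>C (x + y) = c *\<^sub>C x + c *\<^sub>C y"
    and scaleC_add_left: "(c + d) *\<^sub>C x = c *\<^sub>C x + d *\<^sub>C x"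
    and scaleC_scaleC: "c *\<^sub>C (d *\<^sub>C x) = (c * d) *\<^sub>C x"
    and scaleC_of_real: "complex_of_real r *\<^sub>C x = r *\<^sub>R x"

text \<open>The inner product \<open>cinner\<close> is conjugate linear in its first argument.
  The topology and the norm are those of the underlying real Hilbert space.\<close>

class complex_hilbert = complex_vector + real_inner + complete_space +
  fixes cinner :: "'a \<Rightarrow> 'a \<Rightarrow> complex"
  assumes cinner_commute: "cinner x y = cnj (cinner y x)"
    and cinner_add_right: "cinner x (y + z) = cinner x y + cinner x z"
    and cinner_scaleC_right: "cinner x (c *\<^sub>C y) = c * cinner x y"
    and Re_cinner: "Re (cinner x y) = inner x y"

class cstar_algebra = complex_vector + real_normed_algebra_1 + complete_space +
  fixes star :: "'a \<Rightarrow> 'a"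
  assumes scaleC_mult_left: "(c *\<^sub>C x) * y = c *\<^sub>C (x * y)"
    and scaleC_mult_right: "x * (c *\<^sub>C y) = c *\<^sub>C (x * y)"
    and norm_scaleC: "norm (c *\<^sub>C x) = cmod c * norm x"
    and star_star: "star (star x) = x"
    and star_add: "star (x + y) = star x + star y"
    and star_scaleC: "star (c *\<^sub>C x) = cnj c *\<^sub>C star x"
    and star_mult: "star (x * y) = star y * star x"
    and cstar_identity: "norm (star x * x) = (norm x)\<^sup>2"

instantiation complex :: complex_vector
begin
definition scaleC_complex :: "complex \<Rightarrow> complex \<Rightarrow> complex"
  where "scaleC_complex c x = c * x"
instance
  by standard (auto simp: scaleC_complex_def algebra_simps scaleR_conv_of_real)
end

instantiation complex :: complex_hilbert
begin
definition cinner_complex :: "complex \<Rightarrow> complex \<Rightarrow> complex"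
  where "cinner_complex x y = cnj x * y"
instance
  by standard (auto simp: cinner_complex_def scaleC_complex_def algebra_simps inner_complex_def)
end

instantiation complex :: cstar_algebra
begin
definition star_complex :: "complex \<Rightarrow> complex"
  where "star_complex x = cnj x"
instance
  by standard
    (auto simp: star_complex_def scaleC_complex_def norm_mult power2_eq_square)
end

instantiation prod :: (complex_vector, complex_vector) complex_vector
begin
definition scaleC_prod :: "complex \<Rightarrow> 'a \<times> 'b \<Rightarrow> 'a \<times> 'b"
  where "scaleC_prod c x = (c *\<^sub>C fst x, c *\<^sub>C snd x)"
instance
  by standard
    (auto simp: scaleC_prod_def scaleC_add_right scaleC_add_left scaleC_scaleC
      scaleC_of_real scaleR_prod_def)
end

instantiation prod :: (complex_hilbert, complex_hilbert) complex_hilbert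
begin
definition cinner_prod :: "'a \<times> 'b \<Rightarrow> 'a \<times> 'b \<Rightarrow> complex"
  where "cinner_prod x y = cinner (fst x) (fst y) + cinner (snd x) (snd y)"
instance
proof
  fix x y z :: "'a \<times> 'b" and c :: complex
  show "cinner x y = cnj (cinner y x)"
    unfolding cinner_prod_def
    by (subst cinner_commute[of "fst x"], subst cinner_commute[of "snd x"]) simp
  show "cinner x (y + z) = cinner x y + cinner x z"
    by (simp add: cinner_prod_def cinner_add_right)
  show "cinner x (c *\<^sub>C y) = c * cinner x y"
    by (simp add: cinner_prod_def scaleC_prod_def cinner_scaleC_right algebra_simps)
  show "Re (cinner x y) = inner x y"
    by (simp add: cinner_prod_def inner_prod_def Re_cinner)
qed
end


section \<open>The Hilbert space of square-summable families\<close>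

typedef 'i ell2 = "{f :: 'i \<Rightarrow> complex. (\<lambda>i. (cmod (f i))\<^sup>2) summable_on UNIV}"
  morphisms coord Abs_ell2
  by (rule exI[of _ "\<lambda>_. 0"]) simp

setup_lifting type_definition_ell2

lemma sqsummable_add:
  fixes f g :: "'i \<Rightarrow> complex"
  assumes "(\<lambda>i. (cmod (f i))\<^sup>2) summable_on A" "(\<lambda>i. (cmod (g i))\<^sup>2) summable_on A"
  shows "(\<lambda>i. (cmod (f i + g i))\<^sup>2) summable_on A"
proof (rule summable_on_comparison_test)
  show "(\<lambda>i. 2 * ((cmod (f i))\<^sup>2 + (cmod (g i))\<^sup>2)) summable_on A"
    by (intro summable_on_cmult_right summable_on_add assms)
  fix i
  have "(cmod (f i + g i))\<^sup>2 \<le> (cmod (f i) + cmod (g i))\<^sup>2"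
    by (intro power_mono norm_triangle_ineq) simp
  also have "\<dots> \<le> 2 * ((cmod (f i))\<^sup>2 + (cmod (g i))\<^sup>2)"
    using sum_squares_bound[of "cmod (f i)" "cmod (g i)"] by (simp add: power2_sum)
  finally show "(cmod (f i + g i))\<^sup>2 \<le> 2 * ((cmod (f i))\<^sup>2 + (cmod (g i))\<^sup>2)" .
qed simp

lemma sqsummable_cmult:
  fixes f :: "'i \<Rightarrow> complex"
  assumes "(\<lambda>i. (cmod (f i))\<^sup>2) summable_on A"
  shows "(\<lambda>i. (cmod (c * f i))\<^sup>2) summable_on A"
  using summable_on_cmult_right[OF assms, of "(cmod c)\<^sup>2"]
  by (simp add: norm_mult power_mult_distrib)

lemma sqsummable_prod:
  fixes f g :: "'i \<Rightarrow> complex"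
  assumes "(\<lambda>i. (cmod (f i))\<^sup>2) summable_on A" "(\<lambda>i. (cmod (g i))\<^sup>2) summable_on A"
  shows "(\<lambda>i. cnj (f i) * g i) summable_on A"
proof (rule abs_summable_summable[OF Infinite_Sum.abs_summable_on_comparison_test'])
  show "(\<lambda>i. (cmod (f i))\<^sup>2 + (cmod (g i))\<^sup>2) summable_on A"
    by (intro summable_on_add assms)
  fix i
  have "2 * cmod (f i) * cmod (g i) \<le> (cmod (f i))\<^sup>2 + (cmod (g i))\<^sup>2"
    by (rule sum_squares_bound)
  moreover have "0 \<le> cmod (f i) * cmod (g i)" by (rule mult_nonneg_nonneg) simp_all
  ultimately have "cmod (f i) * cmod (g i) \<le> (cmod (f i))\<^sup>2 + (cmod (g i))\<^sup>2"
    by linarith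
  then show "norm (cnj (f i) * g i) \<le> (cmod (f i))\<^sup>2 + (cmod (g i))\<^sup>2"
    by (simp add: norm_mult)
qed

instantiation ell2 :: (type) complex_vector
begin
lift_definition zero_ell2 :: "'a ell2" is "\<lambda>_. 0" by simp
lift_definition plus_ell2 :: "'a ell2 \<Rightarrow> 'a ell2 \<Rightarrow> 'a ell2" is "\<lambda>f g i. f i + g i"
  by (rule sqsummable_add)
lift_definition uminus_ell2 :: "'a ell2 \<Rightarrow> 'a ell2" is "\<lambda>f i. - f i" by simp
lift_definition minus_ell2 :: "'a ell2 \<Rightarrow> 'a ell2 \<Rightarrow> 'a ell2" is "\<lambda>f g i. f i - g i"
proof -
  fix f g :: "'a \<Rightarrow> complex"
  assume "(\<lambda>i. (cmod (f i))\<^sup>2) summable_on UNIV" "(\<lambda>i. (cmod (g i))\<^sup>2) summable_on UNIV"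
  then show "(\<lambda>i. (cmod (f i - g i))\<^sup>2) summable_on UNIV"
    using sqsummable_add[of f UNIV "\<lambda>i. - g i"] by simp
qed
lift_definition scaleC_ell2 :: "complex \<Rightarrow> 'a ell2 \<Rightarrow> 'a ell2" is "\<lambda>c f i. c * f i"
  by (rule sqsummable_cmult)
lift_definition scaleR_ell2 :: "real \<Rightarrow> 'a ell2 \<Rightarrow> 'a ell2" is "\<lambda>r f i. complex_of_real r * f i"
  by (rule sqsummable_cmult)
instance
  by standard (transfer; auto simp: algebra_simps fun_eq_iff)+
end

lemma coord_sqsummable: "(\<lambda>i. (cmod (coord x i))\<^sup>2) summable_on A"
  using coord[of x] by (auto intro: summable_on_subset_banach)

lemma coord_add: "coord (x + y) i = coord x i + coord y i"
  by transfer simp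
lemma coord_diff: "coord (x - y) i = coord x i - coord y i"
  by transfer simp
lemma coord_scaleC: "coord (c *\<^sub>C x) i = c * coord x i"
  by transfer simp
lemma coord_scaleR: "coord (r *\<^sub>R x) i = complex_of_real r * coord x i"
  by transfer simp
lemma coord_zero: "coord 0 i = 0"
  by transfer simp
lemma ell2_eqI: "(\<And>i. coord x i = coord y i) \<Longrightarrow> x = y"
  by transfer auto

instantiation ell2 :: (type) real_inner
begin
definition inner_ell2 :: "'a ell2 \<Rightarrow> 'a ell2 \<Rightarrow> real"
  where "inner_ell2 x y = Re (\<Sum>\<^sub>\<infinity>i. cnj (coord x i) * coord y i)"
definition norm_ell2 :: "'a ell2 \<Rightarrow> real"
  where "norm_ell2 x = sqrt (inner x x)"
definition dist_ell2 :: "'a ell2 \<Rightarrow> 'a ell2 \<Rightarrow> real"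
  where "dist_ell2 x y = norm (x - y)"
definition sgn_ell2 :: "'a ell2 \<Rightarrow> 'a ell2"
  where "sgn_ell2 x = inverse (norm x) *\<^sub>R x"
definition uniformity_ell2 :: "('a ell2 \<times> 'a ell2) filter"
  where "uniformity_ell2 = (INF e\<in>{0<..}. principal {(x, y). dist x y < e})"
definition open_ell2 :: "'a ell2 set \<Rightarrow> bool"
  where "open_ell2 U = (\<forall>x\<in>U. \<forall>\<^sub>F (x', y) in uniformity. x' = x \<longrightarrow> y \<in> U)"
instance
proof
  fix x y z :: "'a ell2" and r :: real and U :: "'a ell2 set"
  have smb: "(\<lambda>i. cnj (coord x i) * coord y i) summable_on UNIV" for x y :: "'a ell2"
    by (intro sqsummable_prod coord_sqsummable)
  show "dist x y = norm (x - y)" by (rule dist_ell2_def)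
  show "sgn x = inverse (norm x) *\<^sub>R x" by (rule sgn_ell2_def)
  show "uniformity = (INF e\<in>{0<..}. principal {(x, y). dist (x::'a ell2) y < e})"
    by (rule uniformity_ell2_def)
  show "open U = (\<forall>x\<in>U. \<forall>\<^sub>F (x', y) in uniformity. x' = x \<longrightarrow> y \<in> U)"
    by (rule open_ell2_def)
  show "norm x = sqrt (inner x x)" by (rule norm_ell2_def)
  have "(\<Sum>\<^sub>\<infinity>i. cnj (coord y i) * coord x i) = cnj (\<Sum>\<^sub>\<infinity>i. cnj (coord x i) * coord y i)"
    by (simp flip: infsum_cnj add: mult.commute)
  then show "inner x y = inner y x" by (simp add: inner_ell2_def)
  have "(\<Sum>\<^sub>\<infinity>i. cnj (coord (x + y) i) * coord z i)
      = (\<Sum>\<^sub>\<infinity>i. cnj (coord x i) * coord z i + cnj (coord y i) * coord z i)"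
    by (simp add: coord_add algebra_simps)
  also have "\<dots> = (\<Sum>\<^sub>\<infinity>i. cnj (coord x i) * coord z i) + (\<Sum>\<^sub>\<infinity>i. cnj (coord y i) * coord z i)"
    by (intro infsum_add smb)
  finally show "inner (x + y) z = inner x z + inner y z" by (simp add: inner_ell2_def)
  have "(\<Sum>\<^sub>\<infinity>i. cnj (coord (r *\<^sub>R x) i) * coord y i)
      = (\<Sum>\<^sub>\<infinity>i. complex_of_real r * (cnj (coord x i) * coord y i))"
    by (simp add: coord_scaleR algebra_simps)
  also have "\<dots> = complex_of_real r * (\<Sum>\<^sub>\<infinity>i. cnj (coord x i) * coord y i)"
    by (intro infsum_cmult_right smb)
  finally show "inner (r *\<^sub>R x) y = r * inner x y" by (simp add: inner_ell2_def)
  have sq: "inner x x = (\<Sum>\<^sub>\<infinity>i. (cmod (coord x i))\<^sup>2)" for x :: "'a ell2"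
  proof -
    have "Re (cnj z * z) = (cmod z)\<^sup>2" for z
      by (simp add: cmod_def power2_eq_square)
    then show ?thesis
      unfolding inner_ell2_def by (subst infsum_Re[OF smb, symmetric]) simp
  qed
  show "0 \<le> inner x x"
    unfolding sq by (intro infsum_nonneg) simp
  show "(inner x x = 0) = (x = 0)"
  proof
    assume "inner x x = 0"
    then have "(cmod (coord x i))\<^sup>2 = 0" for i
      unfolding sq by (intro nonneg_infsum_le_0D[of "\<lambda>i. (cmod (coord x i))\<^sup>2" UNIV])
        (auto intro: coord_sqsummable)
    then show "x = 0" by (intro ell2_eqI) (simp add: coord_zero)
  qed (simp add: sq coord_zero)
qed
end

lemma norm_ell2_sq: "(norm x)\<^sup>2 = (\<Sum>\<^sub>\<infinity>i. (cmod (coord x i))\<^sup>2)"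
proof -
  have "Re (cnj z * z) = (cmod z)\<^sup>2" for z
    by (simp add: cmod_def power2_eq_square)
  then have "inner x x = (\<Sum>\<^sub>\<infinity>i. (cmod (coord x i))\<^sup>2)"
    unfolding inner_ell2_def
    by (subst infsum_Re[symmetric]) (auto intro: sqsummable_prod coord_sqsummable)
  then show ?thesis by (simp add: power2_norm_eq_inner)
qed

lemma sum_coord_le_norm: "finite F \<Longrightarrow> (\<Sum>i\<in>F. (cmod (coord x i))\<^sup>2) \<le> (norm x)\<^sup>2"
  unfolding norm_ell2_sq by (intro finite_sum_le_infsum coord_sqsummable) auto

lemma coord_le_norm: "cmod (coord x i) \<le> norm x"
  using sum_coord_le_norm[of "{i}" x] by (simp add: power2_le_iff_abs_le)

instance ell2 :: (type) complete_space
proof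
  fix X :: "nat \<Rightarrow> 'a ell2"
  assume "Cauchy X"
  have "Cauchy (\<lambda>n. coord (X n) i)" for i
  proof (rule metric_CauchyI)
    fix \<epsilon> :: real assume "0 < \<epsilon>"
    then obtain M where M: "\<forall>m\<ge>M. \<forall>n\<ge>M. dist (X m) (X n) < \<epsilon>"
      using metric_CauchyD[OF \<open>Cauchy X\<close>, of \<epsilon>] \<open>0 < \<epsilon>\<close> by blast
    have "dist (coord (X m) i) (coord (X n) i) < \<epsilon>" if "m \<ge> M" "n \<ge> M" for m n
      using le_less_trans[OF coord_le_norm[of "X m - X n" i], of \<epsilon>] M that
      by (simp add: dist_norm coord_diff)
    then show "\<exists>M. \<forall>m\<ge>M. \<forall>n\<ge>M. dist (coord (X m) i) (coord (X n) i) < \<epsilon>" by blast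
  qed
  then have "\<forall>i. \<exists>l. (\<lambda>n. coord (X n) i) \<longlonglongrightarrow> l"
    using Cauchy_convergent_iff convergent_def by blast
  then obtain L where L: "\<And>i. (\<lambda>n. coord (X n) i) \<longlonglongrightarrow> L i" by metis
  have bound: "\<exists>M. \<forall>m\<ge>M. \<forall>F. finite F \<longrightarrow> (\<Sum>i\<in>F. (cmod (coord (X m) i - L i))\<^sup>2) \<le> \<epsilon>\<^sup>2"
    if "0 < \<epsilon>" for \<epsilon> :: real
  proof -
    obtain M where M: "\<forall>m\<ge>M. \<forall>n\<ge>M. dist (X m) (X n) < \<epsilon>"
      using metric_CauchyD[OF \<open>Cauchy X\<close>, of \<epsilon>] \<open>0 < \<epsilon>\<close> by blast
    have "(\<Sum>i\<in>F. (cmod (coord (X m) i - L i))\<^sup>2) \<le> \<epsilon>\<^sup>2" if "m \<ge> M" "finite F" for m F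
    proof (rule LIMSEQ_le_const2)
      show "(\<lambda>n. \<Sum>i\<in>F. (cmod (coord (X m) i - coord (X n) i))\<^sup>2)
          \<longlonglongrightarrow> (\<Sum>i\<in>F. (cmod (coord (X m) i - L i))\<^sup>2)"
        by (intro tendsto_intros L)
      show "\<exists>N. \<forall>n\<ge>N. (\<Sum>i\<in>F. (cmod (coord (X m) i - coord (X n) i))\<^sup>2) \<le> \<epsilon>\<^sup>2"
      proof (intro exI allI impI)
        fix n assume "n \<ge> M"
        have "(\<Sum>i\<in>F. (cmod (coord (X m - X n) i))\<^sup>2) \<le> (norm (X m - X n))\<^sup>2"
          by (rule sum_coord_le_norm[OF \<open>finite F\<close>])
        also have "\<dots> \<le> \<epsilon>\<^sup>2"
          using M \<open>m \<ge> M\<close> \<open>n \<ge> M\<close> by (intro power_mono) (auto simp: dist_norm less_imp_le)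
        finally show "(\<Sum>i\<in>F. (cmod (coord (X m) i - coord (X n) i))\<^sup>2) \<le> \<epsilon>\<^sup>2"
          by (simp add: coord_diff)
      qed
    qed
    then show ?thesis by blast
  qed
  have smb: "(\<lambda>i. (cmod (coord (X m) i - L i))\<^sup>2) summable_on UNIV"
    if "\<forall>F. finite F \<longrightarrow> (\<Sum>i\<in>F. (cmod (coord (X m) i - L i))\<^sup>2) \<le> \<epsilon>\<^sup>2" for m and \<epsilon> :: real
    using that by (intro nonneg_bdd_above_summable_on bdd_aboveI2[where M = "\<epsilon>\<^sup>2"]) auto
  obtain M1 where M1: "\<forall>F. finite F \<longrightarrow> (\<Sum>i\<in>F. (cmod (coord (X M1) i - L i))\<^sup>2) \<le> 1\<^sup>2"
    using bound[of 1] by auto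
  have "(\<lambda>i. (cmod (coord (X M1) i + (-1) * (coord (X M1) i - L i)))\<^sup>2) summable_on UNIV"
    by (intro sqsummable_add sqsummable_cmult coord_sqsummable smb[OF M1])
  then have "(\<lambda>i. (cmod (L i))\<^sup>2) summable_on UNIV" by simp
  then have co: "coord (Abs_ell2 L) = L" by (simp add: Abs_ell2_inverse)
  have "X \<longlonglongrightarrow> Abs_ell2 L"
  proof (rule metric_LIMSEQ_I)
    fix r :: real assume "0 < r"
    then obtain M where
      M: "\<forall>m\<ge>M. \<forall>F. finite F \<longrightarrow> (\<Sum>i\<in>F. (cmod (coord (X m) i - L i))\<^sup>2) \<le> (r/2)\<^sup>2"
      using bound[of "r/2"] by auto
    have "dist (X m) (Abs_ell2 L) < r" if "m \<ge> M" for m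
    proof -
      have "(norm (X m - Abs_ell2 L))\<^sup>2 \<le> (r/2)\<^sup>2"
        unfolding norm_ell2_sq coord_diff co
        by (rule infsum_le_finite_sums[OF smb]) (use M that in auto)
      then have "norm (X m - Abs_ell2 L) \<le> r/2"
        using \<open>0 < r\<close> by (simp add: power2_le_iff_abs_le)
      then show ?thesis using \<open>0 < r\<close> by (simp add: dist_norm)
    qed
    then show "\<exists>no. \<forall>n\<ge>no. dist (X n) (Abs_ell2 L) < r" by blast
  qed
  then show "convergent X" by (auto simp: convergent_def)
qed

instantiation ell2 :: (type) complex_hilbert
begin
definition cinner_ell2 :: "'a ell2 \<Rightarrow> 'a ell2 \<Rightarrow> complex"
  where "cinner_ell2 x y = (\<Sum>\<^sub>\<infinity>i. cnj (coord x i) * coord y i)"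
instance
proof
  fix x y z :: "'a ell2" and c :: complex
  have smb: "(\<lambda>i. cnj (coord x i) * coord y i) summable_on UNIV" for x y :: "'a ell2"
    by (intro sqsummable_prod coord_sqsummable)
  show "cinner x y = cnj (cinner y x)"
    by (simp add: cinner_ell2_def mult.commute flip: infsum_cnj)
  show "cinner x (y + z) = cinner x y + cinner x z"
    unfolding cinner_ell2_def coord_add distrib_left by (intro infsum_add smb)
  have "cinner x (c *\<^sub>C y) = (\<Sum>\<^sub>\<infinity>i. c * (cnj (coord x i) * coord y i))"
    by (simp add: cinner_ell2_def coord_scaleC algebra_simps)
  also have "\<dots> = c * cinner x y"
    unfolding cinner_ell2_def by (intro infsum_cmult_right smb)
  finally show "cinner x (c *\<^sub>C y) = c * cinner x y" .
  show "Re (cinner x y) = inner x y"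
    by (simp add: cinner_ell2_def inner_ell2_def)
qed
end


section \<open>Operators on a complex Hilbert space\<close>

definition bounded_op :: "('h::complex_hilbert \<Rightarrow> 'k::complex_hilbert) \<Rightarrow> bool"
  where "bounded_op T \<longleftrightarrow> bounded_linear T \<and> (\<forall>c x. T (c *\<^sub>C x) = c *\<^sub>C T x)"

definition is_adjoint :: "('h::complex_hilbert \<Rightarrow> 'h) \<Rightarrow> ('h \<Rightarrow> 'h) \<Rightarrow> bool"
  where "is_adjoint T T' \<longleftrightarrow> (\<forall>x y. cinner (T x) y = cinner x (T' y))"

definition selfadjoint_op :: "('h::complex_hilbert \<Rightarrow> 'h) \<Rightarrow> bool"
  where "selfadjoint_op T \<longleftrightarrow> bounded_op T \<and> is_adjoint T T"

definition positive_op :: "('h::complex_hilbert \<Rightarrow> 'h) \<Rightarrow> bool"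
  where "positive_op T \<longleftrightarrow> bounded_op T \<and> (\<forall>x. cinner x (T x) \<in> \<real>\<^sub>\<ge>\<^sub>0)"

definition compact_op :: "('h::complex_hilbert \<Rightarrow> 'h) \<Rightarrow> bool"
  where "compact_op T \<longleftrightarrow> bounded_op T \<and> compact (closure (T ` cball 0 1))"

definition commutator :: "('h::complex_hilbert \<Rightarrow> 'h) \<Rightarrow> ('h \<Rightarrow> 'h) \<Rightarrow> 'h \<Rightarrow> 'h"
  where "commutator T U = (\<lambda>x. T (U x) - U (T x))"

definition orthonormal_basis :: "'h::complex_hilbert set \<Rightarrow> bool"
  where "orthonormal_basis B \<longleftrightarrow>
    (\<forall>b\<in>B. \<forall>b'\<in>B. cinner b b' = (if b = b' then 1 else 0)) \<and>
    closure {\<Sum>b\<in>B0. c b *\<^sub>C b | B0 c. finite B0 \<and> B0 \<subseteq> B} = UNIV"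

text \<open>Below, \<open>R\<close> is the absolute value \<open>(T\<^sup>* T)\<^sup>1\<^sup>/\<^sup>2\<close>.\<close>

definition trace_class :: "('h::complex_hilbert \<Rightarrow> 'h) \<Rightarrow> bool"
  where "trace_class T \<longleftrightarrow> bounded_op T \<and>
    (\<exists>T' R B. is_adjoint T T' \<and> positive_op R \<and> R \<circ> R = T' \<circ> T \<and>
      orthonormal_basis B \<and> (\<lambda>b. cinner b (R b)) summable_on B)"

text \<open>For trace class operators the sum converges absolutely and does not depend on
  the chosen basis.\<close>

definition trace_op :: "('h::complex_hilbert \<Rightarrow> 'h) \<Rightarrow> complex"
  where "trace_op T = (\<Sum>\<^sub>\<infinity>b\<in>(SOME B. orthonormal_basis B). cinner b (T b))"

text \<open>The operator on a direct sum with matrix \<open>((a, b), (c, d))\<close>.\<close>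

definition block_op ::
  "('h \<Rightarrow> 'h) \<Rightarrow> ('k \<Rightarrow> 'h) \<Rightarrow> ('h \<Rightarrow> 'k) \<Rightarrow> ('k \<Rightarrow> 'k)
    \<Rightarrow> 'h::complex_hilbert \<times> 'k::complex_hilbert \<Rightarrow> 'h \<times> 'k"
  where "block_op a b c d = (\<lambda>(x, y). (a x + b y, c x + d y))"


section \<open>Representations and even Fredholm modules\<close>

text \<open>Neither homomorphisms nor representations are required to be unital.\<close>

definition star_hom :: "('a::cstar_algebra \<Rightarrow> 'b::cstar_algebra) \<Rightarrow> bool"
  where "star_hom f \<longleftrightarrow>
    (\<forall>a b. f (a + b) = f a + f b) \<and> (\<forall>c a. f (c *\<^sub>C a) = c *\<^sub>C f a) \<and>
    (\<forall>a b. f (a * b) = f a * f b) \<and> (\<forall>a. f (star a) = star (f a))"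

definition star_rep :: "('a::cstar_algebra \<Rightarrow> 'h::complex_hilbert \<Rightarrow> 'h) \<Rightarrow> bool"
  where "star_rep \<pi> \<longleftrightarrow>
    (\<forall>a. bounded_op (\<pi> a)) \<and>
    (\<forall>a b x. \<pi> (a + b) x = \<pi> a x + \<pi> b x) \<and> (\<forall>c a x. \<pi> (c *\<^sub>C a) x = c *\<^sub>C \<pi> a x) \<and>
    (\<forall>a b. \<pi> (a * b) = \<pi> a \<circ> \<pi> b) \<and> (\<forall>a. is_adjoint (\<pi> a) (\<pi> (star a)))"

text \<open>The Hilbert space of a module is the type \<open>'h\<close>.\<close>

record ('a, 'h) graded_module =
  rep :: "'a \<Rightarrow> 'h \<Rightarrow> 'h"
  fop :: "'h \<Rightarrow> 'h"
  grading :: "'h \<Rightarrow> 'h"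

definition even_fredholm_module :: "('a::cstar_algebra, 'h::complex_hilbert) graded_module \<Rightarrow> bool"
  where "even_fredholm_module w \<longleftrightarrow>
    star_rep (rep w) \<and>
    selfadjoint_op (fop w) \<and> fop w \<circ> fop w = id \<and>
    (\<forall>a. compact_op (commutator (fop w) (rep w a))) \<and>
    selfadjoint_op (grading w) \<and> grading w \<circ> grading w = id \<and>
    (\<forall>a. grading w \<circ> rep w a = rep w a \<circ> grading w) \<and>
    (\<forall>x. fop w (grading w x) = - grading w (fop w x))"


section \<open>Chern character and pairing with projections\<close>

definition chern_op ::
  "('a::cstar_algebra, 'h::complex_hilbert) graded_module \<Rightarrow> nat \<Rightarrow> (nat \<Rightarrow> 'a) \<Rightarrow> 'h \<Rightarrow> 'h"
  where "chern_op w n a =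
    grading w \<circ> rep w (a 0) \<circ>
      foldr (\<circ>) (map (\<lambda>j. commutator (fop w) (rep w (a j))) [1..<2*n+1]) id"

text \<open>The component of degree \<open>2n\<close> of Connes' Chern character of an even Fredholm module;
  only \<open>a 0, \<dots>, a (2n)\<close> matter.\<close>

definition chern_character ::
  "('a::cstar_algebra, 'h::complex_hilbert) graded_module \<Rightarrow> nat \<Rightarrow> (nat \<Rightarrow> 'a) \<Rightarrow> complex"
  where "chern_character w n a =
    (-1) ^ (n * (2 * n - 1)) * Gamma (of_nat n + 1) * trace_op (chern_op w n a)"

definition is_projection :: "'a::cstar_algebra \<Rightarrow> bool"
  where "is_projection p \<longleftrightarrow> star p = p \<and> p * p = p"

text \<open>\<open>has_chern_pairing w p v\<close>: the pairing of the Chern character of \<open>w\<close> with the K-theory class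
  of the projection \<open>p\<close> is defined and equals \<open>v\<close>.  On projections over which the module is finitely summable, Connes'
  pairing is the limit of the degree \<open>2n\<close> components divided by \<open>n!\<close>.  The trace
  need not exist for small \<open>n\<close>: for \<open>n = 0\<close> and \<open>p = 1\<close> the operator is the grading itself.\<close>

definition has_chern_pairing ::
  "('a::cstar_algebra, 'h::complex_hilbert) graded_module \<Rightarrow> 'a \<Rightarrow> complex \<Rightarrow> bool"
  where "has_chern_pairing w p v \<longleftrightarrow>
    is_projection p \<and>
    (\<forall>\<^sub>F n in sequentially. trace_class (chern_op w n (\<lambda>_. p))) \<and>
    (\<lambda>n. chern_character w n (\<lambda>_. p) / fact n) \<longlonglongrightarrow> v"


section \<open>Group C*-algebras\<close>

text \<open>The group algebra of \<open>G\<close> consists of the finitely supported complex functions on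
  the carrier, with convolution and the usual involution.\<close>

definition group_algebra :: "('g, 'm) monoid_scheme \<Rightarrow> ('g \<Rightarrow> complex) set"
  where "group_algebra G = {f. finite {x. f x \<noteq> 0} \<and> {x. f x \<noteq> 0} \<subseteq> carrier G}"

definition convolution ::
  "('g, 'm) monoid_scheme \<Rightarrow> ('g \<Rightarrow> complex) \<Rightarrow> ('g \<Rightarrow> complex) \<Rightarrow> 'g \<Rightarrow> complex"
  where "convolution G f h = (\<lambda>x. if x \<in> carrier G
    then \<Sum>y | f y \<noteq> 0. f y * h (m_inv G y \<otimes>\<^bsub>G\<^esub> x) else 0)"

definition involution :: "('g, 'm) monoid_scheme \<Rightarrow> ('g \<Rightarrow> complex) \<Rightarrow> 'g \<Rightarrow> complex"
  where "involution G f = (\<lambda>x. if x \<in> carrier G then cnj (f (m_inv G x)) else 0)"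

definition cstar_seminorm :: "('g, 'm) monoid_scheme \<Rightarrow> (('g \<Rightarrow> complex) \<Rightarrow> real) \<Rightarrow> bool"
  where "cstar_seminorm G p \<longleftrightarrow>
    (\<forall>f\<in>group_algebra G. \<forall>h\<in>group_algebra G.
      p (\<lambda>x. f x + h x) \<le> p f + p h \<and> p (convolution G f h) \<le> p f * p h) \<and>
    (\<forall>f\<in>group_algebra G. \<forall>c. p (\<lambda>x. c * f x) = cmod c * p f) \<and>
    (\<forall>f\<in>group_algebra G. p (convolution G (involution G f) f) = (p f)\<^sup>2)"

definition group_sum :: "('g \<Rightarrow> 'a::cstar_algebra) \<Rightarrow> ('g \<Rightarrow> complex) \<Rightarrow> 'a"
  where "group_sum u f = (\<Sum>x | f x \<noteq> 0. f x *\<^sub>C u x)"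

text \<open>The type \<open>'a\<close>, with the canonical unitaries \<open>u\<close>, is the (full) group C*-algebra of
  the discrete group \<open>G\<close>: the completion of the group algebra in the universal C*-norm.  The
  C*-seminorms are exactly the functions \<open>f \<mapsto> \<parallel>\<rho> f\<parallel>\<close> for *-homomorphisms \<open>\<rho>\<close> into
  C*-algebras, that is for *-representations on Hilbert spaces, and the supremum avoids quantifying
  over the spaces.  It is finite, since every C*-seminorm is at most 1 on group elements and hence
  at most the \<open>\<ell>\<^sup>1\<close>-norm.\<close>

definition group_cstar_algebra :: "('g, 'm) monoid_scheme \<Rightarrow> ('g \<Rightarrow> 'a::cstar_algebra) \<Rightarrow> bool"
  where "group_cstar_algebra G u \<longleftrightarrow>
    (\<forall>x\<in>carrier G. \<forall>y\<in>carrier G. u (x \<otimes>\<^bsub>G\<^esub> y) = u x * u y) \<and> u \<one>\<^bsub>G\<^esub> = 1 \<and>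
    (\<forall>x\<in>carrier G. star (u x) = u (m_inv G x)) \<and>
    closure (group_sum u ` group_algebra G) = UNIV \<and>
    (\<forall>f\<in>group_algebra G. norm (group_sum u f) = (SUP p\<in>{p. cstar_seminorm G p}. p f))"

definition semidirect_product ::
  "('n, 'a) monoid_scheme \<Rightarrow> ('k, 'b) monoid_scheme \<Rightarrow> ('k \<Rightarrow> 'n \<Rightarrow> 'n) \<Rightarrow> ('n \<times> 'k) monoid"
  where "semidirect_product N K \<sigma> =
    \<lparr>carrier = carrier N \<times> carrier K,
     monoid.mult = (\<lambda>(m, j) (n, k). (m \<otimes>\<^bsub>N\<^esub> \<sigma> j n, j \<otimes>\<^bsub>K\<^esub> k)),
     one = (\<one>\<^bsub>N\<^esub>, \<one>\<^bsub>K\<^esub>)\<rparr>"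

definition infinite_dihedral :: "(int \<times> int) monoid"
  where "infinite_dihedral =
    semidirect_product integer_group (integer_mod_group 2) (\<lambda>k n. if k = 0 then n else - n)"

lemma carrier_infinite_dihedral: "carrier infinite_dihedral = UNIV \<times> {0, 1}"
proof -
  have "{0..<2} = {0, 1::int}" by auto
  then show ?thesis
    by (simp add: infinite_dihedral_def semidirect_product_def carrier_integer_mod_group)
qed

lemma mult_infinite_dihedral: "(m, j) \<otimes>\<^bsub>infinite_dihedral\<^esub> (n, k)
    = (m + (if j = 0 then n else - n), (j + k) mod 2)"
  by (simp add: infinite_dihedral_def semidirect_product_def integer_mod_group_def)

lemma one_infinite_dihedral: "\<one>\<^bsub>infinite_dihedral\<^esub> = (0, 0)"
  by (simp add: infinite_dihedral_def semidirect_product_def integer_mod_group_def)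

lemma group_infinite_dihedral: "group infinite_dihedral"
proof (rule groupI)
  fix x assume "x \<in> carrier infinite_dihedral"
  then obtain m j where "x = (m, j)" "j = 0 \<or> j = 1"
    by (auto simp: carrier_infinite_dihedral)
  then show "\<exists>y\<in>carrier infinite_dihedral.
      y \<otimes>\<^bsub>infinite_dihedral\<^esub> x = \<one>\<^bsub>infinite_dihedral\<^esub>"
    by (intro bexI[of _ "(if j = 0 then - m else m, j)"])
      (auto simp: carrier_infinite_dihedral mult_infinite_dihedral one_infinite_dihedral)
qed (auto simp: carrier_infinite_dihedral mult_infinite_dihedral one_infinite_dihedral)

section \<open>The Fredholm modules over the C*-algebra of the infinite dihedral group\<close>

text \<open>Throughout, \<open>S\<close> and \<open>e\<close> are the generators of the algebra.  All *-homomorphisms below are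
  determined by their values on \<open>S\<close> and \<open>e\<close> and exist by the universal property.\<close>

definition trivial_character :: "'a::cstar_algebra \<Rightarrow> 'a \<Rightarrow> 'a \<Rightarrow> complex"
  where "trivial_character S e = (THE \<phi>. star_hom \<phi> \<and> \<phi> S = 1 \<and> \<phi> e = 1)"

definition w0 :: "'a::cstar_algebra \<Rightarrow> 'a \<Rightarrow> ('a, complex \<times> complex) graded_module"
  where "w0 S e =
    \<lparr>rep = (\<lambda>a. block_op (\<lambda>z. trivial_character S e a * z) (\<lambda>_. 0) (\<lambda>_. 0) (\<lambda>_. 0)),
     fop = block_op (\<lambda>_. 0) id id (\<lambda>_. 0),
     grading = block_op id (\<lambda>_. 0) (\<lambda>_. 0) uminus\<rparr>"

lemma sqsummable_reindex:
  fixes f :: "int \<Rightarrow> complex"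
  assumes "(\<lambda>n. (cmod (f n))\<^sup>2) summable_on UNIV" "bij h"
  shows "(\<lambda>n. (cmod (f (h n)))\<^sup>2) summable_on UNIV"
  using summable_on_reindex_bij_betw[OF assms(2), of "\<lambda>n. (cmod (f n))\<^sup>2"] assms(1) by simp

text \<open>In terms of the standard basis \<open>ket n\<close> the next three operators send \<open>ket n\<close> to \<open>ket (n + 1)\<close>,
  \<open>ket (- n)\<close> and \<open>ket n\<close> times the sign of \<open>n\<close>, where 0 has sign 1.\<close>

lift_definition shift_op :: "int ell2 \<Rightarrow> int ell2" is "\<lambda>f n. f (n - 1)"
  by (rule sqsummable_reindex) (auto intro!: bij_betw_byWitness[of _ "\<lambda>n. n + 1"])

lift_definition flip_op :: "int ell2 \<Rightarrow> int ell2" is "\<lambda>f n. f (- n)"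
  by (rule sqsummable_reindex) (auto intro!: bij_betw_byWitness[of _ uminus])

lift_definition sign_op :: "int ell2 \<Rightarrow> int ell2" is "\<lambda>f n. (if n \<ge> 0 then 1 else - 1) * f n"
  by (simp add: norm_mult if_distrib[of cmod] cong: if_cong)

lift_definition ket :: "'i \<Rightarrow> 'i ell2" is "\<lambda>i j. if j = i then 1 else 0"
proof -
  fix i :: 'i
  show "(\<lambda>j. (cmod (if j = i then 1 else 0))\<^sup>2) summable_on UNIV"
    by (rule finite_nonzero_values_imp_summable_on)
      (rule finite_subset[of _ "{i}"], auto)
qed

lemma shift_op_ket: "shift_op (ket n) = ket (n + 1)"
  by transfer (auto simp: fun_eq_iff)

lemma flip_op_ket: "flip_op (ket n) = ket (- n)"
  by transfer (auto simp: fun_eq_iff)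

lemma sign_op_ket: "sign_op (ket n) = (if n \<ge> 0 then 1 else - 1) *\<^sub>C ket n"
  by transfer (auto simp: fun_eq_iff)

definition rep1 :: "'a::cstar_algebra \<Rightarrow> 'a \<Rightarrow> 'a \<Rightarrow> int ell2 \<times> int ell2 \<Rightarrow> int ell2 \<times> int ell2"
  where "rep1 S e = (THE \<pi>. star_rep \<pi> \<and>
    \<pi> S = block_op shift_op (\<lambda>_. 0) (\<lambda>_. 0) shift_op \<and>
    \<pi> e = block_op flip_op (\<lambda>_. 0) (\<lambda>_. 0) (\<lambda>x. - flip_op x))"

definition alpha_minus_one :: "'a::cstar_algebra \<Rightarrow> 'a \<Rightarrow> 'a \<Rightarrow> 'a"
  where "alpha_minus_one S e = (THE \<alpha>. star_hom \<alpha> \<and> bij \<alpha> \<and> \<alpha> S = S \<and> \<alpha> e = star S * e)"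

definition w1 :: "'a::cstar_algebra \<Rightarrow> 'a \<Rightarrow> ('a, int ell2 \<times> int ell2) graded_module"
  where "w1 S e =
    \<lparr>rep = rep1 S e,
     fop = block_op (\<lambda>_. 0) (\<lambda>x. \<i> *\<^sub>C sign_op x) (\<lambda>x. - (\<i> *\<^sub>C sign_op x)) (\<lambda>_. 0),
     grading = block_op id (\<lambda>_. 0) (\<lambda>_. 0) uminus\<rparr>"

definition w2 :: "'a::cstar_algebra \<Rightarrow> 'a \<Rightarrow> ('a, int ell2 \<times> int ell2) graded_module"
  where "w2 S e = (w1 S e)\<lparr>rep := rep1 S e \<circ> alpha_minus_one S e\<rparr>"

end

theory Submission
  imports Defs
begin

text \<open>For a projection \<open>p\<close> and \<open>C = [F, p]\<close> the operator \<open>- C\<^sup>2 = C\<^sup>* C\<close> commutes with \<open>p\<close> and with the grading.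
  In all cases of the table it is itself a projection \<open>Q\<close>, so each component of the
  pairing in positive degree equals the trace of \<open>\<gamma> p Q\<close> and no limit is left to compute
  (\<open>has_chern_pairingI\<close>).  For the module \<open>w0\<close> this trace is the value of the character at \<open>p\<close>.  For \<open>w1\<close>
  and a reflection \<open>k \<mapsto> m - k\<close> of the integers, \<open>Q\<close> projects onto the indices whose sign the reflection
  preserves, and the trace counts its fixed points: 1 for even \<open>m\<close> and 0 for odd \<open>m\<close>
  (\<open>pairing_w1_reflection\<close>).  The element \<open>e\<close> is the reflection with \<open>m = 0\<close>, and \<open>S e\<close> the one with
  \<open>m = 1\<close>.  The automorphism defining \<open>w2\<close> lowers \<open>m\<close> by 1, so the two values are interchanged.
  For \<open>p = 1\<close> the commutators with \<open>F\<close> vanish in \<open>w1\<close> and \<open>w2\<close>.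

  The character, the representation and the automorphism in the modules are described only by their values on
  generators.  They exist because a unitary representation of the group induces a C*-seminorm on the
  group algebra, which the universal norm dominates (\<open>universal_star_hom\<close>, \<open>universal_star_rep\<close>).
  They are unique because *-homomorphisms and representations are automatically continuous
  (\<open>cstar_seminorm_continuous\<close>), so agreement on the generators extends to the closure of the group
  algebra.  The same continuity reduces compactness of \<open>[F, \<pi> a]\<close> to group elements, for which
  the commutator has finite rank.

  Traces of operators of finite rank do not depend on the orthonormal basis, by Parseval's identity
  (\<open>parseval\<close>).\<close>

section \<open>Inner products and bounded operators\<close>

lemma scaleC_zero_right [simp]: "c *\<^sub>C (0::'a::complex_vector) = 0"
  using scaleC_add_right[of c 0 "0::'a"] by simp

lemma scaleC_sum_right: "c *\<^sub>C (\<Sum>i\<in>I. x i) = (\<Sum>i\<in>I. c *\<^sub>C (x i :: 'a::complex_vector))"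
  by (induction I rule: infinite_finite_induct) (simp_all add: scaleC_add_right)

lemma scaleC_zero_left [simp]: "0 *\<^sub>C (x::'a::complex_vector) = 0"
  using scaleC_of_real[of 0 x] by simp

lemma scaleC_one [simp]: "1 *\<^sub>C (x::'a::complex_vector) = x"
  using scaleC_of_real[of 1 x] by simp

lemma scaleC_minus_one [simp]: "(-1) *\<^sub>C (x::'a::complex_vector) = - x"
  using scaleC_of_real[of "-1" x] by simp

lemma scaleC_minus_right: "c *\<^sub>C (- x) = - (c *\<^sub>C (x::'a::complex_vector))"
  using scaleC_scaleC[of c "-1" x] scaleC_scaleC[of "-1" c x] by simp

lemma scaleC_minus_left: "(- c) *\<^sub>C x = - (c *\<^sub>C (x::'a::complex_vector))"
  using scaleC_scaleC[of "-1" c x] by simp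

lemma scaleC_diff_right: "c *\<^sub>C (x - y) = c *\<^sub>C x - c *\<^sub>C (y::'a::complex_vector)"
  using scaleC_add_right[of c x "- y"] by (simp add: scaleC_minus_right)

lemma scaleC_sum_left: "(\<Sum>i\<in>I. f i) *\<^sub>C (x::'a::complex_vector) = (\<Sum>i\<in>I. f i *\<^sub>C x)"
  by (induction I rule: infinite_finite_induct) (simp_all add: scaleC_add_left)

lemma scaleC_real_commute: "c *\<^sub>C (r *\<^sub>R x) = r *\<^sub>R (c *\<^sub>C (x::'a::complex_vector))"
  by (simp flip: scaleC_of_real add: scaleC_scaleC mult.commute)

lemma cinner_add_left: "cinner (x + y) z = cinner x z + cinner y z"
  using cinner_commute[of "x + y" z] cinner_commute[of x z] cinner_commute[of y z]
  by (simp add: cinner_add_right)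

lemma cinner_scaleC_left: "cinner (c *\<^sub>C x) y = cnj c * cinner x y"
  using cinner_commute[of "c *\<^sub>C x" y] cinner_commute[of x y]
  by (simp add: cinner_scaleC_right)

lemma cinner_zero_right [simp]: "cinner x 0 = 0"
  using cinner_scaleC_right[of x 0 0] by simp

lemma cinner_zero_left [simp]: "cinner 0 x = 0"
  using cinner_scaleC_left[of 0 0 x] by simp

lemma cinner_minus_right [simp]: "cinner x (- y) = - cinner x y"
  using cinner_scaleC_right[of x "-1" y] by simp

lemma cinner_minus_left [simp]: "cinner (- x) y = - cinner x y"
  using cinner_scaleC_left[of "-1" x y] by simp

lemma cinner_diff_right: "cinner x (y - z) = cinner x y - cinner x z"
  using cinner_add_right[of x y "- z"] by simp

lemma cinner_diff_left: "cinner (x - y) z = cinner x z - cinner y z"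
  using cinner_add_left[of x "- y" z] by simp

lemma cinner_sum_right: "cinner x (\<Sum>i\<in>I. f i) = (\<Sum>i\<in>I. cinner x (f i))"
  by (induction I rule: infinite_finite_induct) (simp_all add: cinner_add_right)

lemma cinner_self: "cinner x x = complex_of_real ((norm x)\<^sup>2)"
proof -
  have "Im (cinner x x) = 0"
    using arg_cong[OF cinner_commute[of x x], of Im] by simp
  then show ?thesis
    by (simp add: complex_eq_iff Re_cinner power2_norm_eq_inner)
qed

lemma norm_scaleC_hilbert: "norm (c *\<^sub>C x) = cmod c * norm (x::'a::complex_hilbert)"
proof -
  have "complex_of_real ((norm (c *\<^sub>C x))\<^sup>2) = cnj c * c * cinner x x"
    by (simp only: cinner_self[symmetric] cinner_scaleC_left cinner_scaleC_right mult.assoc mult.left_commute)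
  also have "\<dots> = complex_of_real ((cmod c * norm x)\<^sup>2)"
    unfolding cinner_self power_mult_distrib of_real_mult complex_norm_square[of c] by simp
  finally have "(norm (c *\<^sub>C x))\<^sup>2 = (cmod c * norm x)\<^sup>2"
    by (simp only: of_real_eq_iff)
  then show ?thesis by (rule power2_eq_imp_eq) simp_all
qed

lemma cmod_cinner_le: "cmod (cinner x y) \<le> norm x * norm y"
proof (cases "cinner x y = 0")
  case False
  define z where "z = cinner x y"
  have "cinner x (cnj z *\<^sub>C y) = complex_of_real ((cmod z)\<^sup>2)"
    by (simp only: cinner_scaleC_right z_def[symmetric] complex_norm_square mult.commute)
  then have "(cmod z)\<^sup>2 = inner x (cnj z *\<^sub>C y)"
    by (simp flip: Re_cinner)
  also have "\<dots> \<le> norm x * norm (cnj z *\<^sub>C y)" by (rule norm_cauchy_schwarz)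
  also have "\<dots> = cmod z * (norm x * norm y)" by (simp add: norm_scaleC_hilbert)
  finally have "cmod z * cmod z \<le> cmod z * (norm x * norm y)" by (simp only: power2_eq_square)
  moreover have "0 < cmod z" using False by (simp add: z_def)
  ultimately show ?thesis unfolding z_def by (rule mult_left_le_imp_le)
qed simp

lemma bounded_opI:
  assumes "\<And>x y. T (x + y) = T x + T y" "\<And>c x. T (c *\<^sub>C x) = c *\<^sub>C T x"
    and "\<And>x. norm (T x) \<le> K * norm x"
  shows "bounded_op T"
  unfolding bounded_op_def
proof (intro conjI allI bounded_linear_intro[where K = K] assms)
  show "T (r *\<^sub>R x) = r *\<^sub>R T x" for r x
    using assms(2)[of "complex_of_real r" x] by (simp add: scaleC_of_real)
  show "norm (T x) \<le> norm x * K" for x using assms(3)[of x] by (simp add: mult.commute)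
qed

lemma bounded_op_linear: "bounded_op T \<Longrightarrow> bounded_linear T"
  by (simp add: bounded_op_def)

lemma bounded_op_scaleC: "bounded_op T \<Longrightarrow> T (c *\<^sub>C x) = c *\<^sub>C T x"
  by (simp add: bounded_op_def)

lemma bounded_op_add: "bounded_op T \<Longrightarrow> T (x + y) = T x + T y"
  by (simp add: bounded_op_def linear_simps)

lemma bounded_op_diff: "bounded_op T \<Longrightarrow> T (x - y) = T x - T y"
  by (simp add: bounded_op_def linear_simps)

lemma bounded_op_minus: "bounded_op T \<Longrightarrow> T (- x) = - T x"
  by (simp add: bounded_op_def linear_simps)

lemma bounded_op_zero: "bounded_op T \<Longrightarrow> T 0 = 0"
  by (simp add: bounded_op_def linear_simps)

lemma bounded_op_sum: "bounded_op T \<Longrightarrow> T (\<Sum>i\<in>I. f i) = (\<Sum>i\<in>I. T (f i))"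
  by (rule linear_sum) (simp add: bounded_op_def bounded_linear.linear)

lemmas bounded_op_simps =
  bounded_op_add bounded_op_diff bounded_op_minus bounded_op_zero bounded_op_scaleC

lemma bounded_op_id: "bounded_op (\<lambda>x. x)"
  by (simp add: bounded_op_def bounded_linear_ident)

lemma bounded_op_0: "bounded_op (\<lambda>_. 0)"
  by (simp add: bounded_op_def)

lemma bounded_op_compose: "bounded_op T \<Longrightarrow> bounded_op U \<Longrightarrow> bounded_op (\<lambda>x. T (U x))"
  by (simp add: bounded_op_def bounded_linear_compose)

lemma bounded_op_scaleC_op: "bounded_op ((*\<^sub>C) c :: 'a \<Rightarrow> 'a::complex_hilbert)"
  by (rule bounded_opI[where K = "cmod c"])
    (simp_all add: scaleC_add_right scaleC_scaleC mult.commute norm_scaleC_hilbert)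

lemma bounded_op_scaleC_comp: "bounded_op T \<Longrightarrow> bounded_op (\<lambda>x. c *\<^sub>C T x)"
  by (rule bounded_op_compose[OF bounded_op_scaleC_op])

lemma bounded_op_neg: "bounded_op T \<Longrightarrow> bounded_op (\<lambda>x. - T x)"
  using bounded_op_scaleC_comp[of T "-1"] by simp

lemma bounded_op_plus: "bounded_op T \<Longrightarrow> bounded_op U \<Longrightarrow> bounded_op (\<lambda>x. T x + U x)"
  by (simp add: bounded_op_def bounded_linear_add scaleC_add_right)

lemma bounded_op_sub: "bounded_op T \<Longrightarrow> bounded_op U \<Longrightarrow> bounded_op (\<lambda>x. T x - U x)"
  by (simp add: bounded_op_def bounded_linear_sub scaleC_diff_right)

lemma bounded_op_finite_sum:
  "(\<And>i. i \<in> I \<Longrightarrow> bounded_op (T i)) \<Longrightarrow> bounded_op (\<lambda>x. \<Sum>i\<in>I. T i x)"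
  by (induction I rule: infinite_finite_induct) (auto intro: bounded_op_plus bounded_op_0)

lemma bounded_op_block:
  assumes "bounded_op a" "bounded_op b" "bounded_op c" "bounded_op d"
  shows "bounded_op (block_op a b c d)"
proof -
  have "bounded_linear (\<lambda>z. (a (fst z) + b (snd z), c (fst z) + d (snd z)))"
    by (intro bounded_linear_Pair bounded_linear_add
        bounded_linear_compose[OF assms(1)[THEN bounded_op_linear] bounded_linear_fst]
        bounded_linear_compose[OF assms(2)[THEN bounded_op_linear] bounded_linear_snd]
        bounded_linear_compose[OF assms(3)[THEN bounded_op_linear] bounded_linear_fst]
        bounded_linear_compose[OF assms(4)[THEN bounded_op_linear] bounded_linear_snd])
  then show ?thesis
    using assms
    by (simp add: bounded_op_def block_op_def case_prod_unfold scaleC_prod_def scaleC_add_right)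
qed

lemma bounded_op_commutator:
  assumes "bounded_op T" "bounded_op U" shows "bounded_op (commutator T U)"
  unfolding commutator_def
  by (rule bounded_op_sub[OF bounded_op_compose[OF assms] bounded_op_compose[OF assms(2,1)]])

lemma is_adjoint_inner: "is_adjoint T T' \<Longrightarrow> inner (T x) y = inner x (T' y)"
  by (simp add: is_adjoint_def flip: Re_cinner)

lemma is_adjoint_sym: "is_adjoint T T' \<Longrightarrow> is_adjoint T' T"
  unfolding is_adjoint_def by (metis cinner_commute)

lemma is_adjoint_compose:
  "is_adjoint T T' \<Longrightarrow> is_adjoint U U' \<Longrightarrow> is_adjoint (\<lambda>x. T (U x)) (\<lambda>x. U' (T' x))"
  by (simp add: is_adjoint_def)

lemma is_adjoint_scaleC: "is_adjoint T T' \<Longrightarrow> is_adjoint (\<lambda>x. c *\<^sub>C T x) (\<lambda>x. cnj c *\<^sub>C T' x)"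
  by (simp add: is_adjoint_def cinner_scaleC_left cinner_scaleC_right)

lemma is_adjoint_plus:
  "is_adjoint T T' \<Longrightarrow> is_adjoint U U' \<Longrightarrow> is_adjoint (\<lambda>x. T x + U x) (\<lambda>x. T' x + U' x)"
  by (simp add: is_adjoint_def cinner_add_left cinner_add_right)

lemma is_adjoint_neg: "is_adjoint T T' \<Longrightarrow> is_adjoint (\<lambda>x. - T x) (\<lambda>x. - T' x)"
  by (simp add: is_adjoint_def)

lemma is_adjoint_0: "is_adjoint (\<lambda>_. 0) (\<lambda>_. 0)"
  by (simp add: is_adjoint_def)

lemma is_adjoint_id: "is_adjoint (\<lambda>x. x) (\<lambda>x. x)"
  by (simp add: is_adjoint_def)

lemma is_adjoint_block:
  fixes a b c d :: "'h::complex_hilbert \<Rightarrow> 'h"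
  assumes "is_adjoint a a'" "is_adjoint b b'" "is_adjoint c c'" "is_adjoint d d'"
  shows "is_adjoint (block_op a b c d) (block_op a' c' b' d')"
  using assms
  by (auto simp: is_adjoint_def block_op_def cinner_prod_def cinner_add_left cinner_add_right)

text \<open>The C*-identity for operators: \<open>\<parallel>T x\<parallel>\<^sup>2 = \<langle>x, T\<^sup>* T x\<rangle>\<close>, so the norm of \<open>T\<^sup>* T\<close> controls that of
  \<open>T\<close>, and applied to \<open>T\<^sup>*\<close> the same computation shows \<open>\<parallel>T\<^sup>*\<parallel> \<le> \<parallel>T\<parallel>\<close>.\<close>

lemma onorm_cstar_identity:
  fixes T :: "'h::complex_hilbert \<Rightarrow> 'h"
  assumes T: "bounded_linear T" and T': "bounded_linear T'" and adj: "is_adjoint T T'"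
  shows "onorm (\<lambda>x. T' (T x)) = (onorm T)\<^sup>2"
proof (rule antisym)
  have le: "norm (T' x) \<le> onorm T * norm x" for x
  proof -
    have "(norm (T' x))\<^sup>2 = inner (T (T' x)) x"
      by (simp add: is_adjoint_inner[OF adj] power2_norm_eq_inner)
    also have "\<dots> \<le> norm (T (T' x)) * norm x" by (rule norm_cauchy_schwarz)
    also have "\<dots> \<le> onorm T * norm (T' x) * norm x"
      by (intro mult_right_mono onorm[OF T]) simp
    finally have "norm (T' x) * norm (T' x) \<le> norm (T' x) * (onorm T * norm x)"
      by (simp add: power2_eq_square algebra_simps)
    then show ?thesis
    proof (cases "norm (T' x) = 0")
      case False
      then have "0 < norm (T' x)" by simp
      with \<open>norm (T' x) * norm (T' x) \<le> _\<close> show ?thesis by (rule mult_left_le_imp_le)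
    qed (simp add: onorm_pos_le[OF T])
  qed
  show "onorm (\<lambda>x. T' (T x)) \<le> (onorm T)\<^sup>2"
  proof (rule onorm_bound)
    fix x
    have "norm (T' (T x)) \<le> onorm T * norm (T x)" by (rule le)
    also have "\<dots> \<le> onorm T * (onorm T * norm x)"
      by (intro mult_left_mono onorm[OF T] onorm_pos_le[OF T])
    finally show "norm (T' (T x)) \<le> (onorm T)\<^sup>2 * norm x"
      by (simp add: power2_eq_square)
  qed simp
  let ?N = "onorm (\<lambda>x. T' (T x))"
  have bl: "bounded_linear (\<lambda>x. T' (T x))" by (rule bounded_linear_compose[OF T' T])
  have "norm (T x) \<le> sqrt ?N * norm x" for x
  proof -
    have "(norm (T x))\<^sup>2 = inner x (T' (T x))"
      by (simp add: is_adjoint_inner[OF adj, symmetric] power2_norm_eq_inner)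
    also have "\<dots> \<le> norm x * norm (T' (T x))" by (rule norm_cauchy_schwarz)
    also have "\<dots> \<le> norm x * (?N * norm x)"
      by (intro mult_left_mono onorm[OF bl]) simp
    finally have "(norm (T x))\<^sup>2 \<le> (sqrt ?N * norm x)\<^sup>2"
      by (simp add: power_mult_distrib onorm_pos_le[OF bl])
         (simp add: power2_eq_square algebra_simps)
    then show ?thesis
      by (rule power2_le_imp_le) (simp add: onorm_pos_le[OF bl])
  qed
  then have "onorm T \<le> sqrt ?N"
    by (intro onorm_bound) (simp_all add: onorm_pos_le[OF bl])
  then have "(onorm T)\<^sup>2 \<le> (sqrt ?N)\<^sup>2"
    by (rule power_mono) (rule onorm_pos_le[OF T])
  then show "(onorm T)\<^sup>2 \<le> ?N" by (simp add: onorm_pos_le[OF bl])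
qed


section \<open>Orthonormal bases and traces\<close>

lemma orthonormal_basisI:
  assumes "\<And>b b'. b \<in> B \<Longrightarrow> b' \<in> B \<Longrightarrow> cinner b b' = (if b = b' then 1 else 0)"
    and "\<And>x \<epsilon>. 0 < \<epsilon> \<Longrightarrow> \<exists>B0 c. finite B0 \<and> B0 \<subseteq> B \<and> norm (x - (\<Sum>b\<in>B0. c b *\<^sub>C b)) < \<epsilon>"
  shows "orthonormal_basis B"
  unfolding orthonormal_basis_def
proof (intro conjI ballI)
  show "closure {\<Sum>b\<in>B0. c b *\<^sub>C b | B0 c. finite B0 \<and> B0 \<subseteq> B} = UNIV" (is "closure ?X = _")
  proof (intro equalityI subset_UNIV subsetI)
    fix x
    show "x \<in> closure ?X"
      unfolding closure_approachable
    proof (intro allI impI)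
      fix \<epsilon> :: real assume "0 < \<epsilon>"
      from assms(2)[OF this, of x] obtain B0 c
        where "finite B0" "B0 \<subseteq> B" "norm (x - (\<Sum>b\<in>B0. c b *\<^sub>C b)) < \<epsilon>" by auto
      then show "\<exists>y\<in>?X. dist y x < \<epsilon>"
        by (intro bexI[of _ "\<Sum>b\<in>B0. c b *\<^sub>C b"]) (auto simp: dist_norm norm_minus_commute)
    qed
  qed
qed (rule assms(1))

lemma orthonormal_basisD:
  "orthonormal_basis B \<Longrightarrow> b \<in> B \<Longrightarrow> b' \<in> B \<Longrightarrow> cinner b b' = (if b = b' then 1 else 0)"
  by (simp add: orthonormal_basis_def)

lemma orthonormal_basis_nonzero: "orthonormal_basis B \<Longrightarrow> 0 \<notin> B"
  using orthonormal_basisD[of B 0 0] by auto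

lemma orthonormal_basisE:
  assumes "orthonormal_basis B" "0 < \<epsilon>"
  obtains B0 c where "finite B0" "B0 \<subseteq> B" "norm (x - (\<Sum>b\<in>B0. c b *\<^sub>C b)) < \<epsilon>"
proof -
  have "x \<in> closure {\<Sum>b\<in>B0. c b *\<^sub>C b | B0 c. finite B0 \<and> B0 \<subseteq> B}"
    using assms(1) by (simp add: orthonormal_basis_def)
  then show ?thesis
    using assms(2) that unfolding closure_approachable
    by (auto simp: dist_norm norm_minus_commute)
qed

text \<open>The finite partial sums of the expansion of \<open>y\<close> are its best approximations from the spans of
  finite subsets of the basis, hence converge to \<open>y\<close>.\<close>

lemma parseval:
  assumes B: "orthonormal_basis B"
  shows "((\<lambda>b. cinner x b * cinner b y) has_sum cinner x y) B"
  unfolding has_sum_def tendsto_iff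
proof (intro allI impI)
  fix \<epsilon> :: real assume e: "0 < \<epsilon>"
  define \<delta> where "\<delta> = \<epsilon> / (norm x + 1)"
  have d: "0 < \<delta>" using e by (simp add: \<delta>_def add_nonneg_pos)
  obtain B0 c where B0: "finite B0" "B0 \<subseteq> B" and s: "norm (y - (\<Sum>b\<in>B0. c b *\<^sub>C b)) < \<delta>"
    using orthonormal_basisE[OF B d] .
  show "\<forall>\<^sub>F F in finite_subsets_at_top B.
      dist (\<Sum>b\<in>F. cinner x b * cinner b y) (cinner x y) < \<epsilon>"
    unfolding eventually_finite_subsets_at_top
  proof (intro exI[of _ B0] conjI allI impI B0)
    fix F assume "finite F \<and> B0 \<subseteq> F \<and> F \<subseteq> B"
    then have F: "finite F" "B0 \<subseteq> F" "F \<subseteq> B" by auto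
    define P where "P = (\<Sum>b\<in>F. cinner b y *\<^sub>C b)"
    define s where "s = (\<Sum>b\<in>B0. c b *\<^sub>C b)"
    have orth: "cinner (y - P) b = 0" if "b \<in> F" for b
    proof -
      have "cinner b P = (\<Sum>b'\<in>F. cinner b' y * (if b = b' then 1 else 0))"
        unfolding P_def cinner_sum_right cinner_scaleC_right
        using F that by (intro sum.cong refl) (simp add: orthonormal_basisD[OF B] subset_iff)
      also have "\<dots> = cinner b y"
        using F that by (simp add: if_distrib cong: if_cong)
      finally have "cinner b (y - P) = 0" by (simp add: cinner_diff_right)
      then show ?thesis using cinner_commute[of "y - P" b] by simp
    qed
    have "cinner (y - P) P = 0" "cinner (y - P) s = 0"
      unfolding P_def s_def cinner_sum_right cinner_scaleC_right
      using F(2) by (auto simp: orth[unfolded P_def] intro!: sum.neutral)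
    then have "inner (y - P) (P - s) = 0"
      by (simp add: cinner_diff_right flip: Re_cinner)
    then have "(norm (y - P + (P - s)))\<^sup>2 = (norm (y - P))\<^sup>2 + (norm (P - s))\<^sup>2"
      by (rule norm_add_Pythagorean[unfolded orthogonal_def])
    then have "(norm (y - P))\<^sup>2 \<le> (norm (y - s))\<^sup>2" by simp
    then have "norm (y - P) \<le> norm (y - s)" by (rule power2_le_imp_le) simp
    then have le: "norm (y - P) < \<delta>" using s by (simp add: s_def)
    have "(\<Sum>b\<in>F. cinner x b * cinner b y) - cinner x y = - cinner x (y - P)"
      by (simp add: P_def cinner_diff_right cinner_sum_right cinner_scaleC_right mult.commute)
    then have "dist (\<Sum>b\<in>F. cinner x b * cinner b y) (cinner x y) \<le> norm x * norm (y - P)"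
      by (simp only: dist_norm norm_minus_cancel cmod_cinner_le)
    also have "\<dots> \<le> norm x * \<delta>" using le by (intro mult_left_mono) auto
    also have "\<dots> < \<epsilon>"
      using e by (simp add: \<delta>_def divide_simps add_nonneg_pos)
    finally show "dist (\<Sum>b\<in>F. cinner x b * cinner b y) (cinner x y) < \<epsilon>" .
  qed
qed

lemma orthonormal_basis_complex: "orthonormal_basis {1::complex}"
proof (rule orthonormal_basisI)
  fix x :: complex and \<epsilon> :: real assume "0 < \<epsilon>"
  then show "\<exists>B0 c. finite B0 \<and> B0 \<subseteq> {1::complex} \<and> norm (x - (\<Sum>b\<in>B0. c b *\<^sub>C b)) < \<epsilon>"
    by (intro exI[of _ "{1}"] exI[of _ "\<lambda>_. x"]) (simp add: scaleC_complex_def)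
qed (simp add: cinner_complex_def)

lemma coord_ket: "coord (ket i) j = (if j = i then 1 else 0)"
  by transfer simp

lemma coord_sum: "coord (\<Sum>k\<in>K. f k) i = (\<Sum>k\<in>K. coord (f k) i)"
  by (induction K rule: infinite_finite_induct) (simp_all add: coord_zero coord_add)

lemma cinner_ket: "cinner (ket i) x = coord x i"
proof -
  have "cinner (ket i) x = (\<Sum>\<^sub>\<infinity>j\<in>{i}. cnj (coord (ket i) j) * coord x j)"
    unfolding cinner_ell2_def by (rule infsum_cong_neutral) (auto simp: coord_ket)
  then show ?thesis by (simp add: coord_ket)
qed

lemma orthonormal_basis_ket: "orthonormal_basis (range (ket :: 'i \<Rightarrow> 'i ell2))"
proof (rule orthonormal_basisI)
  have inj: "ket i = ket j \<longleftrightarrow> i = j" for i j :: 'i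
    by (metis coord_ket zero_neq_one)
  fix b b' :: "'i ell2" assume "b \<in> range ket" "b' \<in> range ket"
  then show "cinner b b' = (if b = b' then 1 else 0)"
    by (auto simp: cinner_ket coord_ket inj)
next
  fix x :: "'i ell2" and \<epsilon> :: real assume e: "0 < \<epsilon>"
  have "((\<lambda>i. (cmod (coord x i))\<^sup>2) has_sum (norm x)\<^sup>2) UNIV"
    by (simp add: norm_ell2_sq coord_sqsummable)
  then have "\<forall>\<^sub>F F in finite_subsets_at_top UNIV.
      dist (\<Sum>i\<in>F. (cmod (coord x i))\<^sup>2) ((norm x)\<^sup>2) < \<epsilon>\<^sup>2"
    using e by (simp add: has_sum_def tendsto_iff)
  then obtain F where F: "finite F" "dist (\<Sum>i\<in>F. (cmod (coord x i))\<^sup>2) ((norm x)\<^sup>2) < \<epsilon>\<^sup>2"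
    by (auto simp: eventually_finite_subsets_at_top)
  define s where "s = (\<Sum>i\<in>F. coord x i *\<^sub>C ket i)"
  have cs: "coord s i = (if i \<in> F then coord x i else 0)" for i
    using F by (simp add: s_def coord_sum coord_scaleC coord_ket if_distrib cong: if_cong)
  have "inner s (x - s) = 0"
    unfolding Re_cinner[symmetric] cinner_ell2_def
    by (subst infsum_0) (auto simp: coord_diff cs)
  then have "(norm (s + (x - s)))\<^sup>2 = (norm s)\<^sup>2 + (norm (x - s))\<^sup>2"
    by (rule norm_add_Pythagorean[unfolded orthogonal_def])
  moreover have "(norm s)\<^sup>2 = (\<Sum>i\<in>F. (cmod (coord x i))\<^sup>2)"
  proof -
    have "(norm s)\<^sup>2 = (\<Sum>\<^sub>\<infinity>i\<in>F. (cmod (coord x i))\<^sup>2)"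
      unfolding norm_ell2_sq by (rule infsum_cong_neutral) (auto simp: cs)
    then show ?thesis using F by simp
  qed
  ultimately have "(norm (x - s))\<^sup>2 < \<epsilon>\<^sup>2"
    using F by (simp add: dist_real_def)
  then have lt: "norm (x - s) < \<epsilon>" using e by (simp add: power2_less_imp_less)
  have inj: "inj_on ket F" by (metis coord_ket inj_onI zero_neq_one)
  have "s = (\<Sum>b\<in>ket ` F. (coord x (inv_into F ket b)) *\<^sub>C b)"
    by (simp add: sum.reindex[OF inj] inv_into_f_f[OF inj] s_def)
  with lt F show "\<exists>B0 c. finite B0 \<and> B0 \<subseteq> range ket \<and> norm (x - (\<Sum>b\<in>B0. c b *\<^sub>C b)) < \<epsilon>"
    by (intro exI[of _ "ket ` F"] exI[of _ "\<lambda>b. coord x (inv_into F ket b)"]) auto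
qed

lemma orthonormal_basis_prod:
  fixes B :: "'h::complex_hilbert set" and B' :: "'k::complex_hilbert set"
  assumes B: "orthonormal_basis B" and B': "orthonormal_basis B'"
  shows "orthonormal_basis ((\<lambda>b. (b, 0)) ` B \<union> (\<lambda>b. (0, b)) ` B')"
proof (rule orthonormal_basisI)
  have nz: "0 \<notin> B" "0 \<notin> B'"
    using B B' by (auto dest: orthonormal_basis_nonzero)
  fix b b' :: "'h \<times> 'k"
  assume "b \<in> (\<lambda>b. (b, 0)) ` B \<union> (\<lambda>b. (0, b)) ` B'" "b' \<in> (\<lambda>b. (b, 0)) ` B \<union> (\<lambda>b. (0, b)) ` B'"
  then show "cinner b b' = (if b = b' then 1 else 0)"
    using nz
    by (auto simp: orthonormal_basisD[OF B] orthonormal_basisD[OF B'] cinner_prod_def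
        split: if_splits)
next
  fix x :: "'h \<times> 'k" and \<epsilon> :: real assume "0 < \<epsilon>"
  then have e: "0 < \<epsilon> / 2" by simp
  have nz: "0 \<notin> B" "0 \<notin> B'"
    using B B' by (auto dest: orthonormal_basis_nonzero)
  obtain B0 c where B0: "finite B0" "B0 \<subseteq> B" "norm (fst x - (\<Sum>b\<in>B0. c b *\<^sub>C b)) < \<epsilon> / 2"
    using orthonormal_basisE[OF B e] .
  obtain B1 d where B1: "finite B1" "B1 \<subseteq> B'" "norm (snd x - (\<Sum>b\<in>B1. d b *\<^sub>C b)) < \<epsilon> / 2"
    using orthonormal_basisE[OF B' e] .
  define C where "C = (\<lambda>b. (b, 0::'k)) ` B0 \<union> (\<lambda>b. (0::'h, b)) ` B1"
  define f where "f z = (if snd z = 0 then c (fst z) else d (snd z))" for z :: "'h \<times> 'k"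
  have "(\<Sum>z\<in>C. f z *\<^sub>C z) = (\<Sum>z\<in>(\<lambda>b. (b, 0::'k)) ` B0. f z *\<^sub>C z)
      + (\<Sum>z\<in>(\<lambda>b. (0::'h, b)) ` B1. f z *\<^sub>C z)"
    unfolding C_def using B0(1,2) B1(1,2) nz by (intro sum.union_disjoint) auto
  also have "(\<Sum>z\<in>(\<lambda>b. (b, 0::'k)) ` B0. f z *\<^sub>C z) = (\<Sum>b\<in>B0. (c b *\<^sub>C b, 0))"
    by (subst sum.reindex) (auto simp: inj_on_def f_def scaleC_prod_def)
  also have "(\<Sum>z\<in>(\<lambda>b. (0::'h, b)) ` B1. f z *\<^sub>C z) = (\<Sum>b\<in>B1. (0, d b *\<^sub>C b))"
  proof -
    have "f (0, b) *\<^sub>C (0::'h, b) = (0, d b *\<^sub>C b)" if "b \<in> B1" for b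
      using that B1(2) nz(2) by (auto simp: f_def scaleC_prod_def)
    then show ?thesis
      by (subst sum.reindex) (simp_all add: inj_on_def)
  qed
  finally have "x - (\<Sum>z\<in>C. f z *\<^sub>C z)
      = (fst x - (\<Sum>b\<in>B0. c b *\<^sub>C b), snd x - (\<Sum>b\<in>B1. d b *\<^sub>C b))"
    by (simp add: prod_eq_iff fst_sum snd_sum)
  then have "norm (x - (\<Sum>z\<in>C. f z *\<^sub>C z))
      = norm (fst x - (\<Sum>b\<in>B0. c b *\<^sub>C b), snd x - (\<Sum>b\<in>B1. d b *\<^sub>C b))"
    by (simp only:)
  also have "\<dots> \<le> norm (fst x - (\<Sum>b\<in>B0. c b *\<^sub>C b)) + norm (snd x - (\<Sum>b\<in>B1. d b *\<^sub>C b))"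
    by (rule norm_Pair_le)
  also have "\<dots> < \<epsilon>" using B0(3) B1(3) by linarith
  finally have "norm (x - (\<Sum>z\<in>C. f z *\<^sub>C z)) < \<epsilon>" .
  moreover have "finite C" using B0(1) B1(1) by (simp add: C_def)
  moreover have "C \<subseteq> (\<lambda>b. (b, 0)) ` B \<union> (\<lambda>b. (0, b)) ` B'"
    unfolding C_def by (intro Un_mono image_mono B0(2) B1(2))
  ultimately show "\<exists>B0 c. finite B0 \<and> B0 \<subseteq> (\<lambda>b. (b, 0)) ` B \<union> (\<lambda>b. (0, b)) ` B'
      \<and> norm (x - (\<Sum>b\<in>B0. c b *\<^sub>C b)) < \<epsilon>"
    by (intro exI[of _ C] exI[of _ f] conjI)
qed

text \<open>The trace operator sums over an arbitrarily chosen basis, so the value is required for all of them.\<close>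

definition has_trace :: "('h::complex_hilbert \<Rightarrow> 'h) \<Rightarrow> complex \<Rightarrow> bool"
  where "has_trace T t \<longleftrightarrow> (\<forall>B. orthonormal_basis B \<longrightarrow> ((\<lambda>b. cinner b (T b)) has_sum t) B)"

lemma has_trace_rank_one: "has_trace (\<lambda>x. cinner w x *\<^sub>C v) (cinner w v)"
  unfolding has_trace_def
  using parseval[of _ w v] by (simp add: cinner_scaleC_right)

lemma has_trace_add: "has_trace T t \<Longrightarrow> has_trace U s \<Longrightarrow> has_trace (\<lambda>x. T x + U x) (t + s)"
  by (simp add: has_trace_def cinner_add_right has_sum_add)

lemma has_trace_zero: "has_trace (\<lambda>_. 0) 0"
  by (simp add: has_trace_def)

lemma has_trace_scaleC: "has_trace T t \<Longrightarrow> has_trace (\<lambda>x. c *\<^sub>C T x) (c * t)"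
  by (simp add: has_trace_def cinner_scaleC_right has_sum_cmult_right)

lemma has_trace_sum:
  "(\<And>i. i \<in> I \<Longrightarrow> has_trace (T i) (t i)) \<Longrightarrow> has_trace (\<lambda>x. \<Sum>i\<in>I. T i x) (\<Sum>i\<in>I. t i)"
  by (induction I rule: infinite_finite_induct) (auto intro: has_trace_add has_trace_zero)

lemma trace_op_eq:
  assumes "has_trace T t" "orthonormal_basis (B :: 'h::complex_hilbert set)"
  shows "trace_op (T :: 'h \<Rightarrow> 'h) = t"
  using assms someI[of orthonormal_basis B] by (auto simp: trace_op_def has_trace_def intro!: infsumI)

lemma has_trace_diagonal_finite_rank:
  fixes a b :: "'i \<Rightarrow> 'h::complex_hilbert" and c d :: "'i \<Rightarrow> 'k::complex_hilbert"
  shows "has_trace (\<lambda>(x, y). (\<Sum>k\<in>K. cinner (a k) x *\<^sub>C b k, \<Sum>k\<in>K. cinner (c k) y *\<^sub>C d k))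
    ((\<Sum>k\<in>K. cinner (a k) (b k)) + (\<Sum>k\<in>K. cinner (c k) (d k)))"
proof -
  have "has_trace (\<lambda>z. (\<Sum>k\<in>K. cinner (a k, 0::'k) z *\<^sub>C (b k, 0::'k))
        + (\<Sum>k\<in>K. cinner (0::'h, c k) z *\<^sub>C (0::'h, d k)))
      ((\<Sum>k\<in>K. cinner (a k, 0::'k) (b k, 0::'k)) + (\<Sum>k\<in>K. cinner (0::'h, c k) (0::'h, d k)))"
    by (intro has_trace_add has_trace_sum has_trace_rank_one)
  also have "(\<lambda>z. (\<Sum>k\<in>K. cinner (a k, 0::'k) z *\<^sub>C (b k, 0::'k))
        + (\<Sum>k\<in>K. cinner (0::'h, c k) z *\<^sub>C (0::'h, d k)))
      = (\<lambda>(x, y). (\<Sum>k\<in>K. cinner (a k) x *\<^sub>C b k, \<Sum>k\<in>K. cinner (c k) y *\<^sub>C d k))"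
    by (auto simp: fun_eq_iff prod_eq_iff fst_sum snd_sum scaleC_prod_def cinner_prod_def)
  finally show ?thesis by (simp add: cinner_prod_def)
qed


section \<open>Compact operators\<close>

lemma compact_opI:
  assumes "bounded_op T" "compact K" "\<And>x. norm x \<le> 1 \<Longrightarrow> T x \<in> K"
  shows "compact_op T"
proof -
  have "closure (T ` cball 0 1) \<subseteq> K"
    using assms by (intro closure_minimal compact_imp_closed) auto
  then have "compact (closure (T ` cball 0 1))"
    by (metis assms(2) closed_closure compact_Int_closed inf.absorb_iff2)
  then show ?thesis using assms(1) by (simp add: compact_op_def)
qed

lemma compact_op_bounded: "compact_op T \<Longrightarrow> bounded_op T"
  by (simp add: compact_op_def)

lemma compact_opE:
  assumes "compact_op T" obtains K where "compact K" "\<forall>x. norm x \<le> 1 \<longrightarrow> T x \<in> K"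
  using assms closure_subset[of "T ` cball 0 1"]
  by (intro that[of "closure (T ` cball 0 1)"]) (auto simp: compact_op_def image_subset_iff)

lemma compact_op_zero: "compact_op (\<lambda>_. 0)"
  by (rule compact_opI[OF bounded_op_0, of "{0}"]) auto

lemma compact_op_add:
  assumes "compact_op T" "compact_op U" shows "compact_op (\<lambda>x. T x + U x)"
proof -
  obtain K where K: "compact K" "\<forall>x. norm x \<le> 1 \<longrightarrow> T x \<in> K" using compact_opE[OF assms(1)] .
  obtain L where L: "compact L" "\<forall>x. norm x \<le> 1 \<longrightarrow> U x \<in> L" using compact_opE[OF assms(2)] .
  show ?thesis
    by (rule compact_opI[OF _ compact_sums[OF K(1) L(1)]])
      (use K L assms in \<open>auto intro: bounded_op_plus compact_op_bounded\<close>)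
qed

lemma compact_op_scaleC: "compact_op T \<Longrightarrow> compact_op (\<lambda>x. c *\<^sub>C T x)"
proof -
  assume T: "compact_op T"
  obtain K where K: "compact K" "\<forall>x. norm x \<le> 1 \<longrightarrow> T x \<in> K" using compact_opE[OF T] .
  have "continuous_on K ((*\<^sub>C) c)"
    using bounded_op_linear[OF bounded_op_scaleC_op] by (rule linear_continuous_on)
  then have "compact ((*\<^sub>C) c ` K)" using K(1) by (rule compact_continuous_image)
  then show ?thesis
    by (rule compact_opI[rotated]) (use K T in \<open>auto intro: bounded_op_scaleC_comp compact_op_bounded\<close>)
qed

lemma compact_op_sum:
  "(\<And>i. i \<in> I \<Longrightarrow> compact_op (T i)) \<Longrightarrow> compact_op (\<lambda>x. \<Sum>i\<in>I. T i x)"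
  by (induction I rule: infinite_finite_induct) (auto intro: compact_op_add compact_op_zero)

lemma compact_op_rank_one:
  fixes v :: "'h::complex_hilbert"
  shows "compact_op (\<lambda>x. cinner w x *\<^sub>C v)"
proof (rule compact_opI)
  have bnd: "norm (cinner w x *\<^sub>C v) \<le> (norm w * norm v) * norm x" for x
    using mult_right_mono[OF cmod_cinner_le[of w x], of "norm v"]
    by (simp add: norm_scaleC_hilbert algebra_simps)
  show "bounded_op (\<lambda>x. cinner w x *\<^sub>C v)"
    by (rule bounded_opI[OF _ _ bnd])
      (simp_all add: cinner_add_right cinner_scaleC_right scaleC_add_left scaleC_scaleC)
  have "bounded_linear (\<lambda>c::complex. c *\<^sub>C v)"
    by (rule bounded_linear_intro[where K = "norm v"])
      (simp_all add: scaleC_add_left norm_scaleC_hilbert scaleR_conv_of_real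
        flip: scaleC_scaleC scaleC_of_real)
  then have "continuous_on (cball 0 (norm w)) (\<lambda>c. c *\<^sub>C v)" by (rule linear_continuous_on)
  then show "compact ((\<lambda>c. c *\<^sub>C v) ` cball 0 (norm w))"
    by (rule compact_continuous_image) simp
  fix x :: 'h assume "norm x \<le> 1"
  then have "cmod (cinner w x) \<le> norm w"
    using cmod_cinner_le[of w x] mult_left_le[of "norm x" "norm w"] by simp
  then show "cinner w x *\<^sub>C v \<in> (\<lambda>c. c *\<^sub>C v) ` cball 0 (norm w)" by auto
qed

text \<open>The image of the unit ball under \<open>T\<close> inherits total boundedness from its images under the
  approximating operators.\<close>

lemma compact_op_limit:
  assumes T: "bounded_op (T :: 'h::complex_hilbert \<Rightarrow> 'h)"
    and approx: "\<And>\<epsilon>. 0 < \<epsilon> \<Longrightarrow> \<exists>U. compact_op U \<and> (\<forall>x. norm (T x - U x) \<le> \<epsilon> * norm x)"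
  shows "compact_op T"
  unfolding compact_op_def compact_eq_totally_bounded
proof (intro conjI allI impI T)
  show "complete (closure (T ` cball 0 1))" by (simp add: complete_eq_closed)
  fix \<epsilon> :: real assume "0 < \<epsilon>"
  then have e: "0 < \<epsilon> / 3" by simp
  obtain U where U: "compact_op U" "\<And>x. norm (T x - U x) \<le> \<epsilon> / 3 * norm x"
    using approx[OF e] by auto
  obtain K where K: "compact K" "\<forall>x. norm x \<le> 1 \<longrightarrow> U x \<in> K" using compact_opE[OF U(1)] .
  from K(1) e obtain N where N: "finite N" "K \<subseteq> (\<Union>z\<in>N. ball z (\<epsilon> / 3))"
    unfolding compact_eq_totally_bounded by blast
  have "T ` cball 0 1 \<subseteq> (\<Union>z\<in>N. cball z (2 * \<epsilon> / 3))"
  proof clarify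
    fix x :: 'h assume "x \<in> cball 0 1"
    then have x: "norm x \<le> 1" by simp
    from K(2) x have "U x \<in> K" by blast
    with N obtain z where z: "z \<in> N" "dist z (U x) < \<epsilon> / 3" by auto
    have "dist (U x) (T x) \<le> \<epsilon> / 3"
      using order_trans[OF U(2)[of x] mult_left_le[OF x]] e
      by (simp add: dist_norm norm_minus_commute)
    with z dist_triangle[of z "T x" "U x"] have "dist z (T x) \<le> 2 * \<epsilon> / 3" by linarith
    with z show "T x \<in> (\<Union>z\<in>N. cball z (2 * \<epsilon> / 3))" by auto
  qed
  then have "closure (T ` cball 0 1) \<subseteq> (\<Union>z\<in>N. cball z (2 * \<epsilon> / 3))"
    by (rule closure_minimal) (use N in \<open>auto intro: closed_UN\<close>)
  also have "\<dots> \<subseteq> (\<Union>z\<in>N. ball z \<epsilon>)" using \<open>0 < \<epsilon>\<close> by (intro UN_mono subset_refl) auto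
  finally show "\<exists>k. finite k \<and> closure (T ` cball 0 1) \<subseteq> (\<Union>x\<in>k. ball x \<epsilon>)"
    using N(1) by blast
qed

section \<open>Automatic continuity\<close>

lemma norm_star: "norm (star x) = norm (x::'a::cstar_algebra)"
proof -
  have le: "norm y \<le> norm (star y)" for y :: 'a
  proof (cases "y = 0")
    case False
    then have "norm y * norm y \<le> norm (star y) * norm y"
      using norm_mult_ineq[of "star y" y] by (simp add: cstar_identity power2_eq_square)
    with False show ?thesis by simp
  qed simp
  from le[of x] le[of "star x"] show ?thesis by (simp add: star_star)
qed

lemma star_one [simp]: "star (1::'a::cstar_algebra) = 1"
  by (metis mult.right_neutral star_mult star_star)

lemma star_zero [simp]: "star (0::'a::cstar_algebra) = 0"
  using star_add[of "0::'a" 0] by simp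

lemma star_minus: "star (- x) = - star (x::'a::cstar_algebra)"
  using star_scaleC[of "-1" x] by simp

lemma star_diff: "star (x - y) = star x - star (y::'a::cstar_algebra)"
  using star_add[of x "- y"] by (simp add: star_minus)

lemma star_scaleR: "star (r *\<^sub>R x) = r *\<^sub>R star (x::'a::cstar_algebra)"
  using star_scaleC[of "complex_of_real r" x] by (simp add: scaleC_of_real)

lemma bounded_linear_star: "bounded_linear (star :: 'a::cstar_algebra \<Rightarrow> 'a)"
  by (rule bounded_linear_intro[where K = 1]) (simp_all add: star_add star_scaleR norm_star)

lemma continuous_on_star [continuous_intros]:
  "continuous_on X f \<Longrightarrow> continuous_on X (\<lambda>x. star (f x :: 'a::cstar_algebra))"
  by (rule bounded_linear.continuous_on[OF bounded_linear_star])

lemma bounded_linear_scaleC: "bounded_linear ((*\<^sub>C) c :: 'a::cstar_algebra \<Rightarrow> 'a)"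
  by (rule bounded_linear_intro[where K = "cmod c"])
    (simp_all add: scaleC_add_right scaleC_real_commute norm_scaleC)

lemma continuous_on_scaleC [continuous_intros]:
  "continuous_on X f \<Longrightarrow> continuous_on X (\<lambda>x. c *\<^sub>C (f x :: 'a::cstar_algebra))"
  by (rule bounded_linear.continuous_on[OF bounded_linear_scaleC])

text \<open>With \<open>b = 1 - y\<close> the equation \<open>b\<^sup>2 = 1 - a\<^sup>2\<close> reads \<open>y = (a\<^sup>2 + y\<^sup>2) / 2\<close>, and the right hand side is
  a contraction of the ball of radius \<open>1/2\<close>.  Its fixed point inherits every closed property that
  the iteration preserves, here being selfadjoint and commuting with \<open>a\<close>.\<close>

lemma selfadjoint_complementary_root:
  fixes a :: "'a::cstar_algebra"
  assumes a: "star a = a" and small: "(norm a)\<^sup>2 \<le> 1/2"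
  obtains b where "star b = b" "a * b = b * a" "b * b = 1 - a * a"
proof -
  define X where "X = {y::'a. norm y \<le> 1/2 \<and> star y = y \<and> a * y = y * a}"
  define f where "f y = (1/2) *\<^sub>R (a * a + y * y)" for y
  have "closed X"
    unfolding X_def by (intro closed_Collect_conj closed_Collect_eq closed_Collect_le continuous_intros)
  then have "complete X" by (simp add: complete_eq_closed)
  moreover have "X \<noteq> {}" using a by (auto simp: X_def intro!: exI[of _ 0])
  moreover have "f ` X \<subseteq> X"
  proof clarify
    fix y assume "y \<in> X"
    then have y: "norm y \<le> 1/2" "star y = y" "a * y = y * a" by (auto simp: X_def)
    have "norm (y * y) \<le> norm y * norm y" by (rule norm_mult_ineq)
    also have "\<dots> \<le> (1/2) * (1/2)" using y by (intro mult_mono) auto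
    finally have "norm (y * y) \<le> 1/2" by simp
    moreover have "norm (a * a) \<le> 1/2"
      using norm_mult_ineq[of a a] small by (simp add: power2_eq_square)
    ultimately have "norm (a * a + y * y) \<le> 1"
      using norm_triangle_ineq[of "a * a" "y * y"] by linarith
    moreover have "a * (y * y) = y * y * a" by (metis mult.assoc y(3))
    ultimately have "norm (f y) \<le> 1/2" "a * f y = f y * a"
      by (simp_all add: f_def distrib_left distrib_right mult.assoc)
    then show "f y \<in> X"
      using y a by (simp add: X_def f_def star_scaleR star_add star_mult)
  qed
  moreover have "dist (f y) (f z) \<le> 1/2 * dist y z" if "y \<in> X" "z \<in> X" for y z
  proof -
    have "y * y - z * z = y * (y - z) + (y - z) * z" by (simp add: algebra_simps)
    also have "norm \<dots> \<le> norm y * norm (y - z) + norm (y - z) * norm z"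
      by (intro norm_triangle_le add_mono norm_mult_ineq)
    also have "\<dots> \<le> 1/2 * norm (y - z) + norm (y - z) * (1/2)"
      using that by (intro add_mono mult_mono) (auto simp: X_def)
    finally have "norm (y * y - z * z) \<le> norm (y - z)" by simp
    moreover have "f y - f z = (1/2) *\<^sub>R (y * y - z * z)" by (simp add: f_def algebra_simps)
    ultimately show ?thesis by (simp add: dist_norm)
  qed
  ultimately have "\<exists>!y\<in>X. f y = y" by (intro Banach_fix[where c = "1/2"]) auto
  then obtain y where y: "y \<in> X" "f y = y" by blast
  have "y + y = 2 *\<^sub>R f y" using y by (simp add: scaleR_2)
  then have "y + y = a * a + y * y" by (simp add: f_def)
  then have "(1 - y) * (1 - y) = 1 - a * a" by (simp add: algebra_simps)
  moreover have "star (1 - y) = 1 - y" "a * (1 - y) = (1 - y) * a"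
    using y by (auto simp: X_def star_diff algebra_simps)
  ultimately show ?thesis by (rule that[rotated 2])
qed

text \<open>This is why *-homomorphisms and representations are automatically continuous.
  A small selfadjoint \<open>a\<close> is the real part \<open>(v + v\<^sup>*) / 2\<close> of the unitary \<open>v = a + i (1 - a\<^sup>2)\<^sup>1\<^sup>/\<^sup>2\<close>, and
  the C*-identity bounds a C*-seminorm on unitaries by 1.  Rescaling to norm \<open>1/2\<close> costs the factor 2,
  and the C*-identity passes from selfadjoint elements to all others.\<close>

lemma cstar_seminorm_continuous:
  fixes q :: "'a::cstar_algebra \<Rightarrow> real"
  assumes add: "\<And>x y. q (x + y) \<le> q x + q y" and scale: "\<And>c x. q (c *\<^sub>C x) = cmod c * q x"
    and cstar: "\<And>x. q (star x * x) = (q x)\<^sup>2" and nonneg: "\<And>x. 0 \<le> q x"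
  shows "q x \<le> 2 * norm x"
proof -
  have q1: "q 1 \<le> 1"
  proof -
    have "q 1 * q 1 = q 1 * 1" using cstar[of 1] by (simp add: power2_eq_square)
    then show ?thesis by (cases "q 1 = 0") auto
  qed
  have unitary: "q v \<le> 1" if "star v * v = 1" for v
    using cstar[of v] that q1 power_le_one_iff[of "q v" 2] nonneg[of v]
    by simp
  have small: "q a \<le> 1" if a: "star a = a" "(norm a)\<^sup>2 \<le> 1/2" for a
  proof -
    obtain b where b: "star b = b" "a * b = b * a" "b * b = 1 - a * a"
      using selfadjoint_complementary_root[OF a] .
    define v where "v = a + \<i> *\<^sub>C b"
    have sv: "star v = a + (-\<i>) *\<^sub>C b" by (simp add: v_def star_add star_scaleC a b)
    have "star v * v = 1" "v * star v = 1"
      unfolding sv by (simp_all add: v_def distrib_left distrib_right left_diff_distrib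
          right_diff_distrib scaleC_mult_left scaleC_mult_right scaleC_scaleC b scaleC_minus_left
          scaleC_diff_right scaleC_add_right)
    then have "q v \<le> 1" "q (star v) \<le> 1" by (simp_all add: unitary star_star)
    moreover have "2 *\<^sub>C a = v + star v"
      unfolding sv using scaleC_add_left[of 1 1 a] by (simp add: v_def scaleC_minus_left)
    then have "2 * q a \<le> q v + q (star v)"
      using scale[of 2 a] add[of v "star v"] by simp
    ultimately show ?thesis by simp
  qed
  have sa: "q a \<le> 2 * norm a" if a: "star a = a" for a
  proof (cases "a = 0")
    case True
    then show ?thesis using scale[of 0 0] by simp
  next
    case False
    define r where "r = 1 / (2 * norm a)"
    have r: "0 < r" "r * norm a = 1/2" using False by (simp_all add: r_def)
    have "norm (complex_of_real r *\<^sub>C a) = 1/2" using r by (simp add: norm_scaleC)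
    then have "(norm (complex_of_real r *\<^sub>C a))\<^sup>2 \<le> 1/2"
      by (simp only:) (simp add: power2_eq_square)
    then have "q (complex_of_real r *\<^sub>C a) \<le> 1"
      by (rule small[rotated]) (simp add: star_scaleC a)
    then have "r * q a \<le> 1" using r by (simp add: scale)
    then show ?thesis using False by (simp add: r_def divide_simps mult.commute)
  qed
  have "(q x)\<^sup>2 \<le> 2 * (norm x)\<^sup>2"
    using sa[of "star x * x"] by (simp add: cstar star_mult star_star cstar_identity)
  also have "\<dots> \<le> (2 * norm x)\<^sup>2" by (simp add: power2_eq_square)
  finally show ?thesis by (rule power2_le_imp_le) simp
qed

lemma star_hom_norm_le:
  assumes "star_hom (f :: 'a::cstar_algebra \<Rightarrow> 'b::cstar_algebra)"
  shows "norm (f x) \<le> 2 * norm x"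
proof (rule cstar_seminorm_continuous[of "\<lambda>x. norm (f x)"])
  have f: "f (x + y) = f x + f y" "f (c *\<^sub>C x) = c *\<^sub>C f x" "f (x * y) = f x * f y"
    "f (star x) = star (f x)" for x y c
    using assms by (auto simp: star_hom_def)
  show "norm (f (star x * x)) = (norm (f x))\<^sup>2" for x by (simp add: f cstar_identity)
qed (use assms in \<open>auto simp: star_hom_def norm_scaleC norm_triangle_ineq\<close>)

lemma star_hom_bounded_linear:
  assumes "star_hom (f :: 'a::cstar_algebra \<Rightarrow> 'b::cstar_algebra)"
  shows "bounded_linear f"
proof (rule bounded_linear_intro[where K = 2])
  show "f (r *\<^sub>R x) = r *\<^sub>R f x" for r x
    using assms by (simp add: star_hom_def flip: scaleC_of_real)
qed (use assms star_hom_norm_le[OF assms] in \<open>auto simp: star_hom_def mult.commute\<close>)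

lemma star_repD:
  assumes "star_rep \<pi>"
  shows "bounded_op (\<pi> a)" "\<pi> (a + b) x = \<pi> a x + \<pi> b x" "\<pi> (c *\<^sub>C a) x = c *\<^sub>C \<pi> a x"
    "\<pi> (a * b) = (\<lambda>x. \<pi> a (\<pi> b x))" "is_adjoint (\<pi> a) (\<pi> (star a))"
  using assms by (auto simp: star_rep_def o_def)

lemma onorm_scaleC:
  assumes "bounded_op (T :: 'h::complex_hilbert \<Rightarrow> 'h)"
  shows "onorm (\<lambda>x. c *\<^sub>C T x) = cmod c * onorm T"
proof -
  have "onorm (\<lambda>x. c *\<^sub>C T x) = onorm (\<lambda>x. cmod c *\<^sub>R T x)"
    by (simp add: onorm_def norm_scaleC_hilbert)
  then show ?thesis using onorm_scaleR[OF bounded_op_linear[OF assms], of "cmod c"] by simp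
qed

lemma star_rep_norm_le:
  fixes \<pi> :: "'a::cstar_algebra \<Rightarrow> 'h::complex_hilbert \<Rightarrow> 'h"
  assumes \<pi>: "star_rep \<pi>"
  shows "norm (\<pi> a x) \<le> 2 * norm a * norm x"
proof -
  note D = star_repD[OF \<pi>]
  have "onorm (\<pi> a) \<le> 2 * norm a"
  proof (rule cstar_seminorm_continuous[of "\<lambda>a. onorm (\<pi> a)"])
    show "onorm (\<pi> (a + b)) \<le> onorm (\<pi> a) + onorm (\<pi> b)" for a b
      using onorm_triangle[OF bounded_op_linear[OF D(1)[of a]] bounded_op_linear[OF D(1)[of b]]]
      by (simp flip: D(2))
    show "onorm (\<pi> (c *\<^sub>C a)) = cmod c * onorm (\<pi> a)" for c a
      using onorm_scaleC[OF D(1)[of a], of c] by (simp flip: D(3))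
    show "onorm (\<pi> (star a * a)) = (onorm (\<pi> a))\<^sup>2" for a
      unfolding D(4) by (intro onorm_cstar_identity bounded_op_linear D)
    show "0 \<le> onorm (\<pi> a)" for a by (intro onorm_pos_le bounded_op_linear D)
  qed
  then have "onorm (\<pi> a) * norm x \<le> 2 * norm a * norm x" by (rule mult_right_mono) simp
  with onorm[OF bounded_op_linear[OF D(1)], of a x] show ?thesis by linarith
qed

lemma star_rep_continuous:
  assumes \<pi>: "star_rep \<pi>"
  shows "bounded_linear (\<lambda>a. \<pi> a x)"
proof (rule bounded_linear_intro[where K = "2 * norm x"])
  show "\<pi> (r *\<^sub>R a) x = r *\<^sub>R \<pi> a x" for r a
    using star_repD(3)[OF \<pi>, of "complex_of_real r" a x] by (simp add: scaleC_of_real)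
  show "norm (\<pi> a x) \<le> norm a * (2 * norm x)" for a
    using star_rep_norm_le[OF \<pi>, of a x] by (simp add: algebra_simps)
qed (simp add: star_repD[OF \<pi>])

section \<open>The universal property of the group C*-algebra\<close>

text \<open>This extends \<open>group_sum\<close> to values that need not lie in a C*-algebra, such as the vectors
  \<open>U x \<xi>\<close> for a unitary representation \<open>U\<close>.\<close>

definition linear_extension :: "('g \<Rightarrow> 'v::complex_vector) \<Rightarrow> ('g \<Rightarrow> complex) \<Rightarrow> 'v"
  where "linear_extension U f = (\<Sum>x | f x \<noteq> 0. f x *\<^sub>C U x)"

lemma linear_extension_eq:
  assumes "finite X" "{x. f x \<noteq> 0} \<subseteq> X"
  shows "linear_extension U f = (\<Sum>x\<in>X. f x *\<^sub>C U x)"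
  unfolding linear_extension_def using assms by (intro sum.mono_neutral_left) auto

lemma group_sum_eq: "group_sum u = linear_extension u"
  by (simp add: fun_eq_iff group_sum_def linear_extension_def)

lemma linear_extension_delta: "linear_extension U (\<lambda>y. if y = x then 1 else 0) = U x"
  by (subst linear_extension_eq[of "{x}"]) auto

lemma group_algebra_delta:
  "x \<in> carrier G \<Longrightarrow> (\<lambda>y. if y = x then 1 else 0) \<in> group_algebra G"
  by (auto simp: group_algebra_def)

lemma group_algebra_add:
  assumes "f \<in> group_algebra G" "h \<in> group_algebra G"
  shows "(\<lambda>x. f x + h x) \<in> group_algebra G"
proof -
  have "{x. f x + h x \<noteq> 0} \<subseteq> {x. f x \<noteq> 0} \<union> {x. h x \<noteq> 0}" by auto
  with assms show ?thesis
    unfolding group_algebra_def by (simp add: finite_subset) (meson finite_UnI finite_subset subset_trans Un_least)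
qed

lemma group_algebra_scale: "f \<in> group_algebra G \<Longrightarrow> (\<lambda>x. c * f x) \<in> group_algebra G"
  by (auto simp: group_algebra_def intro: finite_subset[of _ "{x. f x \<noteq> 0}"])

lemma linear_extension_add:
  assumes "f \<in> group_algebra G" "h \<in> group_algebra G"
  shows "linear_extension U (\<lambda>x. f x + h x) = linear_extension U f + linear_extension U h"
proof -
  define X where "X = {x. f x \<noteq> 0} \<union> {x. h x \<noteq> 0}"
  have X: "finite X" using assms by (simp add: X_def group_algebra_def)
  show ?thesis
    by (subst (1 2 3) linear_extension_eq[OF X])
      (auto simp: X_def scaleC_add_left sum.distrib)
qed

lemma linear_extension_scale:
  assumes "f \<in> group_algebra G"
  shows "linear_extension U (\<lambda>x. c * f x) = c *\<^sub>C linear_extension U f"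
proof -
  have X: "finite {x. f x \<noteq> 0}" using assms by (simp add: group_algebra_def)
  show ?thesis
    by (subst (1 2) linear_extension_eq[OF X]) (auto simp: scaleC_sum_right scaleC_scaleC)
qed

lemma linear_extension_diff:
  assumes "f \<in> group_algebra G" "h \<in> group_algebra G"
  shows "linear_extension U (\<lambda>x. f x + (-1) * h x) = linear_extension U f - linear_extension U h"
  using linear_extension_add[OF assms(1) group_algebra_scale[OF assms(2)], of U "-1"]
    linear_extension_scale[OF assms(2), of U "-1"]
  by simp

lemma bounded_linear_cinner: "bounded_linear (cinner (w :: 'h::complex_hilbert))"
proof (rule bounded_linear_intro[where K = "norm w"])
  show "cinner w (r *\<^sub>R x) = r *\<^sub>R cinner w x" for r x
    using cinner_scaleC_right[of w "complex_of_real r" x]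
    by (simp add: scaleC_of_real scaleR_conv_of_real)
  show "norm (cinner w x) \<le> norm x * norm w" for x
    using cmod_cinner_le[of w x] by (simp add: mult.commute)
qed (rule cinner_add_right)

lemma cstar_seminormD:
  assumes "cstar_seminorm G p" "f \<in> group_algebra G"
  shows "p (\<lambda>x. c * f x) = cmod c * p f"
    and "p (convolution G (involution G f) f) = (p f)\<^sup>2"
    and "h \<in> group_algebra G \<Longrightarrow> p (\<lambda>x. f x + h x) \<le> p f + p h"
  using assms by (simp_all add: cstar_seminorm_def)

context group
begin

lemma group_algebra_involution: "f \<in> group_algebra G \<Longrightarrow> involution G f \<in> group_algebra G"
proof -
  assume f: "f \<in> group_algebra G"
  have "{x. involution G f x \<noteq> 0} \<subseteq> m_inv G ` {x. f x \<noteq> 0}"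
  proof
    fix x assume "x \<in> {x. involution G f x \<noteq> 0}"
    then have "x \<in> carrier G" "f (inv x) \<noteq> 0" by (auto simp: involution_def split: if_splits)
    then show "x \<in> m_inv G ` {x. f x \<noteq> 0}" by (intro image_eqI[of _ _ "inv x"]) auto
  qed
  moreover have "finite (m_inv G ` {x. f x \<noteq> 0})" using f by (simp add: group_algebra_def)
  ultimately show ?thesis
    by (auto simp: group_algebra_def involution_def intro: finite_subset split: if_splits)
qed

lemma linear_extension_involution:
  assumes f: "f \<in> group_algebra G"
  shows "linear_extension U (involution G f) = (\<Sum>x | f x \<noteq> 0. cnj (f x) *\<^sub>C U (inv x))"
proof -
  have supp: "{x. f x \<noteq> 0} \<subseteq> carrier G" using f by (simp add: group_algebra_def)
  have "{x. involution G f x \<noteq> 0} = m_inv G ` {x. f x \<noteq> 0}"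
  proof (intro equalityI subsetI)
    fix x assume "x \<in> {x. involution G f x \<noteq> 0}"
    then have "x \<in> carrier G" "f (inv x) \<noteq> 0" by (auto simp: involution_def split: if_splits)
    then show "x \<in> m_inv G ` {x. f x \<noteq> 0}" by (intro image_eqI[of _ _ "inv x"]) auto
  next
    fix x assume "x \<in> m_inv G ` {x. f x \<noteq> 0}"
    then show "x \<in> {x. involution G f x \<noteq> 0}" using supp by (auto simp: involution_def)
  qed
  moreover have "inj_on (m_inv G) {x. f x \<noteq> 0}"
    using supp by (meson inj_on_subset inv_inj)
  ultimately show ?thesis
    unfolding linear_extension_def using supp
    by (simp add: sum.reindex) (intro sum.cong, auto simp: involution_def)
qed

lemma linear_extension_convolution:
  assumes f: "f \<in> group_algebra G" and h: "h \<in> group_algebra G"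
  shows "linear_extension U (convolution G f h)
    = (\<Sum>y | f y \<noteq> 0. \<Sum>z | h z \<noteq> 0. (f y * h z) *\<^sub>C U (y \<otimes> z))"
proof -
  let ?F = "{y. f y \<noteq> 0}" and ?H = "{z. h z \<noteq> 0}"
  have fin: "finite ?F" "finite ?H" and sub: "?F \<subseteq> carrier G" "?H \<subseteq> carrier G"
    using f h by (auto simp: group_algebra_def)
  define X where "X = (\<lambda>(y, z). y \<otimes> z) ` (?F \<times> ?H)"
  have X: "finite X" "X \<subseteq> carrier G" using fin sub by (auto simp: X_def)
  have inX: "x \<in> (\<lambda>z. y \<otimes> z) ` ?H" if "y \<in> ?F" "x \<in> carrier G" "h (inv y \<otimes> x) \<noteq> 0" for x y
  proof -
    have "x = y \<otimes> (inv y \<otimes> x)" using that sub by (auto simp: m_assoc[symmetric])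
    with that show ?thesis by blast
  qed
  have "{x. convolution G f h x \<noteq> 0} \<subseteq> X"
  proof
    fix x assume "x \<in> {x. convolution G f h x \<noteq> 0}"
    then have x: "x \<in> carrier G" "(\<Sum>y\<in>?F. f y * h (inv y \<otimes> x)) \<noteq> 0"
      by (auto simp: convolution_def split: if_splits)
    then obtain y where "y \<in> ?F" "h (inv y \<otimes> x) \<noteq> 0"
      by (metis (mono_tags, lifting) mult_zero_right sum.neutral)
    with inX x show "x \<in> X" by (force simp: X_def)
  qed
  then have "linear_extension U (convolution G f h)
      = (\<Sum>x\<in>X. convolution G f h x *\<^sub>C U x)"
    by (rule linear_extension_eq[OF X(1)])
  also have "\<dots> = (\<Sum>x\<in>X. \<Sum>y\<in>?F. (f y * h (inv y \<otimes> x)) *\<^sub>C U x)"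
    using X by (intro sum.cong refl) (auto simp: convolution_def scaleC_sum_left)
  also have "\<dots> = (\<Sum>y\<in>?F. \<Sum>x\<in>X. (f y * h (inv y \<otimes> x)) *\<^sub>C U x)"
    by (rule sum.swap)
  also have "\<dots> = (\<Sum>y\<in>?F. \<Sum>z\<in>?H. (f y * h z) *\<^sub>C U (y \<otimes> z))"
  proof (rule sum.cong[OF refl])
    fix y assume y: "y \<in> ?F"
    then have yc: "y \<in> carrier G" using sub by auto
    have "(\<Sum>x\<in>X. (f y * h (inv y \<otimes> x)) *\<^sub>C U x)
        = (\<Sum>x\<in>(\<lambda>z. y \<otimes> z) ` ?H. (f y * h (inv y \<otimes> x)) *\<^sub>C U x)"
    proof (rule sum.mono_neutral_right[OF X(1)])
      show "(\<lambda>z. y \<otimes> z) ` ?H \<subseteq> X" using y by (auto simp: X_def)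
      show "\<forall>x\<in>X - (\<lambda>z. y \<otimes> z) ` ?H. (f y * h (inv y \<otimes> x)) *\<^sub>C U x = 0"
      proof
        fix x assume x: "x \<in> X - (\<lambda>z. y \<otimes> z) ` ?H"
        then have "h (inv y \<otimes> x) = 0" using inX[OF y] X(2) by blast
        then show "(f y * h (inv y \<otimes> x)) *\<^sub>C U x = 0" by simp
      qed
    qed
    also have "\<dots> = (\<Sum>z\<in>?H. (f y * h z) *\<^sub>C U (y \<otimes> z))"
    proof (subst sum.reindex)
      show "inj_on (\<lambda>z. y \<otimes> z) ?H" by (rule inj_on_subset[OF inj_on_cmult[OF yc] sub(2)])
      show "sum ((\<lambda>x. (f y * h (inv y \<otimes> x)) *\<^sub>C U x) \<circ> (\<lambda>z. y \<otimes> z)) ?H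
          = (\<Sum>z\<in>?H. (f y * h z) *\<^sub>C U (y \<otimes> z))"
        using sub yc by (intro sum.cong) (auto simp: m_assoc[symmetric])
    qed
    finally show "(\<Sum>x\<in>X. (f y * h (inv y \<otimes> x)) *\<^sub>C U x)
        = (\<Sum>z\<in>?H. (f y * h z) *\<^sub>C U (y \<otimes> z))" .
  qed
  finally show ?thesis .
qed

lemma convolution_delta:
  assumes "a \<in> carrier G" "b \<in> carrier G"
  shows "convolution G (\<lambda>y. if y = a then 1 else 0) (\<lambda>y. if y = b then 1 else 0)
    = (\<lambda>y. if y = a \<otimes> b then 1 else 0)"
proof
  fix x
  have "inv a \<otimes> x = b \<longleftrightarrow> x = a \<otimes> b" if "x \<in> carrier G"
    using assms that by (metis inv_closed inv_solve_left)
  then show "convolution G (\<lambda>y. if y = a then 1 else 0) (\<lambda>y. if y = b then 1 else 0) x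
      = (if x = a \<otimes> b then 1 else 0)"
    using assms by (auto simp: convolution_def)
qed

lemma involution_delta:
  assumes "a \<in> carrier G"
  shows "involution G (\<lambda>y. if y = a then 1 else 0) = (\<lambda>y. if y = inv a then 1 else 0)"
  using assms by (auto simp: involution_def fun_eq_iff)

text \<open>A C*-seminorm takes values at most 1 on group elements, because \<open>\<delta>\<^sub>x\<^sup>* \<delta>\<^sub>x\<close> is the unit, an
  idempotent.\<close>

lemma cstar_seminorm_le_l1:
  assumes p: "cstar_seminorm G p" and f: "f \<in> group_algebra G"
  shows "p f \<le> (\<Sum>x | f x \<noteq> 0. cmod (f x))"
proof -
  define d where "d x = (\<lambda>y. if y = x then 1 else 0 :: complex)" for x :: 'a
  have dG: "d x \<in> group_algebra G" if "x \<in> carrier G" for x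
    using group_algebra_delta[OF that] by (simp add: d_def)
  have sq: "(p (d x))\<^sup>2 = p (d \<one>)" if "x \<in> carrier G" for x
  proof -
    have "(p (d x))\<^sup>2 = p (convolution G (involution G (d x)) (d x))"
      using cstar_seminormD(2)[OF p dG[OF that]] by simp
    then show ?thesis using that by (simp add: d_def involution_delta convolution_delta)
  qed
  have "p (d \<one>) * p (d \<one>) = p (d \<one>) * 1" using sq[of \<one>] by (simp add: power2_eq_square)
  then have "p (d \<one>) \<le> 1" by (cases "p (d \<one>) = 0") auto
  then have le: "p (d x) \<le> 1" if "x \<in> carrier G" for x
    using sq[OF that] power_le_imp_le_base[of "p (d x)" 1 1]
    by (metis abs_ge_self abs_square_le_1 order_trans)
  have "p (\<lambda>y. if y \<in> X then f y else 0) \<le> (\<Sum>x\<in>X. cmod (f x))"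
    if "finite X" "X \<subseteq> carrier G" for X
    using that
  proof (induction X rule: finite_induct)
    case empty
    have "p (\<lambda>x. 0 * d \<one> x) = cmod 0 * p (d \<one>)"
      by (intro cstar_seminormD(1)[OF p] dG one_closed)
    then show ?case by simp
  next
    case (insert a X)
    let ?g = "\<lambda>y. if y \<in> X then f y else 0"
    have g: "?g \<in> group_algebra G"
      using insert by (auto simp: group_algebra_def intro: finite_subset[of _ X] split: if_splits)
    have a: "(\<lambda>y. f a * d a y) \<in> group_algebra G"
      using insert by (intro group_algebra_scale dG) auto
    have eq: "(\<lambda>y. if y \<in> insert a X then f y else 0) = (\<lambda>y. ?g y + f a * d a y)"
      using insert by (auto simp: d_def fun_eq_iff)
    have "p (\<lambda>y. if y \<in> insert a X then f y else 0) \<le> p ?g + p (\<lambda>y. f a * d a y)"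
      unfolding eq using cstar_seminormD(3)[OF p g a] .
    also have "p (\<lambda>y. f a * d a y) = cmod (f a) * p (d a)"
      using insert by (intro cstar_seminormD(1)[OF p] dG) auto
    also have "\<dots> \<le> cmod (f a)" using le[of a] insert by (intro mult_left_le) auto
    finally show ?case using insert by simp
  qed
  moreover have "finite {x. f x \<noteq> 0}" "{x. f x \<noteq> 0} \<subseteq> carrier G"
    using f by (simp_all add: group_algebra_def)
  ultimately have "p (\<lambda>y. if y \<in> {x. f x \<noteq> 0} then f y else 0) \<le> (\<Sum>x | f x \<noteq> 0. cmod (f x))"
    by blast
  moreover have "(\<lambda>y. if y \<in> {x. f x \<noteq> 0} then f y else 0) = f" by auto
  ultimately show ?thesis by (simp only:)
qed

end

locale group_cstar = group G for G (structure) +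
  fixes u :: "'g \<Rightarrow> 'a::cstar_algebra"
  assumes gca: "group_cstar_algebra G u"
begin

lemma u_mult: "x \<in> carrier G \<Longrightarrow> y \<in> carrier G \<Longrightarrow> u (x \<otimes> y) = u x * u y"
  using gca by (simp add: group_cstar_algebra_def)

lemma u_one: "u \<one> = 1"
  using gca by (simp add: group_cstar_algebra_def)

lemma u_star: "x \<in> carrier G \<Longrightarrow> star (u x) = u (inv x)"
  using gca by (simp add: group_cstar_algebra_def)

text \<open>Finite combinations of group elements are dense, so a closed linear condition need only be
  checked on group elements.\<close>

lemma dense_induct [consumes 0, case_names closed add scaleC group]:
  assumes "closed {a. P a}" and add: "\<And>a b. P a \<Longrightarrow> P b \<Longrightarrow> P (a + b)"
    and scale: "\<And>c a. P a \<Longrightarrow> P (c *\<^sub>C a)" and u: "\<And>x. x \<in> carrier G \<Longrightarrow> P (u x)"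
  shows "P a"
proof -
  have P0: "P 0" using scale[OF u[OF one_closed], of 0] by simp
  have "P (\<Sum>x\<in>X. f x *\<^sub>C u x)" if "finite X" "X \<subseteq> carrier G" for f X
    using that by (induction X rule: finite_induct) (auto intro: P0 add scale u)
  then have "group_sum u ` group_algebra G \<subseteq> {a. P a}"
    by (auto simp: group_sum_def group_algebra_def)
  then have "closure (group_sum u ` group_algebra G) \<subseteq> {a. P a}"
    using assms(1) by (rule closure_minimal)
  then show ?thesis using gca by (auto simp: group_cstar_algebra_def)
qed

text \<open>The norm is a supremum over all C*-seminorms, and the \<open>\<ell>\<^sup>1\<close>-norm bounds that supremum; an unbounded
  one would have an unspecified value.\<close>

lemma cstar_seminorm_le_norm:
  assumes p: "cstar_seminorm G p" and f: "f \<in> group_algebra G"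
  shows "p f \<le> norm (group_sum u f)"
proof -
  have "bdd_above ((\<lambda>p. p f) ` {p. cstar_seminorm G p})"
    using cstar_seminorm_le_l1[OF _ f] by (intro bdd_aboveI2) auto
  then have "p f \<le> (SUP p\<in>{p. cstar_seminorm G p}. p f)"
    using p by (intro cSUP_upper) auto
  then show ?thesis using gca f by (simp add: group_cstar_algebra_def)
qed

text \<open>The bound makes the value at \<open>group_sum u f\<close> independent of the choice of \<open>f\<close>, without an appeal to
  the injectivity of \<open>group_sum u\<close>.  Taking values in any complex Banach space covers
  both universal properties below: C*-algebras, and orbits of vectors under a representation.\<close>

lemma bounded_extension:
  fixes U :: "'g \<Rightarrow> 'v::{complex_vector, real_normed_vector, complete_space}"
  assumes scale: "\<And>c (v::'v). norm (c *\<^sub>C v) = cmod c * norm v"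
    and bound: "\<And>f. f \<in> group_algebra G \<Longrightarrow> norm (linear_extension U f) \<le> K * norm (group_sum u f)"
    and K: "0 \<le> K"
  obtains \<Phi> where "\<And>a b. \<Phi> (a + b) = \<Phi> a + \<Phi> b" "\<And>c a. \<Phi> (c *\<^sub>C a) = c *\<^sub>C \<Phi> a"
    "\<And>a. norm (\<Phi> a) \<le> K * norm a" "\<And>x. x \<in> carrier G \<Longrightarrow> \<Phi> (u x) = U x"
proof -
  define X where "X = group_sum u ` group_algebra G"
  have X: "closure X = UNIV" using gca by (simp add: X_def group_cstar_algebra_def)
  have diff: "norm (linear_extension U f - linear_extension U h)
      \<le> K * norm (group_sum u f - group_sum u h)"
    if "f \<in> group_algebra G" "h \<in> group_algebra G" for f h
    using bound[OF group_algebra_add[OF that(1) group_algebra_scale[OF that(2)]], of "-1"] that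
    by (simp only: linear_extension_diff group_sum_eq)
  define \<phi> where "\<phi> a = linear_extension U (SOME f. f \<in> group_algebra G \<and> group_sum u f = a)" for a
  have \<phi>: "\<phi> (group_sum u f) = linear_extension U f" if "f \<in> group_algebra G" for f
  proof -
    have "\<exists>h. h \<in> group_algebra G \<and> group_sum u h = group_sum u f" using that by blast
    from someI_ex[OF this] diff[OF _ that] show ?thesis by (fastforce simp: \<phi>_def)
  qed
  have "K-lipschitz_on X \<phi>"
    using K by (intro lipschitz_onI) (auto simp: X_def dist_norm \<phi> diff)
  then have "uniformly_continuous_on X \<phi>" by (rule lipschitz_on_uniformly_continuous)
  then obtain \<Phi> where uc: "uniformly_continuous_on (closure X) \<Phi>"
    and \<Phi>: "\<And>a. a \<in> X \<Longrightarrow> \<phi> a = \<Phi> a"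
    by (rule uniformly_continuous_on_extension_on_closure) blast
  have cont: "continuous_on UNIV \<Phi>" using uc by (simp add: X uniformly_continuous_imp_continuous)
  have \<Phi>_sum: "\<Phi> (group_sum u f) = linear_extension U f" if "f \<in> group_algebra G" for f
    using \<Phi>[of "group_sum u f"] that by (simp add: X_def \<phi>)
  have cont2: "continuous_on UNIV (\<lambda>z. \<Phi> (g z))" if "continuous_on UNIV g"
    for g :: "'c::topological_space \<Rightarrow> 'a"
    by (rule continuous_on_compose2[OF cont that]) simp
  have bl: "bounded_linear (\<lambda>v::'v. c *\<^sub>C v)" for c
    by (rule bounded_linear_intro[where K = "cmod c"])
      (simp_all add: scaleC_add_right scaleC_real_commute scale)
  have gs_add: "group_sum u (\<lambda>x. f x + h x) = group_sum u f + group_sum u h"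
    if "f \<in> group_algebra G" "h \<in> group_algebra G" for f h
    using linear_extension_add[OF that, of u] by (simp add: group_sum_eq)
  have gs_scale: "group_sum u (\<lambda>x. c * f x) = c *\<^sub>C group_sum u f"
    if "f \<in> group_algebra G" for c f
    using linear_extension_scale[OF that, of u] by (simp add: group_sum_eq)
  show ?thesis
  proof (rule that)
    have "closure (X \<times> X) \<subseteq> {z. \<Phi> (fst z + snd z) = \<Phi> (fst z) + \<Phi> (snd z)}"
    proof (rule closure_minimal)
      show "X \<times> X \<subseteq> {z. \<Phi> (fst z + snd z) = \<Phi> (fst z) + \<Phi> (snd z)}"
        by (auto simp: X_def \<Phi>_sum group_algebra_add gs_add[symmetric] linear_extension_add[of _ G])
      show "closed {z. \<Phi> (fst z + snd z) = \<Phi> (fst z) + \<Phi> (snd z)}"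
        by (intro closed_Collect_eq continuous_intros cont2)
    qed
    moreover have "(a, b) \<in> closure (X \<times> X)" for a b by (simp add: closure_Times X)
    ultimately show "\<Phi> (a + b) = \<Phi> a + \<Phi> b" for a b by fastforce
    have "closure X \<subseteq> {a. \<Phi> (c *\<^sub>C a) = c *\<^sub>C \<Phi> a}" for c
    proof (rule closure_minimal)
      show "X \<subseteq> {a. \<Phi> (c *\<^sub>C a) = c *\<^sub>C \<Phi> a}"
        by (auto simp: X_def \<Phi>_sum group_algebra_scale gs_scale[symmetric]
            linear_extension_scale[of _ G])
      show "closed {a. \<Phi> (c *\<^sub>C a) = c *\<^sub>C \<Phi> a}"
        by (intro closed_Collect_eq continuous_intros cont2 bounded_linear.continuous_on[OF bl] cont)
    qed
    then show "\<Phi> (c *\<^sub>C a) = c *\<^sub>C \<Phi> a" for c a by (auto simp: X)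
    have "closure X \<subseteq> {a. norm (\<Phi> a) \<le> K * norm a}"
    proof (rule closure_minimal)
      show "X \<subseteq> {a. norm (\<Phi> a) \<le> K * norm a}" by (auto simp: X_def \<Phi>_sum bound)
      show "closed {a. norm (\<Phi> a) \<le> K * norm a}"
        by (intro closed_Collect_le continuous_intros cont)
    qed
    then show "norm (\<Phi> a) \<le> K * norm a" for a by (auto simp: X)
    show "\<Phi> (u x) = U x" if "x \<in> carrier G" for x
      using \<Phi>_sum[OF group_algebra_delta[OF that]]
      by (simp add: group_sum_eq linear_extension_delta)
  qed
qed

text \<open>The norm on the target pulls back to a C*-seminorm on the group algebra, hence is dominated by the
  universal norm.  Products and adjoints are then checked on group elements, one factor at a time.\<close>

theorem universal_star_hom:
  fixes U :: "'g \<Rightarrow> 'c::cstar_algebra"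
  assumes mult: "\<And>x y. x \<in> carrier G \<Longrightarrow> y \<in> carrier G \<Longrightarrow> U (x \<otimes> y) = U x * U y"
    and star: "\<And>x. x \<in> carrier G \<Longrightarrow> star (U x) = U (inv x)"
  obtains \<Phi> where "star_hom \<Phi>" "\<And>x. x \<in> carrier G \<Longrightarrow> \<Phi> (u x) = U x"
proof -
  have supp: "f x \<noteq> 0 \<Longrightarrow> x \<in> carrier G" if "f \<in> group_algebra G" for f x
    using that by (auto simp: group_algebra_def)
  have conv: "linear_extension U (convolution G f h) = linear_extension U f * linear_extension U h"
    if "f \<in> group_algebra G" "h \<in> group_algebra G" for f h
    unfolding linear_extension_convolution[OF that]
    unfolding linear_extension_def sum_product
    using supp[OF that(1)] supp[OF that(2)]
    by (intro sum.cong refl) (auto simp: mult scaleC_mult_left scaleC_mult_right scaleC_scaleC mult.commute)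
  have invol: "linear_extension U (involution G f) = star (linear_extension U f)"
    if "f \<in> group_algebra G" for f
  proof -
    have "star (\<Sum>x\<in>X. g x) = (\<Sum>x\<in>X. star (g x))" for X and g :: "'g \<Rightarrow> 'c"
      by (induction X rule: infinite_finite_induct) (simp_all add: star_add)
    then show ?thesis
      unfolding linear_extension_involution[OF that] unfolding linear_extension_def
      using supp[OF that] by (simp add: star_scaleC star)
  qed
  have p: "cstar_seminorm G (\<lambda>f. norm (linear_extension U f))"
    unfolding cstar_seminorm_def
  proof (intro conjI ballI allI)
    fix f assume f: "f \<in> group_algebra G"
    show "norm (linear_extension U (convolution G (involution G f) f)) = (norm (linear_extension U f))\<^sup>2"
      by (simp add: conv[OF group_algebra_involution[OF f] f] invol[OF f] cstar_identity)
    show "norm (linear_extension U (\<lambda>x. c * f x)) = cmod c * norm (linear_extension U f)" for c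
      by (simp add: linear_extension_scale[OF f] norm_scaleC)
    fix h assume h: "h \<in> group_algebra G"
    show "norm (linear_extension U (\<lambda>x. f x + h x))
        \<le> norm (linear_extension U f) + norm (linear_extension U h)"
      by (simp add: linear_extension_add[OF f h] norm_triangle_ineq)
    show "norm (linear_extension U (convolution G f h))
        \<le> norm (linear_extension U f) * norm (linear_extension U h)"
      by (simp add: conv[OF f h] norm_mult_ineq)
  qed
  obtain \<Phi> where \<Phi>: "\<And>a b. \<Phi> (a + b) = \<Phi> a + \<Phi> b" "\<And>c a. \<Phi> (c *\<^sub>C a) = c *\<^sub>C \<Phi> a"
    "\<And>a. norm (\<Phi> a) \<le> 1 * norm a" "\<And>x. x \<in> carrier G \<Longrightarrow> \<Phi> (u x) = U x"
    by (rule bounded_extension[of U 1]) (use cstar_seminorm_le_norm[OF p] in \<open>auto simp: norm_scaleC\<close>)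
  have "bounded_linear \<Phi>"
    by (rule bounded_linear_intro[where K = 1]) (use \<Phi> in \<open>simp_all flip: scaleC_of_real\<close>)
  then have [continuous_intros]: "continuous_on X g \<Longrightarrow> continuous_on X (\<lambda>a. \<Phi> (g a))" for X g
    by (rule bounded_linear.continuous_on)
  have 1: "\<Phi> (a * u y) = \<Phi> a * \<Phi> (u y)" if y: "y \<in> carrier G" for a y
  proof (induction a rule: dense_induct)
    case closed
    show ?case by (intro closed_Collect_eq continuous_intros continuous_on_id)
  qed (simp_all add: \<Phi> y mult u_mult[symmetric] distrib_right scaleC_mult_left)
  have 2: "\<Phi> (a * b) = \<Phi> a * \<Phi> b" for a b
  proof (induction b rule: dense_induct)
    case closed
    show ?case by (intro closed_Collect_eq continuous_intros continuous_on_id)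
  qed (simp_all add: \<Phi>(1,2) 1 distrib_left scaleC_mult_right)
  have 3: "\<Phi> (star a) = star (\<Phi> a)" for a
  proof (induction a rule: dense_induct)
    case closed
    show ?case by (intro closed_Collect_eq continuous_intros continuous_on_id)
  qed (simp_all add: \<Phi> star u_star star_add star_scaleC)
  show ?thesis by (rule that[of \<Phi>]) (auto simp: star_hom_def \<Phi> 2 3)
qed

text \<open>The same argument with the operator norm as C*-seminorm.  The operators are obtained pointwise:
  each orbit map \<open>f \<mapsto> U f \<xi>\<close> extends, with bound \<open>\<parallel>\<xi>\<parallel>\<close>.\<close>

theorem universal_star_rep:
  fixes U :: "'g \<Rightarrow> 'h::complex_hilbert \<Rightarrow> 'h"
  assumes bounded: "\<And>x. x \<in> carrier G \<Longrightarrow> bounded_op (U x)"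
    and mult: "\<And>x y \<xi>. x \<in> carrier G \<Longrightarrow> y \<in> carrier G \<Longrightarrow> U (x \<otimes> y) \<xi> = U x (U y \<xi>)"
    and adj: "\<And>x. x \<in> carrier G \<Longrightarrow> is_adjoint (U x) (U (inv x))"
  obtains \<pi> where "star_rep \<pi>" "\<And>x. x \<in> carrier G \<Longrightarrow> \<pi> (u x) = U x"
proof -
  define T where "T f \<xi> = linear_extension (\<lambda>x. U x \<xi>) f" for f \<xi>
  have supp: "f x \<noteq> 0 \<Longrightarrow> x \<in> carrier G" if "f \<in> group_algebra G" for f x
    using that by (auto simp: group_algebra_def)
  have T: "bounded_op (T f)" if "f \<in> group_algebra G" for f
    unfolding T_def[abs_def] linear_extension_def
    using supp[OF that] by (intro bounded_op_finite_sum bounded_op_scaleC_comp bounded) auto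
  note Tl = T[THEN bounded_op_linear]
  have conv: "T (convolution G f h) \<xi> = T f (T h \<xi>)"
    if "f \<in> group_algebra G" "h \<in> group_algebra G" for f h \<xi>
  proof -
    have "T f (T h \<xi>) = (\<Sum>y | f y \<noteq> 0. f y *\<^sub>C (\<Sum>z | h z \<noteq> 0. U y (h z *\<^sub>C U z \<xi>)))"
      unfolding T_def linear_extension_def using supp[OF that(1)]
      by (intro sum.cong refl) (simp add: bounded_op_sum[OF bounded])
    also have "\<dots> = (\<Sum>y | f y \<noteq> 0. \<Sum>z | h z \<noteq> 0. (f y * h z) *\<^sub>C U (y \<otimes> z) \<xi>)"
      using supp[OF that(1)] supp[OF that(2)] unfolding scaleC_sum_right
      by (intro sum.cong refl) (simp add: mult bounded_op_scaleC[OF bounded] scaleC_scaleC)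
    finally show ?thesis by (simp add: T_def linear_extension_convolution[OF that])
  qed
  have invol: "is_adjoint (T f) (T (involution G f))" if "f \<in> group_algebra G" for f
  proof -
    have "cinner (U x \<xi>) \<eta> = cinner \<xi> (U (inv x) \<eta>)" if "x \<in> carrier G" for x \<xi> \<eta>
      using adj[OF that] by (simp add: is_adjoint_def)
    moreover have "cinner (\<Sum>x\<in>X. g x) \<eta> = (\<Sum>x\<in>X. cinner (g x) \<eta>)" for X \<eta> and g :: "'g \<Rightarrow> 'h"
      by (induction X rule: infinite_finite_induct) (simp_all add: cinner_add_left)
    ultimately show ?thesis
      unfolding is_adjoint_def T_def linear_extension_involution[OF that]
      unfolding linear_extension_def
      using supp[OF that] by (simp add: cinner_sum_right cinner_scaleC_left cinner_scaleC_right)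
  qed
  have p: "cstar_seminorm G (\<lambda>f. onorm (T f))"
    unfolding cstar_seminorm_def
  proof (intro conjI ballI allI)
    fix f assume f: "f \<in> group_algebra G"
    note f' = group_algebra_involution[OF f]
    have "T (convolution G (involution G f) f) = (\<lambda>\<xi>. T (involution G f) (T f \<xi>))"
      using conv[OF f' f] by auto
    then show "onorm (T (convolution G (involution G f) f)) = (onorm (T f))\<^sup>2"
      by (simp add: onorm_cstar_identity[OF Tl[OF f] Tl[OF f'] invol[OF f]])
    have "T (\<lambda>x. c * f x) = (\<lambda>\<xi>. c *\<^sub>C T f \<xi>)" for c
      by (auto simp: T_def linear_extension_scale[OF f])
    then show "onorm (T (\<lambda>x. c * f x)) = cmod c * onorm (T f)" for c
      by (simp add: onorm_scaleC[OF T[OF f]])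
    fix h assume h: "h \<in> group_algebra G"
    have "T (\<lambda>x. f x + h x) = (\<lambda>\<xi>. T f \<xi> + T h \<xi>)"
      by (auto simp: T_def linear_extension_add[OF f h])
    then show "onorm (T (\<lambda>x. f x + h x)) \<le> onorm (T f) + onorm (T h)"
      using onorm_triangle[OF Tl[OF f] Tl[OF h]] by simp
    have "T (convolution G f h) = T f \<circ> T h" using conv[OF f h] by auto
    then show "onorm (T (convolution G f h)) \<le> onorm (T f) * onorm (T h)"
      using onorm_compose[OF Tl[OF f] Tl[OF h]] by simp
  qed
  \<comment> \<open>The conditions on an extended orbit map are packed into one predicate in order to choose
    such a map for every vector.\<close>
  define orbit where "orbit \<xi> \<phi> \<longleftrightarrow> (\<forall>a b. \<phi> (a + b) = \<phi> a + \<phi> b) \<and> (\<forall>c a. \<phi> (c *\<^sub>C a) = c *\<^sub>C \<phi> a) \<and>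
      (\<forall>a. norm (\<phi> a) \<le> norm \<xi> * norm a) \<and> (\<forall>x\<in>carrier G. \<phi> (u x) = U x \<xi>)"
    for \<xi> and \<phi> :: "'a \<Rightarrow> 'h"
  have "\<exists>\<phi>. orbit \<xi> \<phi>" for \<xi>
  proof (rule bounded_extension[of "\<lambda>x. U x \<xi>" "norm \<xi>"])
    show "norm (c *\<^sub>C v) = cmod c * norm v" for c and v :: 'h by (rule norm_scaleC_hilbert)
    show "norm (linear_extension (\<lambda>x. U x \<xi>) f) \<le> norm \<xi> * norm (group_sum u f)"
      if "f \<in> group_algebra G" for f
    proof -
      have "norm (T f \<xi>) \<le> onorm (T f) * norm \<xi>" by (rule onorm[OF Tl[OF that]])
      also have "\<dots> \<le> norm (group_sum u f) * norm \<xi>"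
        using cstar_seminorm_le_norm[OF p that] by (rule mult_right_mono) simp
      finally show ?thesis by (simp add: T_def mult.commute)
    qed
    show "\<exists>\<phi>. orbit \<xi> \<phi>"
      if "\<And>a b. \<phi> (a + b) = \<phi> a + \<phi> b" "\<And>c a. \<phi> (c *\<^sub>C a) = c *\<^sub>C \<phi> a"
        "\<And>a. norm (\<phi> a) \<le> norm \<xi> * norm a" "\<And>x. x \<in> carrier G \<Longrightarrow> \<phi> (u x) = U x \<xi>" for \<phi>
      using that by (intro exI[of _ \<phi>]) (simp add: orbit_def)
  qed simp
  then obtain \<Phi> where "orbit \<xi> (\<Phi> \<xi>)" for \<xi> by metis
  then have \<Phi>: "\<And>\<xi> a b. \<Phi> \<xi> (a + b) = \<Phi> \<xi> a + \<Phi> \<xi> b"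
    "\<And>\<xi> c a. \<Phi> \<xi> (c *\<^sub>C a) = c *\<^sub>C \<Phi> \<xi> a"
    "\<And>\<xi> a. norm (\<Phi> \<xi> a) \<le> norm \<xi> * norm a" "\<And>\<xi> x. x \<in> carrier G \<Longrightarrow> \<Phi> \<xi> (u x) = U x \<xi>"
    by (simp_all add: orbit_def)
  have "bounded_linear (\<Phi> \<xi>)" for \<xi>
    by (rule bounded_linear_intro[where K = "norm \<xi>"])
      (use \<Phi> in \<open>simp_all add: mult.commute flip: scaleC_of_real\<close>)
  then have cont: "continuous_on X g \<Longrightarrow> continuous_on X (\<lambda>a. \<Phi> \<xi> (g a))"
    for X \<xi> and g :: "'c::topological_space \<Rightarrow> 'a"
    by (rule bounded_linear.continuous_on)
  have contC: "continuous_on X g \<Longrightarrow> continuous_on X (\<lambda>a. c *\<^sub>C g a)"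
    for X c and g :: "'c::topological_space \<Rightarrow> 'h"
    by (rule bounded_linear.continuous_on[OF bounded_op_linear[OF bounded_op_scaleC_op]])
  have lin: "\<Phi> (\<xi> + \<eta>) a = \<Phi> \<xi> a + \<Phi> \<eta> a" for \<xi> \<eta> a
  proof (induction a rule: dense_induct)
    case closed
    show ?case by (intro closed_Collect_eq continuous_on_add cont continuous_on_id)
  qed (simp_all add: \<Phi> bounded_op_add[OF bounded] scaleC_add_right)
  have linC: "\<Phi> (c *\<^sub>C \<xi>) a = c *\<^sub>C \<Phi> \<xi> a" for c \<xi> a
  proof (induction a rule: dense_induct)
    case closed
    show ?case by (intro closed_Collect_eq contC cont continuous_on_id)
  qed (simp_all add: \<Phi> bounded_op_scaleC[OF bounded] scaleC_add_right scaleC_scaleC mult.commute)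
  have bop: "bounded_op (\<lambda>\<xi>. \<Phi> \<xi> a)" for a
    by (rule bounded_opI[where K = "norm a"]) (use \<Phi>(3) in \<open>simp_all add: lin linC mult.commute\<close>)
  have 1: "\<Phi> \<xi> (a * u y) = \<Phi> (U y \<xi>) a" if y: "y \<in> carrier G" for a y \<xi>
  proof (induction a rule: dense_induct)
    case closed
    show ?case by (intro closed_Collect_eq cont continuous_intros continuous_on_id)
  qed (simp_all add: \<Phi> y mult u_mult[symmetric] distrib_right scaleC_mult_left)
  have 2: "\<Phi> \<xi> (a * b) = \<Phi> (\<Phi> \<xi> b) a" for a b \<xi>
  proof (induction b rule: dense_induct)
    case closed
    have "continuous_on UNIV (\<lambda>b. \<Phi> (\<Phi> \<xi> b) a)"
      by (intro bounded_linear.continuous_on[OF bounded_op_linear[OF bop]] cont continuous_on_id)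
    then show ?case by (intro closed_Collect_eq cont continuous_intros continuous_on_id)
  qed (simp_all add: \<Phi> 1 distrib_left scaleC_mult_right lin linC)
  have 3: "cinner (\<Phi> \<xi> a) \<eta> = cinner \<xi> (\<Phi> \<eta> (star a))" for \<xi> \<eta> a
  proof (induction a rule: dense_induct)
    case closed
    have "continuous_on UNIV (\<lambda>a. cnj (cinner \<eta> (\<Phi> \<xi> a)))"
      "continuous_on UNIV (\<lambda>a. cinner \<xi> (\<Phi> \<eta> (star a)))"
      by (intro continuous_on_cnj bounded_linear.continuous_on[OF bounded_linear_cinner] cont
          continuous_on_star continuous_on_id)+
    then show ?case
      by (intro closed_Collect_eq) (simp_all flip: cinner_commute)
  next
    case (group x)
    then show ?case using adj[OF group] by (simp add: \<Phi> u_star is_adjoint_def)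
  qed (simp_all add: \<Phi> star_add star_scaleC cinner_add_left cinner_add_right
      cinner_scaleC_left cinner_scaleC_right)
  show ?thesis
  proof (rule that[of "\<lambda>a \<xi>. \<Phi> \<xi> a"])
    show "star_rep (\<lambda>a \<xi>. \<Phi> \<xi> a)" by (auto simp: star_rep_def is_adjoint_def o_def bop \<Phi> 2 3)
  qed (auto simp: \<Phi>)
qed

end

section \<open>Pairings with projections\<close>

lemma foldr_comp_const: "foldr (\<circ>) (map (\<lambda>_. f) xs) id = f ^^ length xs"
  by (induction xs) auto

lemma chern_op_const:
  "chern_op w n (\<lambda>_. p)
    = (\<lambda>x. grading w (rep w p ((commutator (fop w) (rep w p) ^^ (2 * n)) x)))"
  unfolding chern_op_def foldr_comp_const by (simp add: fun_eq_iff del: upt_Suc)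

lemma power_sign_cancel:
  assumes "0 < n"
  shows "(-1) ^ (n * (2 * n - 1)) * (-1) ^ n = (1::complex)"
proof -
  have "odd (2 * n - 1)" using assms by simp
  then have "(-1) ^ (n * (2 * n - 1)) = ((-1) ^ n :: complex)"
    by (subst mult.commute) (simp add: power_mult)
  then show ?thesis by (simp flip: power_mult_distrib)
qed

text \<open>For a projection \<open>p\<close> the square of \<open>C = [F, p]\<close> commutes with \<open>p\<close> and with the grading \<open>\<gamma>\<close>, and
  \<open>C\<^sup>* = - C\<close>.  If \<open>Q = - C\<^sup>2\<close> is a projection, the operator in degree \<open>2 n > 0\<close> is therefore
  \<open>(-1)\<^sup>n \<gamma> p Q\<close>, whose absolute value is the projection \<open>p Q\<close>.  The sign cancels the one in the Chern
  character, so the sequence of normalized components is constant from degree 2 on.\<close>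

lemma has_chern_pairingI:
  fixes w :: "('a::cstar_algebra, 'h::complex_hilbert) graded_module"
  assumes w: "even_fredholm_module w" and p: "is_projection p"
    and C: "\<And>x. commutator (fop w) (rep w p) (commutator (fop w) (rep w p) x) = - Q x"
    and idem: "\<And>x. Q (Q x) = Q x"
    and t: "has_trace (\<lambda>x. grading w (rep w p (Q x))) t"
    and r: "has_trace (\<lambda>x. rep w p (Q x)) r"
    and B: "orthonormal_basis (B :: 'h set)"
  shows "has_chern_pairing w p t"
proof -
  define F where "F = fop w"
  define P where "P = rep w p"
  define \<gamma> where "\<gamma> = grading w"
  define K where "K = commutator F P"
  have Kdef: "K x = F (P x) - P (F x)" for x by (simp add: K_def commutator_def)
  have rep: "star_rep (rep w)" using w by (simp add: even_fredholm_module_def)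
  have bF: "bounded_op F" and adjF: "is_adjoint F F" and FF: "F (F x) = x" for x
    using w by (auto simp: F_def even_fredholm_module_def selfadjoint_op_def fun_eq_iff)
  have bG: "bounded_op \<gamma>" and adjG: "is_adjoint \<gamma> \<gamma>" and GG: "\<gamma> (\<gamma> x) = x"
    and GP: "\<gamma> (P x) = P (\<gamma> x)" and FG: "\<gamma> (F x) = - F (\<gamma> x)" for x
    using w by (auto simp: F_def P_def \<gamma>_def even_fredholm_module_def selfadjoint_op_def fun_eq_iff)
  have bP: "bounded_op P" by (simp add: P_def star_repD[OF rep])
  have adjP: "is_adjoint P P" and PP: "P (P x) = P x" for x
    using star_repD(5)[OF rep, of p] star_repD(4)[OF rep, of p p] p
    by (simp_all add: P_def is_projection_def fun_eq_iff)
  have bK: "bounded_op K" unfolding K_def by (rule bounded_op_commutator[OF bF bP])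
  have KK: "Q = (\<lambda>x. - K (K x))" using C by (simp add: K_def F_def P_def fun_eq_iff)
  have bPi: "bounded_op Q"
    unfolding KK by (rule bounded_op_neg[OF bounded_op_compose[OF bK bK]])
  have "is_adjoint (\<lambda>x. F (P x) + - P (F x)) (\<lambda>x. P (F x) + - F (P x))"
    by (rule is_adjoint_plus[OF is_adjoint_compose[OF adjF adjP]
        is_adjoint_neg[OF is_adjoint_compose[OF adjP adjF]]])
  then have "is_adjoint K (\<lambda>x. - K x)" by (simp add: is_adjoint_def Kdef cinner_diff_left cinner_diff_right)
  then have adjPi: "is_adjoint Q Q"
    by (simp add: is_adjoint_def KK)
  have PPi: "P (Q x) = Q (P x)" for x
    by (simp add: KK Kdef bounded_op_simps[OF bP] bounded_op_simps[OF bF] PP FF)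
  have GK: "\<gamma> (K x) = - K (\<gamma> x)" for x
    by (simp add: Kdef bounded_op_simps[OF bG] bounded_op_simps[OF bP] GP FG)
  have GPi: "\<gamma> (Q x) = Q (\<gamma> x)" for x
    by (simp add: KK GK bounded_op_simps[OF bG] bounded_op_simps[OF bK])
  define R where "R x = P (Q x)" for x
  define T where "T x = \<gamma> (R x)" for x
  have bR: "bounded_op R" unfolding R_def[abs_def] by (rule bounded_op_compose[OF bP bPi])
  have bT: "bounded_op T" unfolding T_def[abs_def] by (rule bounded_op_compose[OF bG bR])
  have RR: "R (R x) = R x" for x by (simp add: R_def PPi PP idem)
  have TT: "T (T x) = R x" for x
    by (simp add: T_def R_def GP GPi PPi GG PP idem)
  have adjR: "is_adjoint R R"
    using is_adjoint_compose[OF adjP adjPi] by (simp add: R_def[abs_def] PPi)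
  have adjT: "is_adjoint T T"
    using is_adjoint_compose[OF adjG adjR] by (simp add: T_def[abs_def] R_def GP GPi)
  have trT: "has_trace T t" and trR: "has_trace R r"
    using t r by (simp_all add: T_def[abs_def] R_def[abs_def] P_def \<gamma>_def)
  have pos: "positive_op R"
    unfolding positive_op_def
  proof (intro conjI allI bR)
    fix x
    have "cinner x (R x) = cinner (R x) (R x)"
      using adjR by (simp add: is_adjoint_def RR)
    then show "cinner x (R x) \<in> \<real>\<^sub>\<ge>\<^sub>0" by (simp add: cinner_self)
  qed
  have power: "(K ^^ (2 * n)) x = (-1) ^ n *\<^sub>C Q x" if "0 < n" for n x
    using that
  proof (induction n)
    case (Suc n)
    have "(K ^^ (2 * Suc n)) x = K (K ((K ^^ (2 * n)) x))" by simp
    also have "\<dots> = (-1) ^ Suc n *\<^sub>C Q x"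
    proof (cases "n = 0")
      case True
      then show ?thesis by (simp add: KK)
    next
      case False
      have "K (K (Q x)) = - Q x" using idem[of x] by (metis KK minus_minus)
      then show ?thesis
        using Suc False by (simp add: bounded_op_scaleC[OF bK] scaleC_minus_left scaleC_minus_right)
    qed
    finally show ?case .
  qed simp
  have op: "chern_op w n (\<lambda>_. p) = (\<lambda>x. (-1) ^ n *\<^sub>C T x)" if "0 < n" for n
    unfolding chern_op_const F_def[symmetric] P_def[symmetric] \<gamma>_def[symmetric] K_def[symmetric]
    by (simp add: power[OF that] T_def R_def bounded_op_scaleC[OF bP] bounded_op_scaleC[OF bG])
  have "trace_class (chern_op w n (\<lambda>_. p))" if "0 < n" for n
    unfolding op[OF that] trace_class_def
  proof (intro conjI exI)
    show "bounded_op (\<lambda>x. (-1) ^ n *\<^sub>C T x)" by (rule bounded_op_scaleC_comp[OF bT])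
    show "is_adjoint (\<lambda>x. (-1) ^ n *\<^sub>C T x) (\<lambda>x. (-1) ^ n *\<^sub>C T x)"
      using is_adjoint_scaleC[OF adjT, of "(-1) ^ n"] by simp
    show "R \<circ> R = (\<lambda>x. (-1) ^ n *\<^sub>C T x) \<circ> (\<lambda>x. (-1) ^ n *\<^sub>C T x)"
      by (simp add: fun_eq_iff RR bounded_op_scaleC[OF bT] scaleC_scaleC TT flip: power_mult_distrib)
    show "positive_op R" by (rule pos)
    show "orthonormal_basis B" by (rule B)
    show "(\<lambda>b. cinner b (R b)) summable_on B"
      using trR B by (auto simp: has_trace_def intro: has_sum_imp_summable)
  qed
  moreover have "chern_character w n (\<lambda>_. p) / fact n = t" if "0 < n" for n
  proof -
    have "trace_op (chern_op w n (\<lambda>_. p)) = (-1) ^ n * t"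
      unfolding op[OF that] by (rule trace_op_eq[OF has_trace_scaleC[OF trT] B])
    moreover have "Gamma (of_nat n + 1 :: complex) = fact n"
      by (simp add: Gamma_fact add.commute)
    ultimately have "chern_character w n (\<lambda>_. p) / fact n
        = ((-1) ^ (n * (2 * n - 1)) * (-1) ^ n) * t"
      by (simp add: chern_character_def)
    then show ?thesis unfolding power_sign_cancel[OF that] by simp
  qed
  then have "(\<lambda>n. chern_character w n (\<lambda>_. p) / fact n) \<longlonglongrightarrow> t"
    by (intro tendsto_eventually eventually_mono[OF eventually_gt_at_top[of 0]]) auto
  ultimately show ?thesis
    using p unfolding has_chern_pairing_def
    by (auto intro: eventually_mono[OF eventually_gt_at_top[of 0]])
qed

lemma is_projection_reflection:
  fixes g :: "'a::cstar_algebra"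
  assumes "star g = g" "g * g = 1"
  shows "is_projection ((1/2) *\<^sub>C (1 + g))"
proof -
  have "(1/2) *\<^sub>C (1 + g) * (1/2) *\<^sub>C (1 + g) = (1/4) *\<^sub>C ((1 + g) + (1 + g))"
    unfolding scaleC_mult_left scaleC_mult_right scaleC_scaleC
    using assms(2) by (simp add: distrib_left distrib_right ac_simps)
  also have "(1 + g) + (1 + g) = 2 *\<^sub>C (1 + g)"
    using scaleC_add_left[of 1 1 "1 + g"] by simp
  finally show ?thesis
    using assms(1) by (simp add: is_projection_def star_scaleC star_add scaleC_scaleC)
qed


section \<open>The infinite dihedral group\<close>

lemma inv_infinite_dihedral:
  assumes "j = 0 \<or> j = 1"
  shows "inv\<^bsub>infinite_dihedral\<^esub> (n, j) = (if j = 0 then - n else n, j)"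
  using assms
  by (intro group.inv_equality[OF group_infinite_dihedral])
    (auto simp: carrier_infinite_dihedral mult_infinite_dihedral one_infinite_dihedral)

locale dihedral_cstar = group_cstar infinite_dihedral u for u :: "int \<times> int \<Rightarrow> 'a::cstar_algebra"
begin

abbreviation S :: 'a where "S \<equiv> u (1, 0)"
abbreviation e :: 'a where "e \<equiv> u (0, 1)"

lemma star_S_S: "star S * S = 1"
  by (simp add: u_star carrier_infinite_dihedral inv_infinite_dihedral mult_infinite_dihedral
      flip: u_mult u_one one_infinite_dihedral)

lemma u_generated:
  assumes mult: "\<And>a b. P a \<Longrightarrow> P b \<Longrightarrow> P (a * b)" and star: "\<And>a. P a \<Longrightarrow> P (star a)"
    and "P S" "P e" and g: "g \<in> carrier infinite_dihedral"
  shows "P (u g)"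
proof -
  have nat: "P (u (int n, 0))" for n
  proof (induction n)
    case 0
    have "P (star S * S)" by (intro mult star \<open>P S\<close>)
    then show ?case by (simp add: star_S_S u_one flip: one_infinite_dihedral)
  next
    case (Suc n)
    have "u (int (Suc n), 0) = S * u (int n, 0)"
      by (simp add: carrier_infinite_dihedral mult_infinite_dihedral flip: u_mult)
    with Suc show ?case using mult[OF \<open>P S\<close>] by simp
  qed
  have int: "P (u (n, 0))" for n
  proof (cases "0 \<le> n")
    case True
    then show ?thesis using nat[of "nat n"] by simp
  next
    case False
    then have "star (u (int (nat (- n)), 0)) = u (n, 0)"
      by (simp add: u_star carrier_infinite_dihedral inv_infinite_dihedral)
    then show ?thesis using star[OF nat] by metis
  qed
  obtain n j where "g = (n, j)" "j = 0 \<or> j = 1"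
    using g by (auto simp: carrier_infinite_dihedral)
  moreover have "u (n, 1) = u (n, 0) * e"
    by (simp add: carrier_infinite_dihedral mult_infinite_dihedral flip: u_mult)
  ultimately show ?thesis using int mult[OF int \<open>P e\<close>] by auto
qed

text \<open>Continuity is automatic, so values on the generators determine a *-homomorphism, and likewise a
  representation; this makes the descriptions of the modules by generators unambiguous.\<close>

lemma star_hom_unique:
  fixes f h :: "'a \<Rightarrow> 'c::cstar_algebra"
  assumes f: "star_hom f" and h: "star_hom h" and "f S = h S" "f e = h e"
  shows "f = h"
proof
  fix a
  show "f a = h a"
  proof (induction a rule: dense_induct)
    case closed
    show ?case
      by (intro closed_Collect_eq linear_continuous_on star_hom_bounded_linear f h)
  next
    case (group x)
    then show ?case
      by (rule u_generated[rotated 4]) (use assms in \<open>simp_all add: star_hom_def\<close>)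
  qed (use f h in \<open>simp_all add: star_hom_def\<close>)
qed

lemma star_rep_unique:
  fixes \<pi> \<rho> :: "'a \<Rightarrow> 'h::complex_hilbert \<Rightarrow> 'h"
  assumes \<pi>: "star_rep \<pi>" and \<rho>: "star_rep \<rho>" and "\<pi> S = \<rho> S" "\<pi> e = \<rho> e"
  shows "\<pi> = \<rho>"
proof (intro ext)
  fix a x
  have adjoint_unique: "T' = T''" if "is_adjoint T T'" "is_adjoint T T''" for T T' T'' :: "'h \<Rightarrow> 'h"
  proof
    fix y
    have "cinner x (T' y - T'' y) = 0" for x
      using that by (simp add: is_adjoint_def cinner_diff_right)
    from this[of "T' y - T'' y"] show "T' y = T'' y" by (simp add: cinner_self)
  qed
  show "\<pi> a x = \<rho> a x"
  proof (induction a rule: dense_induct)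
    case closed
    show ?case
      by (intro closed_Collect_eq linear_continuous_on star_rep_continuous \<pi> \<rho>)
  next
    case (group g)
    have "\<pi> (u g) = \<rho> (u g)"
      using group
    proof (rule u_generated[rotated 4])
      show "\<pi> (star a) = \<rho> (star a)" if "\<pi> a = \<rho> a" for a
        using adjoint_unique[of "\<pi> a"] star_repD(5)[OF \<pi>, of a] star_repD(5)[OF \<rho>, of a] that by simp
      show "\<pi> (a * b) = \<rho> (a * b)" if "\<pi> a = \<rho> a" "\<pi> b = \<rho> b" for a b
        using that by (simp add: star_repD(4)[OF \<pi>] star_repD(4)[OF \<rho>])
    qed (use assms in simp_all)
    then show ?case by simp
  qed (simp_all add: star_repD[OF \<pi>] star_repD[OF \<rho>])
qed

lemma trivial_character:
  "star_hom (trivial_character S e)" "trivial_character S e S = 1" "trivial_character S e e = 1"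
proof -
  obtain \<Phi> :: "'a \<Rightarrow> complex" where \<Phi>: "star_hom \<Phi>"
    "\<And>x. x \<in> carrier infinite_dihedral \<Longrightarrow> \<Phi> (u x) = 1"
    by (rule universal_star_hom[of "\<lambda>_. 1::complex"]) auto
  have "\<exists>!\<phi>. star_hom \<phi> \<and> \<phi> S = (1::complex) \<and> \<phi> e = 1"
  proof (rule ex1I[of _ \<Phi>])
    show *: "star_hom \<Phi> \<and> \<Phi> S = 1 \<and> \<Phi> e = 1"
      using \<Phi> by (simp add: carrier_infinite_dihedral)
    show "\<phi> = \<Phi>" if "star_hom \<phi> \<and> \<phi> S = 1 \<and> \<phi> e = 1" for \<phi>
      using that * by (intro star_hom_unique) auto
  qed
  then have "star_hom (trivial_character S e) \<and> trivial_character S e S = 1 \<and> trivial_character S e e = 1"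
    unfolding trivial_character_def by (rule theI')
  then show "star_hom (trivial_character S e)" "trivial_character S e S = 1" "trivial_character S e e = 1"
    by auto
qed

text \<open>The automorphism fixing \<open>S\<close> and sending \<open>e\<close> to \<open>S\<^sup>* e\<close> comes from the automorphism
  \<open>(n, j) \<mapsto> (n - j, j)\<close> of the group; the inverse group automorphism induces its inverse.\<close>

lemma alpha_minus_one:
  "star_hom (alpha_minus_one S e)" "alpha_minus_one S e S = S" "alpha_minus_one S e e = star S * e"
proof -
  obtain \<Phi> where \<Phi>: "star_hom \<Phi>"
    "\<And>x. x \<in> carrier infinite_dihedral \<Longrightarrow> \<Phi> (u x) = u (fst x - snd x, snd x)"
    by (rule universal_star_hom[of "\<lambda>x. u (fst x - snd x, snd x)"])
      (auto simp: carrier_infinite_dihedral mult_infinite_dihedral inv_infinite_dihedral u_star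
          algebra_simps simp flip: u_mult)
  obtain \<Psi> where \<Psi>: "star_hom \<Psi>"
    "\<And>x. x \<in> carrier infinite_dihedral \<Longrightarrow> \<Psi> (u x) = u (fst x + snd x, snd x)"
    by (rule universal_star_hom[of "\<lambda>x. u (fst x + snd x, snd x)"])
      (auto simp: carrier_infinite_dihedral mult_infinite_dihedral inv_infinite_dihedral u_star
          algebra_simps simp flip: u_mult)
  have "star_hom (\<Phi> \<circ> \<Psi>)" "star_hom (\<Psi> \<circ> \<Phi>)" "star_hom (id :: 'a \<Rightarrow> 'a)"
    using \<Phi>(1) \<Psi>(1) by (auto simp: star_hom_def)
  then have "\<Phi> \<circ> \<Psi> = id" "\<Psi> \<circ> \<Phi> = id"
    by (auto intro!: star_hom_unique simp: \<Phi> \<Psi> carrier_infinite_dihedral)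
  then have bij: "bij \<Phi>" by (rule o_bij[rotated])
  have se: "u (-1, 1) = star S * e"
    by (simp add: u_star carrier_infinite_dihedral mult_infinite_dihedral inv_infinite_dihedral
        flip: u_mult)
  have "\<exists>!\<alpha>. star_hom \<alpha> \<and> bij \<alpha> \<and> \<alpha> S = S \<and> \<alpha> e = star S * e"
  proof (rule ex1I[of _ \<Phi>])
    show *: "star_hom \<Phi> \<and> bij \<Phi> \<and> \<Phi> S = S \<and> \<Phi> e = star S * e"
      using \<Phi> bij by (simp add: carrier_infinite_dihedral se)
    show "\<alpha> = \<Phi>" if "star_hom \<alpha> \<and> bij \<alpha> \<and> \<alpha> S = S \<and> \<alpha> e = star S * e" for \<alpha>
      using that * by (intro star_hom_unique) auto
  qed
  then have "star_hom (alpha_minus_one S e) \<and> bij (alpha_minus_one S e)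
      \<and> alpha_minus_one S e S = S \<and> alpha_minus_one S e e = star S * e"
    unfolding alpha_minus_one_def by (rule theI')
  then show "star_hom (alpha_minus_one S e)" "alpha_minus_one S e S = S"
    "alpha_minus_one S e e = star S * e" by auto
qed

end

section \<open>The action on square-summable sequences\<close>

text \<open>The group element \<open>(n, j)\<close> sends \<open>ket k\<close> to \<open>ket (n + k)\<close> or \<open>ket (n - k)\<close>.\<close>

lift_definition dihedral_op :: "int \<times> int \<Rightarrow> int ell2 \<Rightarrow> int ell2"
  is "\<lambda>g f k. f (if snd g = 0 then k - fst g else fst g - k)"
proof -
  fix g :: "int \<times> int" and f :: "int \<Rightarrow> complex"
  assume "(\<lambda>k. (cmod (f k))\<^sup>2) summable_on UNIV"
  moreover have "bij (\<lambda>k. if snd g = 0 then k - fst g else fst g - k)"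
    by (rule bij_betw_byWitness[of _ "\<lambda>k. if snd g = 0 then k + fst g else fst g - k"]) auto
  ultimately show "(\<lambda>k. (cmod (f (if snd g = 0 then k - fst g else fst g - k)))\<^sup>2) summable_on UNIV"
    by (rule sqsummable_reindex)
qed

lemma coord_dihedral_op:
  "coord (dihedral_op g x) k = coord x (if snd g = 0 then k - fst g else fst g - k)"
  by transfer simp

lemma shift_op_eq: "shift_op = dihedral_op (1, 0)"
  by (rule ext, rule ell2_eqI) (simp add: coord_dihedral_op shift_op.rep_eq)

lemma flip_op_eq: "flip_op = dihedral_op (0, 1)"
  by (rule ext, rule ell2_eqI) (simp add: coord_dihedral_op flip_op.rep_eq)

lemma coord_sign_op: "coord (sign_op x) k = (if k \<ge> 0 then 1 else -1) * coord x k"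
  by transfer simp

lemma bounded_op_dihedral_op: "bounded_op (dihedral_op g)"
proof (rule bounded_opI[where K = 1])
  fix x :: "int ell2"
  have bij: "bij (\<lambda>k. if snd g = 0 then k - fst g else fst g - k)"
    by (rule bij_betw_byWitness[of _ "\<lambda>k. if snd g = 0 then k + fst g else fst g - k"]) auto
  have "(norm (dihedral_op g x))\<^sup>2 = (norm x)\<^sup>2"
    unfolding norm_ell2_sq coord_dihedral_op
    using infsum_reindex_bij_betw[OF bij, of "\<lambda>k. (cmod (coord x k))\<^sup>2"] by simp
  then show "norm (dihedral_op g x) \<le> 1 * norm x" by simp
qed (auto intro!: ell2_eqI simp: coord_dihedral_op coord_add coord_scaleC)

lemma dihedral_op_mult:
  assumes "g \<in> carrier infinite_dihedral" "h \<in> carrier infinite_dihedral"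
  shows "dihedral_op (g \<otimes>\<^bsub>infinite_dihedral\<^esub> h) x = dihedral_op g (dihedral_op h x)"
  using assms
  by (intro ell2_eqI)
    (auto simp: coord_dihedral_op carrier_infinite_dihedral mult_infinite_dihedral algebra_simps)

lemma is_adjoint_dihedral_op:
  assumes "g \<in> carrier infinite_dihedral"
  shows "is_adjoint (dihedral_op g) (dihedral_op (inv\<^bsub>infinite_dihedral\<^esub> g))"
  unfolding is_adjoint_def
proof (intro allI)
  fix x y
  obtain n j where g: "g = (n, j)" "j = 0 \<or> j = 1"
    using assms by (auto simp: carrier_infinite_dihedral)
  have bij: "bij (\<lambda>k. if j = 0 then k - n else n - k)"
    by (rule bij_betw_byWitness[of _ "\<lambda>k. if j = 0 then k + n else n - k"]) auto
  show "cinner (dihedral_op g x) y = cinner x (dihedral_op (inv\<^bsub>infinite_dihedral\<^esub> g) y)"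
    unfolding cinner_ell2_def
    by (subst (2) infsum_reindex_bij_betw[OF bij, symmetric])
      (use g in \<open>auto simp: coord_dihedral_op inv_infinite_dihedral intro!: infsum_cong\<close>)
qed

lemma sign_op_simps:
  "bounded_op sign_op" "is_adjoint sign_op sign_op" "sign_op (sign_op x) = x"
proof -
  show "bounded_op sign_op"
  proof (rule bounded_opI[where K = 1])
    fix x :: "int ell2"
    have "(norm (sign_op x))\<^sup>2 = (norm x)\<^sup>2"
      unfolding norm_ell2_sq coord_sign_op by (intro infsum_cong) (simp add: norm_mult)
    then show "norm (sign_op x) \<le> 1 * norm x" by simp
  qed (auto intro!: ell2_eqI simp: coord_sign_op coord_add coord_scaleC algebra_simps)
  show "is_adjoint sign_op sign_op"
    unfolding is_adjoint_def cinner_ell2_def coord_sign_op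
    by (intro allI infsum_cong) simp
  show "sign_op (sign_op x) = x" by (rule ell2_eqI) (simp add: coord_sign_op)
qed

text \<open>The commutator of the sign operator with a translation, the anticommutator with a reflection.
  A translation changes the sign of only finitely many indices; a reflection keeps the
  sign of only finitely many.  So both have finite rank.  In the modules the
  commutators with \<open>F\<close> are built from these operators, because reflections act with opposite
  signs on the two summands.\<close>

definition sign_defect :: "int \<times> int \<Rightarrow> int ell2 \<Rightarrow> int ell2"
  where "sign_defect g x = sign_op (dihedral_op g x)
    - (if snd g = 0 then 1 else -1) *\<^sub>C dihedral_op g (sign_op x)"

definition defect_coeff :: "int \<times> int \<Rightarrow> int \<Rightarrow> complex"
  where "defect_coeff g k = (if k \<ge> 0 then 1 else -1)
    - (if snd g = 0 then (if k - fst g \<ge> 0 then 1 else -1) else - (if fst g - k \<ge> 0 then 1 else -1))"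

lemma coord_sign_defect:
  "coord (sign_defect g x) k = defect_coeff g k * coord x (if snd g = 0 then k - fst g else fst g - k)"
  by (simp add: sign_defect_def defect_coeff_def coord_diff coord_scaleC coord_sign_op
      coord_dihedral_op algebra_simps)

lemma finite_defect: "finite {k. defect_coeff g k \<noteq> 0}"
proof (rule finite_subset)
  show "{k. defect_coeff g k \<noteq> 0} \<subseteq> {- \<bar>fst g\<bar> .. \<bar>fst g\<bar>}"
    by (auto simp: defect_coeff_def split: if_splits)
qed simp

lemma sign_defect_finite_rank:
  "sign_defect g x = (\<Sum>k | defect_coeff g k \<noteq> 0.
    cinner (ket (if snd g = 0 then k - fst g else fst g - k)) x *\<^sub>C (defect_coeff g k *\<^sub>C ket k))"
  by (rule ell2_eqI)
    (auto simp: coord_sign_defect coord_sum coord_scaleC coord_ket cinner_ket finite_defect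
      if_distrib cong: if_cong)

lemma compact_op_offdiagonal:
  fixes w :: "'i \<Rightarrow> 'k::complex_hilbert" and v :: "'i \<Rightarrow> 'h::complex_hilbert"
    and w' :: "'i \<Rightarrow> 'h" and v' :: "'i \<Rightarrow> 'k"
  shows "compact_op (\<lambda>(x, y). (\<Sum>k\<in>K. cinner (w k) y *\<^sub>C v k, \<Sum>k\<in>K. cinner (w' k) x *\<^sub>C v' k))"
proof -
  have "compact_op (\<lambda>z. (\<Sum>k\<in>K. cinner (0::'h, w k) z *\<^sub>C (v k, 0::'k))
      + (\<Sum>k\<in>K. cinner (w' k, 0::'k) z *\<^sub>C (0::'h, v' k)))"
    by (intro compact_op_add compact_op_sum compact_op_rank_one)
  also have "(\<lambda>z. (\<Sum>k\<in>K. cinner (0::'h, w k) z *\<^sub>C (v k, 0::'k))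
      + (\<Sum>k\<in>K. cinner (w' k, 0::'k) z *\<^sub>C (0::'h, v' k)))
    = (\<lambda>(x, y). (\<Sum>k\<in>K. cinner (w k) y *\<^sub>C v k, \<Sum>k\<in>K. cinner (w' k) x *\<^sub>C v' k))"
    by (auto simp: fun_eq_iff prod_eq_iff fst_sum snd_sum scaleC_prod_def cinner_prod_def)
  finally show ?thesis .
qed

text \<open>Reduces compactness of all commutators to those with group elements: \<open>a \<mapsto> [F, \<pi> a]\<close> is continuous
  in operator norm, because \<open>\<pi>\<close> is.\<close>

lemma closed_compact_commutator:
  assumes \<pi>: "star_rep \<pi>" and F: "selfadjoint_op F" "F \<circ> F = id"
  shows "closed {a. compact_op (commutator F (\<pi> a))}"
proof -
  have FF: "F (F x) = x" for x using F(2) by (simp add: fun_eq_iff)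
  have bF: "bounded_op F" and adj: "is_adjoint F F" using F(1) by (auto simp: selfadjoint_op_def)
  have nF: "norm (F x) = norm x" for x
    using is_adjoint_inner[OF adj, of x "F x"] by (simp add: FF norm_eq_sqrt_inner)
  have "closure {a. compact_op (commutator F (\<pi> a))} \<subseteq> {a. compact_op (commutator F (\<pi> a))}"
  proof clarify
    fix a assume a: "a \<in> closure {a. compact_op (commutator F (\<pi> a))}"
    show "compact_op (commutator F (\<pi> a))"
    proof (rule compact_op_limit)
      show "bounded_op (commutator F (\<pi> a))" by (intro bounded_op_commutator bF star_repD[OF \<pi>])
      fix \<epsilon> :: real assume "0 < \<epsilon>"
      then have "0 < \<epsilon> / 4" by simp
      then obtain b where b: "compact_op (commutator F (\<pi> b))" "dist b a < \<epsilon> / 4"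
        using a unfolding closure_approachable by blast
      have "norm (commutator F (\<pi> a) x - commutator F (\<pi> b) x) \<le> \<epsilon> * norm x" for x
      proof -
        define d where "d = a - b"
        have d: "\<pi> a x = \<pi> b x + \<pi> d x" for x using star_repD(2)[OF \<pi>, of b d x] by (simp add: d_def)
        have "commutator F (\<pi> a) x - commutator F (\<pi> b) x = F (\<pi> d x) - \<pi> d (F x)"
          by (simp add: commutator_def d bounded_op_add[OF bF])
        also have "norm \<dots> \<le> norm (F (\<pi> d x)) + norm (\<pi> d (F x))" by (rule norm_triangle_ineq4)
        also have "\<dots> \<le> 2 * norm d * norm x + 2 * norm d * norm x"
          using star_rep_norm_le[OF \<pi>, of d x] star_rep_norm_le[OF \<pi>, of d "F x"]
          by (intro add_mono) (simp_all add: nF)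
        also have "\<dots> = (4 * norm d) * norm x" by simp
        also have "\<dots> \<le> \<epsilon> * norm x"
          using b(2) by (intro mult_right_mono) (simp_all add: d_def dist_norm norm_minus_commute)
        finally show ?thesis .
      qed
      with b show "\<exists>U. compact_op U \<and> (\<forall>x. norm (commutator F (\<pi> a) x - U x) \<le> \<epsilon> * norm x)"
        by blast
    qed
  qed
  then show ?thesis by (simp add: closure_subset_eq)
qed

section \<open>The modules and their pairings\<close>

lemma grading_simps:
  fixes \<gamma> :: "'h::complex_hilbert \<times> 'h \<Rightarrow> 'h \<times> 'h"
  defines "\<gamma> \<equiv> block_op id (\<lambda>_. 0) (\<lambda>_. 0) uminus"
  shows "selfadjoint_op \<gamma>" "\<gamma> \<circ> \<gamma> = id"
proof -
  show "selfadjoint_op \<gamma>"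
    unfolding \<gamma>_def selfadjoint_op_def id_def
    by (intro conjI bounded_op_block is_adjoint_block bounded_op_id bounded_op_0
        bounded_op_neg[of "\<lambda>x. x"] is_adjoint_id is_adjoint_0 is_adjoint_neg[of "\<lambda>x. x" "\<lambda>x. x"])
  show "\<gamma> \<circ> \<gamma> = id" by (auto simp: \<gamma>_def block_op_def fun_eq_iff)
qed

definition double_rep :: "int \<times> int \<Rightarrow> int ell2 \<times> int ell2 \<Rightarrow> int ell2 \<times> int ell2"
  where "double_rep g = block_op (dihedral_op g) (\<lambda>_. 0) (\<lambda>_. 0)
    (\<lambda>x. (if snd g = 0 then 1 else -1) *\<^sub>C dihedral_op g x)"

definition F1 :: "int ell2 \<times> int ell2 \<Rightarrow> int ell2 \<times> int ell2"
  where "F1 = block_op (\<lambda>_. 0) (\<lambda>x. \<i> *\<^sub>C sign_op x) (\<lambda>x. - (\<i> *\<^sub>C sign_op x)) (\<lambda>_. 0)"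

lemma F1_apply: "F1 (x, y) = (\<i> *\<^sub>C sign_op y, - (\<i> *\<^sub>C sign_op x))"
  by (simp add: F1_def block_op_def)

lemma selfadjoint_F1: "selfadjoint_op F1"
proof -
  have "is_adjoint (\<lambda>x. \<i> *\<^sub>C sign_op x) (\<lambda>x. - (\<i> *\<^sub>C sign_op x))"
    using is_adjoint_scaleC[OF sign_op_simps(2), of \<i>] by (simp add: scaleC_minus_left)
  then show ?thesis
    unfolding F1_def selfadjoint_op_def
    by (intro conjI bounded_op_block is_adjoint_block bounded_op_0 bounded_op_neg
        bounded_op_scaleC_comp sign_op_simps is_adjoint_0) (auto intro: is_adjoint_sym)
qed

lemma F1_F1: "F1 (F1 z) = z"
  by (cases z) (simp add: F1_apply bounded_op_simps[OF sign_op_simps(1)] sign_op_simps(3) scaleC_scaleC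
      scaleC_minus_right)

context dihedral_cstar
begin

lemma rep1: "star_rep (rep1 S e)"
  and rep1_u: "g \<in> carrier infinite_dihedral \<Longrightarrow> rep1 S e (u g) = double_rep g"
proof -
  have "\<exists>\<pi>. star_rep \<pi> \<and> (\<forall>g\<in>carrier infinite_dihedral. \<pi> (u g) = double_rep g)"
  proof (rule universal_star_rep[of double_rep])
    show "\<exists>\<pi>. star_rep \<pi> \<and> (\<forall>g\<in>carrier infinite_dihedral. \<pi> (u g) = double_rep g)"
      if "star_rep \<pi>" "\<And>g. g \<in> carrier infinite_dihedral \<Longrightarrow> \<pi> (u g) = double_rep g" for \<pi>
      using that by blast
    show "bounded_op (double_rep g)" for g
      unfolding double_rep_def
      by (intro bounded_op_block bounded_op_0 bounded_op_scaleC_comp bounded_op_dihedral_op)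
    fix g assume g: "g \<in> carrier infinite_dihedral"
    show "is_adjoint (double_rep g) (double_rep (inv\<^bsub>infinite_dihedral\<^esub> g))"
    proof -
      have "snd (inv\<^bsub>infinite_dihedral\<^esub> g) = snd g"
        using g by (auto simp: carrier_infinite_dihedral inv_infinite_dihedral)
      moreover have "cnj (if snd g = 0 then 1 else -1) = (if snd g = 0 then 1 else -1)" by simp
      ultimately show ?thesis
        unfolding double_rep_def
        using is_adjoint_scaleC[OF is_adjoint_dihedral_op[OF g], of "if snd g = 0 then 1 else -1"]
        by (intro is_adjoint_block is_adjoint_0 is_adjoint_dihedral_op[OF g]) (simp only:)
    qed
    fix h x assume h: "h \<in> carrier infinite_dihedral"
    show "double_rep (g \<otimes>\<^bsub>infinite_dihedral\<^esub> h) x = double_rep g (double_rep h x)"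
      using g h
      by (auto simp: double_rep_def block_op_def case_prod_unfold dihedral_op_mult
          bounded_op_simps[OF bounded_op_dihedral_op] carrier_infinite_dihedral mult_infinite_dihedral
          simp flip: dihedral_op_mult)
  qed
  then obtain \<pi> where \<pi>: "star_rep \<pi>"
    "\<And>g. g \<in> carrier infinite_dihedral \<Longrightarrow> \<pi> (u g) = double_rep g"
    by blast
  have S: "\<pi> S = block_op shift_op (\<lambda>_. 0) (\<lambda>_. 0) shift_op"
    and e: "\<pi> e = block_op flip_op (\<lambda>_. 0) (\<lambda>_. 0) (\<lambda>x. - flip_op x)"
    by (simp_all add: \<pi> carrier_infinite_dihedral double_rep_def shift_op_eq flip_op_eq)
  have "rep1 S e = \<pi>"
    unfolding rep1_def
  proof (rule the_equality)
    show "\<rho> = \<pi>" if "star_rep \<rho> \<and> \<rho> S = block_op shift_op (\<lambda>_. 0) (\<lambda>_. 0) shift_op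
      \<and> \<rho> e = block_op flip_op (\<lambda>_. 0) (\<lambda>_. 0) (\<lambda>x. - flip_op x)" for \<rho>
      using that S e by (intro star_rep_unique \<pi>) auto
  qed (simp add: \<pi>(1) S e)
  then show "star_rep (rep1 S e)"
    "g \<in> carrier infinite_dihedral \<Longrightarrow> rep1 S e (u g) = double_rep g"
    using \<pi> by auto
qed

lemma commutator_F1:
  "commutator F1 (double_rep g) (x, y)
    = (((if snd g = 0 then 1 else -1) * \<i>) *\<^sub>C sign_defect g y, (- \<i>) *\<^sub>C sign_defect g x)"
  by (auto simp: commutator_def double_rep_def block_op_def F1_apply sign_defect_def
      bounded_op_simps[OF sign_op_simps(1)] bounded_op_simps[OF bounded_op_dihedral_op]
      scaleC_diff_right scaleC_add_right scaleC_minus_left scaleC_minus_right scaleC_scaleC)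

lemma compact_commutator_F1: "compact_op (commutator F1 (rep1 S e a))"
proof (induction a rule: dense_induct)
  case closed
  have "F1 \<circ> F1 = id" by (simp add: fun_eq_iff F1_F1)
  then show ?case by (intro closed_compact_commutator rep1 selfadjoint_F1)
next
  case (add a b)
  have "commutator F1 (rep1 S e (a + b))
      = (\<lambda>x. commutator F1 (rep1 S e a) x + commutator F1 (rep1 S e b) x)"
    using selfadjoint_F1
    by (auto simp: commutator_def star_repD[OF rep1] selfadjoint_op_def bounded_op_add)
  with add show ?case by (simp add: compact_op_add)
next
  case (scaleC c a)
  have "commutator F1 (rep1 S e (c *\<^sub>C a)) = (\<lambda>x. c *\<^sub>C commutator F1 (rep1 S e a) x)"
    using selfadjoint_F1
    by (auto simp: commutator_def star_repD[OF rep1] selfadjoint_op_def bounded_op_scaleC scaleC_diff_right)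
  with scaleC show ?case by (simp add: compact_op_scaleC)
next
  case (group g)
  define \<sigma> :: complex where "\<sigma> = (if snd g = 0 then 1 else -1) * \<i>"
  let ?w = "\<lambda>k. ket (if snd g = 0 then k - fst g else fst g - k)"
  have "commutator F1 (rep1 S e (u g)) = (\<lambda>(x, y).
      (\<Sum>k | defect_coeff g k \<noteq> 0. cinner (?w k) y *\<^sub>C (\<sigma> * defect_coeff g k) *\<^sub>C ket k,
       \<Sum>k | defect_coeff g k \<noteq> 0. cinner (?w k) x *\<^sub>C (- \<i> * defect_coeff g k) *\<^sub>C ket k))"
    unfolding rep1_u[OF group]
    by (auto simp: fun_eq_iff commutator_F1 sign_defect_finite_rank[of g] scaleC_sum_right scaleC_scaleC
        \<sigma>_def mult_ac)
  then show ?case by (simp only: compact_op_offdiagonal)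
qed

lemma one_eq: "(1::'a) = u (0, 0)"
  by (simp add: u_one flip: one_infinite_dihedral)

lemma is_projection_one: "is_projection (1::'a)"
  by (simp add: is_projection_def)

lemma is_projection_dihedral: "is_projection ((1/2) *\<^sub>C (1 + u (m, 1)))"
  by (rule is_projection_reflection)
    (simp_all add: u_star one_eq carrier_infinite_dihedral inv_infinite_dihedral
      mult_infinite_dihedral flip: u_mult)

lemma S_mult_e: "S * e = u (1, 1)"
  by (simp add: carrier_infinite_dihedral mult_infinite_dihedral flip: u_mult)

lemma orthonormal_basis_exists: "\<exists>B :: (int ell2 \<times> int ell2) set. orthonormal_basis B"
  using orthonormal_basis_prod[OF orthonormal_basis_ket orthonormal_basis_ket] by blast

lemma even_fredholm_w1: "even_fredholm_module (w1 S e)"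
  unfolding even_fredholm_module_def
proof (intro conjI allI)
  show "grading (w1 S e) \<circ> rep (w1 S e) a = rep (w1 S e) a \<circ> grading (w1 S e)" for a
  proof
    fix x :: "int ell2 \<times> int ell2"
    define \<gamma> :: "int ell2 \<times> int ell2 \<Rightarrow> int ell2 \<times> int ell2"
      where "\<gamma> = block_op id (\<lambda>_. 0) (\<lambda>_. 0) uminus"
    have bl: "bounded_op \<gamma>" using grading_simps(1)[where 'h = "int ell2"] by (simp add: selfadjoint_op_def \<gamma>_def)
    have "\<gamma> (rep1 S e a x) = rep1 S e a (\<gamma> x)"
    proof (induction a rule: dense_induct)
      case closed
      show ?case
        by (intro closed_Collect_eq linear_continuous_on star_rep_continuous rep1
            bounded_linear_compose[OF bounded_op_linear[OF bl]])
    next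
      case (group g)
      show ?case
        unfolding rep1_u[OF group]
        by (simp add: double_rep_def \<gamma>_def block_op_def case_prod_unfold
            bounded_op_minus[OF bounded_op_dihedral_op] scaleC_minus_right)
    qed (simp_all add: star_repD[OF rep1] bounded_op_add[OF bl] bounded_op_scaleC[OF bl])
    then show "(grading (w1 S e) \<circ> rep (w1 S e) a) x = (rep (w1 S e) a \<circ> grading (w1 S e)) x"
      by (simp add: w1_def \<gamma>_def)
  qed
  show "fop (w1 S e) (grading (w1 S e) x) = - grading (w1 S e) (fop (w1 S e) x)" for x
    by (cases x) (simp add: w1_def block_op_def bounded_op_minus[OF sign_op_simps(1)] scaleC_minus_right)
qed (simp_all add: w1_def rep1 grading_simps selfadjoint_F1 compact_commutator_F1 F1_F1 fun_eq_iff
    flip: F1_def)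

lemma even_fredholm_w2: "even_fredholm_module (w2 S e)"
proof -
  have "star_rep (rep1 S e \<circ> alpha_minus_one S e)"
    using rep1 alpha_minus_one(1) by (simp add: star_rep_def star_hom_def)
  then show ?thesis
    using even_fredholm_w1 by (simp add: even_fredholm_module_def w2_def) (simp add: w1_def)
qed

text \<open>The automorphism sends \<open>e\<close> to \<open>u (-1, 1)\<close> and \<open>S e\<close> to \<open>e\<close>, so the values for this module are among those
  of the previous one.\<close>

lemma has_chern_pairing_w2:
  assumes "is_projection p" "has_chern_pairing (w1 S e) (alpha_minus_one S e p) v"
  shows "has_chern_pairing (w2 S e) p v"
proof -
  have "chern_op (w2 S e) n (\<lambda>_. p) = chern_op (w1 S e) n (\<lambda>_. alpha_minus_one S e p)" for n
    by (simp add: chern_op_const w2_def w1_def)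
  then show ?thesis
    using assms by (simp add: has_chern_pairing_def chern_character_def)
qed

lemma alpha_one: "alpha_minus_one S e 1 = 1"
  using alpha_minus_one by (simp add: star_hom_def flip: star_S_S)

lemma alpha_projection:
  "alpha_minus_one S e ((1/2) *\<^sub>C (1 + a)) = (1/2) *\<^sub>C (1 + alpha_minus_one S e a)"
  using alpha_minus_one(1) by (simp add: star_hom_def alpha_one)

lemma alpha_e: "alpha_minus_one S e e = u (-1, 1)"
  unfolding alpha_minus_one
  by (simp add: u_star carrier_infinite_dihedral mult_infinite_dihedral inv_infinite_dihedral
      flip: u_mult)

lemma alpha_S_e: "alpha_minus_one S e (S * e) = e"
proof -
  have "alpha_minus_one S e (S * e) = S * (star S * e)"
    using alpha_minus_one by (simp add: star_hom_def)
  also have "\<dots> = e"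
    by (simp add: u_star carrier_infinite_dihedral mult_infinite_dihedral inv_infinite_dihedral
      flip: u_mult)
  finally show ?thesis .
qed

lemma rep1_one: "rep1 S e 1 x = x"
proof -
  have "dihedral_op (0, 0) y = y" for y by (rule ell2_eqI) (simp add: coord_dihedral_op)
  then show ?thesis
    by (cases x) (simp add: one_eq rep1_u carrier_infinite_dihedral double_rep_def block_op_def)
qed

lemma pairing_w1_one: "has_chern_pairing (w1 S e) 1 0"
proof -
  obtain B :: "(int ell2 \<times> int ell2) set" where B: "orthonormal_basis B"
    using orthonormal_basis_exists ..
  show ?thesis
  proof (rule has_chern_pairingI[OF even_fredholm_w1 is_projection_one, where Q = "\<lambda>_. 0" and r = 0])
    have 0: "rep (w1 S e) 1 0 = 0" "grading (w1 S e) 0 = 0"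
      by (simp_all add: w1_def rep1_one block_op_def zero_prod_def)
    show "commutator (fop (w1 S e)) (rep (w1 S e) 1) (commutator (fop (w1 S e)) (rep (w1 S e) 1) x) = - 0"
      for x by (simp add: commutator_def w1_def rep1_one)
    show "has_trace (\<lambda>x. grading (w1 S e) (rep (w1 S e) 1 0)) 0" "has_trace (\<lambda>x. rep (w1 S e) 1 0) 0"
      unfolding 0 by (rule has_trace_zero)+
  qed (auto intro: B)
qed

text \<open>Here \<open>- [F, p]\<^sup>2\<close> projects, in both summands, onto the span of those \<open>ket k\<close> whose sign the
  reflection \<open>k \<mapsto> m - k\<close> preserves.  The reflection acts with opposite signs on the two summands, so
  the graded trace of \<open>p\<close> on this range is the trace of the reflection, which counts
  its fixed points \<open>k = m / 2\<close>.  The cases \<open>m = 0, 1, -1\<close> occur in the table.\<close>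

lemma pairing_w1_reflection:
  "has_chern_pairing (w1 S e) ((1/2) *\<^sub>C (1 + u (m, 1))) (if even m then 1 else 0)"
proof -
  define p where "p = (1/2) *\<^sub>C (1 + u (m, 1))"
  define D where "D = dihedral_op (m, 1)"
  define X where "X = {k::int. (0 \<le> k) = (0 \<le> m - k)}"
  define Q where "Q x = (\<Sum>k\<in>X. cinner (ket k) x *\<^sub>C ket k)" for x :: "int ell2"
  \<comment> \<open>\<open>b 1 k\<close> and \<open>b (-1) k\<close> are the images of \<open>ket k\<close> under \<open>p\<close> in the first and the second summand.\<close>
  define b where "b s k = (1/2) *\<^sub>C (ket k + s *\<^sub>C ket (m - k))" for s :: complex and k
  have X: "finite X"
    by (rule finite_subset[of _ "{- \<bar>m\<bar> .. \<bar>m\<bar>}"]) (auto simp: X_def)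
  have Dket: "D (ket k) = ket (m - k)" for k
    by (rule ell2_eqI) (auto simp: D_def coord_dihedral_op coord_ket)
  have bD: "bounded_op D" by (simp add: D_def bounded_op_dihedral_op)
  have coordQ: "coord (Q x) k = (if k \<in> X then coord x k else 0)" for x k
    using X by (simp add: Q_def coord_sum coord_scaleC coord_ket cinner_ket if_distrib cong: if_cong)
  have QQ: "Q (Q x) = Q x" for x by (rule ell2_eqI) (simp add: coordQ)
  have gG: "(m, 1) \<in> carrier infinite_dihedral" by (simp add: carrier_infinite_dihedral)
  have rep_p: "rep1 S e p (x, y) = ((1/2) *\<^sub>C (x + D x), (1/2) *\<^sub>C (y - D y))" for x y
    by (simp add: p_def star_repD[OF rep1] rep1_one rep1_u[OF gG] double_rep_def block_op_def D_def
        scaleC_prod_def)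
  define C where "C = commutator F1 (rep1 S e p)"
  have C: "C (x, y) = ((- \<i> / 2) *\<^sub>C sign_defect (m, 1) y, (- \<i> / 2) *\<^sub>C sign_defect (m, 1) x)" for x y
  proof -
    have "C (x, y) = (1/2) *\<^sub>C commutator F1 (double_rep (m, 1)) (x, y)"
      using selfadjoint_F1
      by (simp add: C_def p_def commutator_def star_repD[OF rep1] rep1_one rep1_u[OF gG]
          selfadjoint_op_def bounded_op_simps scaleC_add_right scaleC_diff_right)
    then show ?thesis by (simp add: commutator_F1 scaleC_prod_def scaleC_scaleC)
  qed
  have defect2: "sign_defect (m, 1) (c *\<^sub>C sign_defect (m, 1) x) = (4 * c) *\<^sub>C Q x" for c x
    by (rule ell2_eqI)
      (auto simp: coord_sign_defect defect_coeff_def coordQ X_def coord_scaleC)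
  have rep_Q: "rep1 S e p (Q x, Q y)
      = (\<Sum>k\<in>X. cinner (ket k) x *\<^sub>C b 1 k, \<Sum>k\<in>X. cinner (ket k) y *\<^sub>C b (-1) k)" for x y
    by (simp add: rep_p Q_def bounded_op_sum[OF bD] bounded_op_scaleC[OF bD] Dket b_def
        scaleC_sum_right scaleC_scaleC scaleC_add_right scaleC_diff_right sum.distrib sum_subtractf mult.commute)
  obtain B :: "(int ell2 \<times> int ell2) set" where B: "orthonormal_basis B"
    using orthonormal_basis_exists ..
  have count: "(\<Sum>k\<in>X. cinner (ket k) (b 1 k)) + (\<Sum>k\<in>X. cinner (ket k) (- b (-1) k))
      = (if even m then 1 else 0)"
  proof -
    \<comment> \<open>The diagonal entries \<open>1/2\<close> of the identity cancel, and the two halves of the reflection add up.\<close>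
    have "(\<Sum>k\<in>X. cinner (ket k) (b 1 k)) + (\<Sum>k\<in>X. cinner (ket k) (- b (-1) k))
        = (\<Sum>k\<in>X. if k = m - k then 1 else 0)"
      unfolding sum.distrib[symmetric]
      by (intro sum.cong refl) (auto simp: b_def cinner_ket coord_scaleC coord_add coord_diff coord_ket)
    also have "\<dots> = of_nat (card {k \<in> X. k = m - k})" using X by (simp add: sum.If_cases Int_def)
    also have "{k \<in> X. k = m - k} = (if even m then {m div 2} else {})"
      by (auto simp: X_def)
    finally show ?thesis by simp
  qed
  have "has_chern_pairing (w1 S e) p (if even m then 1 else 0)"
  proof (rule has_chern_pairingI[where Q = "\<lambda>(x, y). (Q x, Q y)"])
    show "even_fredholm_module (w1 S e)" by (rule even_fredholm_w1)
    show "is_projection p" unfolding p_def by (rule is_projection_dihedral)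
    have "C (C z) = - (case z of (x, y) \<Rightarrow> (Q x, Q y))" for z
      by (cases z) (simp add: C defect2 scaleC_scaleC)
    then show "commutator (fop (w1 S e)) (rep (w1 S e) p) (commutator (fop (w1 S e)) (rep (w1 S e) p) z)
        = - (case z of (x, y) \<Rightarrow> (Q x, Q y))" for z
      by (simp add: w1_def C_def flip: F1_def)
    show "(case case z of (x, y) \<Rightarrow> (Q x, Q y) of (x, y) \<Rightarrow> (Q x, Q y)) = (case z of (x, y) \<Rightarrow> (Q x, Q y))"
      for z by (cases z) (simp add: QQ)
    have "(\<lambda>z. grading (w1 S e) (rep (w1 S e) p (case z of (x, y) \<Rightarrow> (Q x, Q y))))
        = (\<lambda>(x, y). (\<Sum>k\<in>X. cinner (ket k) x *\<^sub>C b 1 k, \<Sum>k\<in>X. cinner (ket k) y *\<^sub>C (- b (-1) k)))"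
      by (auto simp: fun_eq_iff w1_def rep_Q block_op_def scaleC_minus_right sum_negf)
    then show "has_trace (\<lambda>z. grading (w1 S e) (rep (w1 S e) p (case z of (x, y) \<Rightarrow> (Q x, Q y))))
        (if even m then 1 else 0)"
      using has_trace_diagonal_finite_rank[of ket "b 1" X ket "\<lambda>k. - b (-1) k"] by (simp only: count)
    have "(\<lambda>z. rep (w1 S e) p (case z of (x, y) \<Rightarrow> (Q x, Q y)))
        = (\<lambda>(x, y). (\<Sum>k\<in>X. cinner (ket k) x *\<^sub>C b 1 k, \<Sum>k\<in>X. cinner (ket k) y *\<^sub>C b (-1) k))"
      by (auto simp: fun_eq_iff w1_def rep_Q)
    then show "has_trace (\<lambda>z. rep (w1 S e) p (case z of (x, y) \<Rightarrow> (Q x, Q y)))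
        ((\<Sum>k\<in>X. cinner (ket k) (b 1 k)) + (\<Sum>k\<in>X. cinner (ket k) (b (-1) k)))"
      using has_trace_diagonal_finite_rank[of ket "b 1" X ket "b (-1)"] by (simp only:)
  qed (rule B)
  then show ?thesis by (simp only: p_def)
qed

abbreviation \<phi> :: "'a \<Rightarrow> complex" where "\<phi> \<equiv> trivial_character S e"

lemma w0_simps:
  "rep (w0 S e) a (x, y) = (\<phi> a * x, 0)" "fop (w0 S e) (x, y) = (y, x)"
  "grading (w0 S e) (x, y) = (x, - y)"
  by (simp_all add: w0_def block_op_def)

lemma commutator_w0: "commutator (fop (w0 S e)) (rep (w0 S e) a) (x, y) = (- (\<phi> a * y), \<phi> a * x)"
  by (simp add: commutator_def w0_simps)

lemma character_simps:
  "\<phi> (a + b) = \<phi> a + \<phi> b" "\<phi> (c *\<^sub>C a) = c * \<phi> a" "\<phi> (a * b) = \<phi> a * \<phi> b" "\<phi> (star a) = cnj (\<phi> a)"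
  using trivial_character(1) by (simp_all add: star_hom_def scaleC_complex_def star_complex_def)

lemma even_fredholm_w0: "even_fredholm_module (w0 S e)"
  unfolding even_fredholm_module_def
proof (intro conjI allI)
  have mult: "bounded_op (\<lambda>z. c * z)" for c :: complex
    using bounded_op_scaleC_op[of c, where 'a = complex] by (simp add: scaleC_complex_def[abs_def])
  show "star_rep (rep (w0 S e))"
    unfolding star_rep_def
  proof (intro conjI allI)
    show "bounded_op (rep (w0 S e) a)" for a
      by (simp add: w0_def) (intro bounded_op_block mult bounded_op_0)
    show "is_adjoint (rep (w0 S e) a) (rep (w0 S e) (star a))" for a
      by (auto simp: is_adjoint_def w0_simps cinner_prod_def cinner_complex_def character_simps)
  qed (auto simp: fun_eq_iff w0_simps character_simps scaleC_prod_def scaleC_complex_def algebra_simps)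
  show "selfadjoint_op (fop (w0 S e))"
    unfolding w0_def selfadjoint_op_def id_def graded_module.simps
    by (intro conjI bounded_op_block is_adjoint_block bounded_op_id bounded_op_0 is_adjoint_id is_adjoint_0)
  show "compact_op (commutator (fop (w0 S e)) (rep (w0 S e) a))" for a
  proof -
    have "commutator (fop (w0 S e)) (rep (w0 S e) a) = (\<lambda>(x, y).
        (\<Sum>k\<in>{()}. cinner 1 y *\<^sub>C (- \<phi> a), \<Sum>k\<in>{()}. cinner 1 x *\<^sub>C \<phi> a))"
      by (auto simp: fun_eq_iff commutator_w0 cinner_complex_def scaleC_complex_def)
    then show ?thesis by (simp only: compact_op_offdiagonal)
  qed
  show "selfadjoint_op (grading (w0 S e))" "grading (w0 S e) \<circ> grading (w0 S e) = id"
    using grading_simps[where 'h = complex] by (simp_all add: w0_def)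
qed (auto simp: fun_eq_iff w0_simps)

text \<open>The commutator \<open>[F, p]\<close> is \<open>((0, -1), (1, 0))\<close>, with square \<open>-1\<close>, and the graded trace of \<open>p\<close> is \<open>\<phi> p\<close>,
  since the second summand carries the zero representation.\<close>

lemma pairing_w0:
  assumes p: "is_projection p" and \<phi>: "\<phi> p = 1"
  shows "has_chern_pairing (w0 S e) p 1"
proof (rule has_chern_pairingI[OF even_fredholm_w0 p, where Q = "\<lambda>x. x" and r = 1])
  show "commutator (fop (w0 S e)) (rep (w0 S e) p) (commutator (fop (w0 S e)) (rep (w0 S e) p) x) = - x" for x
    by (cases x) (simp add: commutator_w0 \<phi>)
  have "has_trace (\<lambda>(x::complex, y::complex). (\<Sum>k\<in>{()}. cinner 1 x *\<^sub>C (1::complex),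
      \<Sum>k\<in>{()}. cinner 0 y *\<^sub>C (0::complex))) 1"
    using has_trace_diagonal_finite_rank[of "\<lambda>_. 1::complex" "\<lambda>_. 1" "{()}" "\<lambda>_. 0::complex" "\<lambda>_. 0"]
    by (simp add: cinner_complex_def)
  also have "(\<lambda>(x::complex, y::complex). (\<Sum>k\<in>{()}. cinner 1 x *\<^sub>C (1::complex),
      \<Sum>k\<in>{()}. cinner 0 y *\<^sub>C (0::complex))) = (\<lambda>(x, y). (x, 0))"
    by (simp add: cinner_complex_def scaleC_complex_def)
  finally have tr: "has_trace (\<lambda>(x::complex, y::complex). (x, 0::complex)) 1" .
  have eq: "(\<lambda>x. grading (w0 S e) (rep (w0 S e) p x)) = (\<lambda>(x, y). (x, 0))"
    "(\<lambda>x. rep (w0 S e) p x) = (\<lambda>(x, y). (x, 0))"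
    by (auto simp: fun_eq_iff w0_simps \<phi>)
  show "has_trace (\<lambda>x. grading (w0 S e) (rep (w0 S e) p x)) 1"
    using tr by (simp only: eq(1))
  show "has_trace (\<lambda>x. rep (w0 S e) p x) 1"
    using tr by (simp only: eq(2))
qed (auto intro: orthonormal_basis_prod orthonormal_basis_complex)

lemma character_one: "\<phi> 1 = 1"
  using trivial_character(2) by (simp add: character_simps flip: star_S_S)

lemma character_reflections:
  "\<phi> ((1/2) *\<^sub>C (1 + e)) = 1" "\<phi> ((1/2) *\<^sub>C (1 + S * e)) = 1"
  using trivial_character by (simp_all add: character_simps character_one)

lemmas projections =
  is_projection_one is_projection_dihedral[of 0] is_projection_dihedral[of 1, folded S_mult_e]

lemma pairings_w0:
  "has_chern_pairing (w0 S e) 1 1"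
  "has_chern_pairing (w0 S e) ((1/2) *\<^sub>C (1 + e)) 1"
  "has_chern_pairing (w0 S e) ((1/2) *\<^sub>C (1 + S * e)) 1"
  by (intro pairing_w0 projections character_one character_reflections)+

lemma pairings_w1:
  "has_chern_pairing (w1 S e) ((1/2) *\<^sub>C (1 + e)) 1"
  "has_chern_pairing (w1 S e) ((1/2) *\<^sub>C (1 + S * e)) 0"
  using pairing_w1_reflection[of 0] pairing_w1_reflection[of 1] by (simp_all add: S_mult_e)

lemma pairings_w2:
  "has_chern_pairing (w2 S e) 1 0"
  "has_chern_pairing (w2 S e) ((1/2) *\<^sub>C (1 + e)) 0"
  "has_chern_pairing (w2 S e) ((1/2) *\<^sub>C (1 + S * e)) 1"
proof -
  show "has_chern_pairing (w2 S e) 1 0"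
    by (rule has_chern_pairing_w2[OF projections(1)]) (simp add: alpha_one pairing_w1_one)
  show "has_chern_pairing (w2 S e) ((1/2) *\<^sub>C (1 + e)) 0"
    using pairing_w1_reflection[of "-1"]
    by (intro has_chern_pairing_w2[OF projections(2)]) (simp add: alpha_projection alpha_e)
  show "has_chern_pairing (w2 S e) ((1/2) *\<^sub>C (1 + S * e)) 1"
    using pairing_w1_reflection[of 0]
    by (intro has_chern_pairing_w2[OF projections(3)]) (simp add: alpha_projection alpha_S_e)
qed

end

theorem proposition8:
  fixes u :: "int \<times> int \<Rightarrow> 'a::cstar_algebra" and S e :: 'a
  assumes A: "group_cstar_algebra infinite_dihedral u"
    and S: "S = u (1, 0)"
    and e: "e = u (0, 1)"
  shows "even_fredholm_module (w0 S e) \<and>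
    even_fredholm_module (w1 S e) \<and>
    even_fredholm_module (w2 S e) \<and>
    has_chern_pairing (w0 S e) 1 1 \<and>
    has_chern_pairing (w0 S e) ((1/2) *\<^sub>C (1 + e)) 1 \<and>
    has_chern_pairing (w0 S e) ((1/2) *\<^sub>C (1 + S * e)) 1 \<and>
    has_chern_pairing (w1 S e) 1 0 \<and>
    has_chern_pairing (w1 S e) ((1/2) *\<^sub>C (1 + e)) 1 \<and>
    has_chern_pairing (w1 S e) ((1/2) *\<^sub>C (1 + S * e)) 0 \<and>
    has_chern_pairing (w2 S e) 1 0 \<and>
    has_chern_pairing (w2 S e) ((1/2) *\<^sub>C (1 + e)) 0 \<and>
    has_chern_pairing (w2 S e) ((1/2) *\<^sub>C (1 + S * e)) 1"
proof -
  interpret dihedral_cstar u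
    by (intro dihedral_cstar.intro group_cstar.intro group_infinite_dihedral
        group_cstar_axioms.intro A)
  show ?thesis
    unfolding S e
    by (intro conjI even_fredholm_w0 even_fredholm_w1 even_fredholm_w2
        pairings_w0 pairing_w1_one pairings_w1 pairings_w2)
qed

end
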